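(* Let $n>1$ take values in an infinite set of positive odd square-free integers such that $$\frac{\max\big(4^{\omega(n)}(\log n)^6,\;5^{\omega(n)}\big)}{\kappa(n)}\to0\quad\text{as } n\to\infty.$$ Let $X_n$ be the Jacobi sequence of length $n$, let $R$ and $T>0$ be real, and let $r$ and $t\ge0$ be integers that may depend on $n$. Then the following hold, as $n\to\infty$: (i) If $r/n\to R$ and $t/n\to T$, then $F(X_n^{r,t})\to g(R,T)$. (ii) If $r/(2n)\to R$ and $t/(2n)\to T$, then $F(N(X_n)^{r,t})\to g(R+\tfrac14,T)$. (iii) If $r/(4n)\to R$ and $t/(4n)\to T$, then $F(P(X_n)^{r,t})\to g(R,T)$.
   Context: $\omega(n)$ denotes the number of distinct prime divisors of $n$ and $\kappa(n)$ the smallest prime divisor of $n$. A binary sequence of length $t>1$ is an element $A=(a_0,\dots,a_{t-1})\in\{-1,1\}^t$. Its aperiodic autocorrelation at shift $u\in\{0,\dots,t-1\}$ is $c_u=\sum_{j=0}^{t-u-1}a_ja_{j+u}$, and its merit factor is $F(A)=\dfrac{t^2}{2\sum_{u=1}^{t-1}c_u^2}$. A binary sequence $(a_0,\dots,a_{n-1})$ is identified with the polynomial $A(z)=\sum_{j=0}^{n-1}a_jz^j$, of which it is called the coefficient sequence; $F(A)$ denotes the merit factor of the coefficient sequence. Extend $a_j$ to all $j\in\mathbb{Z}$ by $a_{j+n}=a_j$. For integers $r$ and $t\ge0$ define $A^{r,t}(z)=\sum_{j=0}^{t-1}a_{j+r}z^j$ (a sequence of length $t$). Define two polynomials of length $4n$: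 $$N(A)(z)=\sum_{j=0}^{4n-1}(-1)^{j(j-1)/2}a_jz^j,\qquad P(A)(z)=\sum_{j=0}^{4n-1}(-1)^{j(j-1)^2/2}a_jz^j.$$ In $N(A)^{r,t}$ and $P(A)^{r,t}$ the operation $(\cdot)^{r,t}$ is applied to the length-$4n$ sequences $N(A)$ and $P(A)$, extended with period $4n$. For $j\in\mathbb{Z}$ and $n$ a positive odd integer, $(j\mid n)$ is the Jacobi symbol, extending the Legendre symbol via $(j\mid1)=1$ and $(j\mid n_1)(j\mid n_2)=(j\mid n_1n_2)$. For $n$ positive, odd and square-free, the Jacobi sequence of length $n$ is the coefficient sequence of $X_n(z)=\sum_{j=0}^{n-1}\big(j\,\big|\,\tfrac{n}{\gcd(j,n)}\big)z^j$, where $\gcd(0,n)=n$. The function $g:\mathbb{R}\times\mathbb{R}^+\to\mathbb{R}$ is defined by $$\frac{1}{g(R,T)}=1-\frac{4T}{3}+4\sum_{m\in\mathbb{N}}\max\Big(0,1-\frac{m}{T}\Big)^2+\sum_{m\in\mathbb{Z}}\max\Big(0,1-\Big|1+\frac{2R-m}{T}\Big|\Big)^2,$$ where $\mathbb{N}$ is the set of positive integers. *)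

theory Defs
  imports
    "HOL-Analysis.Analysis"
    "HOL-Computational_Algebra.Squarefree"
    "HOL-Number_Theory.Residues"
begin

definition omega :: "nat \<Rightarrow> nat" where
  "omega n = card (prime_factors n)"

definition kappa :: "nat \<Rightarrow> nat" where
  "kappa n = Min (prime_factors n)"

text \<open>
  A sequence of length \<open>t\<close> is a list of length \<open>t\<close>, identified with the polynomial whose
  coefficients it lists. The list keeps track of the length, which matters for every operation below.
\<close>

definition autocorrelation :: "int list \<Rightarrow> nat \<Rightarrow> int" where
  "autocorrelation A u = (\<Sum>j<length A - u. A ! j * A ! (j + u))"

text \<open>
  Meaningful for binary sequences of length greater than 1; their autocorrelation at the last shift
  is \<open>1\<close> or \<open>-1\<close>, so the denominator is positive.
\<close>

definition merit_factor :: "int list \<Rightarrow> real" where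
  "merit_factor A =
     real (length A) ^ 2 / (2 * (\<Sum>u = 1..length A - 1. real_of_int (autocorrelation A u) ^ 2))"

definition periodic_ext :: "int list \<Rightarrow> int \<Rightarrow> int" where
  "periodic_ext A j = A ! nat (j mod int (length A))"

text \<open>The sequence usually written \<open>A\<close> with superscripts \<open>r, t\<close>.\<close>

definition rotate_resize :: "int list \<Rightarrow> int \<Rightarrow> nat \<Rightarrow> int list" where
  "rotate_resize A r t = map (\<lambda>j. periodic_ext A (int j + r)) [0..<t]"

text \<open>
  In the exponents the truncated subtraction \<open>j - 1\<close> is harmless (it only truncates at \<open>j = 0\<close>,
  where the factor \<open>j\<close> vanishes), and the divisions by 2 are exact.
\<close>

definition N_seq :: "int list \<Rightarrow> int list" where
  "N_seq A =
     map (\<lambda>j. (-1) ^ (j * (j - 1) div 2) * periodic_ext A (int j)) [0..<4 * length A]"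

definition P_seq :: "int list \<Rightarrow> int list" where
  "P_seq A =
     map (\<lambda>j. (-1) ^ (j * (j - 1) ^ 2 div 2) * periodic_ext A (int j)) [0..<4 * length A]"

text \<open>The Jacobi symbol \<open>(j | n)\<close>, relevant for positive odd \<open>n\<close>.\<close>

definition Jacobi :: "int \<Rightarrow> nat \<Rightarrow> int" where
  "Jacobi j n = (\<Prod>p\<in>#prime_factorization n. Legendre j (int p))"

lemma Jacobi_1: "Jacobi j 1 = 1"
  by (simp add: Jacobi_def)

lemma Jacobi_prime: "prime p \<Longrightarrow> Jacobi j p = Legendre j (int p)"
  by (simp add: Jacobi_def prime_factorization_prime)

lemma Jacobi_mult: "m > 0 \<Longrightarrow> n > 0 \<Longrightarrow> Jacobi j (m * n) = Jacobi j m * Jacobi j n"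
  by (simp add: Jacobi_def prime_factorization_mult)

definition Jacobi_seq :: "nat \<Rightarrow> int list" where
  "Jacobi_seq n = map (\<lambda>j. Jacobi (int j) (n div gcd j n)) [0..<n]"

lemma Jacobi_seq_binary:
  assumes "squarefree n"
  shows "set (Jacobi_seq n) \<subseteq> {-1, 1}"
proof -
  have "Jacobi (int j) (n div gcd j n) \<in> {-1, 1}" if "j < n" for j
  proof -
    have coprime: "\<not> p dvd j" if p: "p \<in> prime_factors (n div gcd j n)" for p
    proof
      assume "p dvd j"
      from p have pp: "prime p" and d: "p dvd n div gcd j n" by auto
      have n: "gcd j n * (n div gcd j n) = n" by (rule dvd_mult_div_cancel) simp
      from d have "p dvd gcd j n * (n div gcd j n)" by (rule dvd_mult)
      then have "p dvd n" unfolding n .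
      with \<open>p dvd j\<close> have "p dvd gcd j n" by simp
      with d have "p * p dvd gcd j n * (n div gcd j n)" by (intro mult_dvd_mono) simp_all
      then have "p ^ 2 dvd n" unfolding n power2_eq_square .
      with assms have "p dvd 1" unfolding squarefree_def by blast
      with pp show False by simp
    qed
    have "(\<Prod>p\<in>#M. Legendre (int j) (int p)) \<in> {-1, 1}"
      if "\<And>p. p \<in># M \<Longrightarrow> \<not> p dvd j" for M :: "nat multiset"
      using that
    proof (induction M)
      case (add q M)
      have "\<not> q dvd j" using add.prems by simp
      then have "Legendre (int j) (int q) \<in> {-1, 1}"
        by (auto simp: Legendre_def cong_0_iff)
      moreover have "(\<Prod>p\<in>#M. Legendre (int j) (int p)) \<in> {-1, 1}"
        using add by simp
      ultimately show ?case by auto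
    qed simp
    with coprime show ?thesis unfolding Jacobi_def by blast
  qed
  then show ?thesis unfolding Jacobi_seq_def set_map set_upt by (intro image_subsetI) simp
qed

abbreviation at_top_in :: "nat set \<Rightarrow> nat filter" where
  "at_top_in S \<equiv> inf at_top (principal S)"

definition limit_merit :: "real \<Rightarrow> real \<Rightarrow> real" where
  "limit_merit R T =
     1 / (1 - 4 * T / 3
          + 4 * (\<Sum>\<^sub>\<infinity>m\<in>{1::nat..}. (max 0 (1 - real m / T)) ^ 2)
          + (\<Sum>\<^sub>\<infinity>m\<in>(UNIV::int set). (max 0 (1 - \<bar>1 + (2 * R - real_of_int m) / T\<bar>)) ^ 2))"

end

theory Submission
  imports Defs "HOL-Number_Theory.Number_Theory" "HOL-Real_Asymp.Real_Asymp"
begin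

text \<open>
  For a binary sequence of length \<open>t\<close> and merit factor \<open>F\<close>, the number \<open>t^2 * (1 + 1/F)\<close> is the sum over all
  additive quadruples \<open>j1 + j2 = j3 + j4\<close> of window positions of the product of the four entries
  (\<open>quad_energy\<close>). The proof expands the entries in a Fourier series over a period \<open>m\<close> of the sequence.
  A common shift of the four frequencies \<open>k1, k2, k3, k4\<close> does not change the exponential sum over the
  quadruples (\<open>quad_char\<close>), so that only the shift average \<open>corr4\<close> of the product of the four Fourier
  coefficients matters (\<open>quad_sum_spectral\<close>).

  The Fourier coefficients of the Jacobi sequence are products over the primes \<open>p\<close> dividing \<open>n\<close> of
  \<open>g p * (k | p) + 1\<close> with \<open>|g p|^2 = p\<close> (\<open>dft_jac\<close>), hence \<open>corr4\<close> is a product of local factors, and these are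
  governed by sums of \<open>(x + k1 | p) (x + k2 | p) (x + k3 | p) (x + k4 | p)\<close>. If the \<open>k\<close>'s coincide in pairs
  modulo \<open>p\<close>, the local factor is nearly \<open>p^3\<close>; otherwise it is smaller by a factor of order \<open>p^(-1/4)\<close>
  (\<open>four_sum_unpaired\<close>). This saving comes from a fourth moment over all polynomials of
  degree at most 3: their values at four distinct points are independent, which makes the moment small
  (\<open>cubic_fourth_moment\<close>), and about \<open>p^3\<close> of these \<open>p^4\<close> polynomials give the same character sum up to
  sign.

  So the quadruples of frequencies that are paired modulo \<open>m\<close> should give the main term. For an unpaired
  quadruple, either the primes at which it is unpaired have a product of at least \<open>n^(1/4)\<close>, and then
  \<open>corr4\<close> is small, or it is paired modulo a divisor \<open>e\<close> of \<open>n\<close> with \<open>n^(1/4) \<le> e\<close>; then two of its frequencies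
  differ by a nonzero multiple of \<open>e\<close>, and the Dirichlet kernels that bound \<open>quad_char\<close> are small. Both cases
  save a power of \<open>n\<close>, which beats the losses \<open>38^omega n\<close> and \<open>ln n ^ 4\<close>, because \<open>kappa n\<close> tends to infinity
  and \<open>kappa n ^ omega n \<le> n\<close>. On the paired quadruples the relative error is of order
  \<open>omega n / sqrt (kappa n)\<close> and the kernels lose \<open>ln n ^ 2\<close>; the growth hypothesis controls this product.

  For the main term, orthogonality turns the three kinds of pairs back into counts of additive quadruples
  with \<open>m\<close> dividing \<open>j1 - j3\<close>, \<open>j1 - j4\<close> and \<open>j1 + j2 + 2 r + h\<close>, and the quadruples of equal frequencies, which
  have been counted three times, contribute \<open>- 2/m\<close> times the number of all additive quadruples
  (\<open>main_term\<close>). Divided by \<open>t^2\<close>, these counts tend to the sums of squared tent functions in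
  \<open>1 / limit_merit\<close> and to \<open>4 T / 3\<close>.

  The three families differ only in a factor \<open>\<tau>\<close> of period 1, 2 or 4 whose Fourier coefficients have
  constant modulus. Multiplying a sequence by \<open>\<i>^j\<close> does not change its quadruple sum, and it turns the
  sign pattern \<open>+ + - -\<close> of \<open>N_seq\<close> into the pattern \<open>1, \<i>\<close> of period 2; the squares of its Fourier
  coefficients alternate in sign, which is the phase \<open>h = n = m/2\<close> and explains the summand \<open>1/4\<close>. The
  pattern \<open>+ + - +\<close> of \<open>P_seq\<close> has Fourier coefficients \<open>2, 2, -2, 2\<close>, whose squares are constant.

  It remains to see that the limit of \<open>1/F\<close> is not zero. For \<open>T > 1\<close> the periodicity forces a large
  autocorrelation at shift \<open>m\<close> (\<open>quad_energy_ge\<close>), and for \<open>T \<le> 1\<close> this is a convexity argument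
  (\<open>limit_denominator_pos_short\<close>).
\<close>

section \<open>Sums over a complete set of residues\<close>

abbreviation res :: "nat \<Rightarrow> int set" where
  "res m \<equiv> {0..<int m}"

abbreviation sum4 :: "int set \<Rightarrow> (int \<Rightarrow> int \<Rightarrow> int \<Rightarrow> int \<Rightarrow> 'a::comm_monoid_add) \<Rightarrow> 'a" where
  "sum4 A F \<equiv> \<Sum>k1\<in>A. \<Sum>k2\<in>A. \<Sum>k3\<in>A. \<Sum>k4\<in>A. F k1 k2 k3 k4"

definition periodic :: "nat \<Rightarrow> (int \<Rightarrow> 'a) \<Rightarrow> bool" where
  "periodic m f \<longleftrightarrow> (\<forall>x. f (x mod int m) = f x)"

lemma periodic_congD:
  assumes "periodic m f" "[x = y] (mod int m)"
  shows "f x = f y"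
  using assms unfolding periodic_def cong_def by metis

lemma periodicI_cong:
  assumes "\<And>x y. [x = y] (mod int m) \<Longrightarrow> f x = f y"
  shows "periodic m f"
  unfolding periodic_def by (auto intro!: assms)

lemma periodicI_add:
  assumes "\<And>x. f (x + int m) = f x"
  shows "periodic m f"
proof -
  have up: "f (x + int m * int k) = f x" for x k
  proof (induction k)
    case (Suc k)
    have "f (x + int m * int (Suc k)) = f ((x + int m * int k) + int m)"
      by (simp add: algebra_simps)
    with Suc assms show ?case by simp
  qed simp
  have "f (x + int m * k) = f x" for x k
  proof (cases "k \<ge> 0")
    case True
    then show ?thesis using up[of x "nat k"] by simp
  next
    case False
    then show ?thesis using up[of "x + int m * k" "nat (- k)"] by simp
  qed
  from this[of "_ mod int m" "_ div int m"] show ?thesis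
    unfolding periodic_def by (metis mult.commute mod_mult_div_eq)
qed

lemma periodic_mult:
  fixes f g :: "int \<Rightarrow> 'a::times"
  assumes "periodic m f" "periodic m g"
  shows "periodic m (\<lambda>x. f x * g x)"
  using assms by (simp add: periodic_def)

lemma sum_residues_reindex:
  fixes f :: "int \<Rightarrow> 'a::comm_monoid_add"
  assumes "m > 0" "periodic m f"
    and inj: "\<And>x y. x \<in> res m \<Longrightarrow> y \<in> res m \<Longrightarrow> [h x = h y] (mod int m) \<Longrightarrow> x = y"
  shows "(\<Sum>x\<in>res m. f (h x)) = (\<Sum>x\<in>res m. f x)"
proof -
  let ?h = "\<lambda>x. h x mod int m"
  have i: "inj_on ?h (res m)" by (intro inj_onI inj) (simp_all add: cong_def)
  have s: "?h ` res m \<subseteq> res m" using assms(1) by auto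
  have "?h ` res m = res m" by (rule endo_inj_surj[OF _ s i]) simp
  then have "(\<Sum>x\<in>res m. f x) = (\<Sum>x\<in>res m. f (?h x))"
    using sum.reindex[OF i, of f] by (simp add: o_def)
  then show ?thesis using assms(2) by (simp add: periodic_def)
qed

lemma sum_residues_affine:
  fixes f :: "int \<Rightarrow> 'a::comm_monoid_add"
  assumes "m > 0" "periodic m f" "coprime u (int m)"
  shows "(\<Sum>x\<in>res m. f (u * x + v)) = (\<Sum>x\<in>res m. f x)"
proof (rule sum_residues_reindex[OF assms(1,2)])
  fix x y assume xy: "x \<in> res m" "y \<in> res m" "[u * x + v = u * y + v] (mod int m)"
  from xy(3) have "[x = y] (mod int m)"
    using assms(3) by (simp add: cong_add_rcancel cong_mult_lcancel)
  with xy(1,2) show "x = y" by (simp add: cong_def)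
qed

lemma sum_residues_shift:
  fixes f :: "int \<Rightarrow> 'a::comm_monoid_add"
  assumes "m > 0" "periodic m f"
  shows "(\<Sum>x\<in>res m. f (x + v)) = (\<Sum>x\<in>res m. f x)"
  using sum_residues_affine[OF assms, of 1 v] by simp

lemma sum_residues_shift4:
  fixes F :: "int \<Rightarrow> int \<Rightarrow> int \<Rightarrow> int \<Rightarrow> 'a::comm_monoid_add"
  assumes "m > 0"
    and "\<And>x y z. periodic m (\<lambda>w. F w x y z)" "\<And>x y z. periodic m (\<lambda>w. F x w y z)"
    and "\<And>x y z. periodic m (\<lambda>w. F x y w z)" "\<And>x y z. periodic m (\<lambda>w. F x y z w)"
  shows "sum4 (res m) (\<lambda>k1 k2 k3 k4. F (k1 + a) (k2 + b) (k3 + c) (k4 + d))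
       = sum4 (res m) (\<lambda>k1 k2 k3 k4. F k1 k2 k3 k4)"
proof -
  have "sum4 (res m) (\<lambda>k1 k2 k3 k4. F (k1 + a) (k2 + b) (k3 + c) (k4 + d))
     = sum4 (res m) (\<lambda>k1 k2 k3 k4. F (k1 + a) (k2 + b) (k3 + c) k4)"
    by (intro sum.cong refl sum_residues_shift[OF assms(1)] assms)
  also have "\<dots> = sum4 (res m) (\<lambda>k1 k2 k3 k4. F (k1 + a) (k2 + b) k3 k4)"
    using assms(4) by (intro sum.cong refl sum_residues_shift[OF assms(1)]) (simp add: periodic_def)
  also have "\<dots> = sum4 (res m) (\<lambda>k1 k2 k3 k4. F (k1 + a) k2 k3 k4)"
    using assms(3) by (intro sum.cong refl sum_residues_shift[OF assms(1)]) (simp add: periodic_def)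
  also have "\<dots> = sum4 (res m) (\<lambda>k1 k2 k3 k4. F k1 k2 k3 k4)"
    using assms(2) by (intro sum_residues_shift[OF assms(1)]) (simp add: periodic_def)
  finally show ?thesis .
qed

lemma power4_sum:
  fixes g :: "int \<Rightarrow> 'a::comm_semiring_1"
  shows "(\<Sum>x\<in>A. g x) ^ 4 = sum4 A (\<lambda>x1 x2 x3 x4. g x1 * g x2 * g x3 * g x4)"
  by (simp only: sum_distrib_left[symmetric] sum_distrib_right[symmetric] power4_eq_xxxx)

lemma sum_swap4:
  "(\<Sum>l\<in>A. \<Sum>x1\<in>B. \<Sum>x2\<in>C. \<Sum>x3\<in>D. \<Sum>x4\<in>E. f l x1 x2 x3 x4)
     = (\<Sum>x1\<in>B. \<Sum>x2\<in>C. \<Sum>x3\<in>D. \<Sum>x4\<in>E. \<Sum>l\<in>A. f l x1 x2 x3 x4)"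
  apply (rule trans[OF sum.swap], rule sum.cong[OF refl])
  apply (rule trans[OF sum.swap], rule sum.cong[OF refl])
  apply (rule trans[OF sum.swap], rule sum.cong[OF refl])
  apply (rule sum.swap)
  done

lemma sum_pairings:
  assumes "finite A"
  shows "sum4 A (\<lambda>x1 x2 x3 x4. of_bool (x1 = x2 \<and> x3 = x4)) = (of_nat (card A) ^ 2 :: 'a::comm_semiring_1)"
    and "sum4 A (\<lambda>x1 x2 x3 x4. of_bool (x1 = x3 \<and> x2 = x4)) = (of_nat (card A) ^ 2 :: 'a::comm_semiring_1)"
    and "sum4 A (\<lambda>x1 x2 x3 x4. of_bool (x1 = x4 \<and> x2 = x3)) = (of_nat (card A) ^ 2 :: 'a::comm_semiring_1)"
proof -
  have d: "(\<Sum>y\<in>A. of_bool (x = y)) = (1 :: 'a)" if "x \<in> A" for x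
    using assms that by (simp add: of_bool_def)
  have "sum4 A (\<lambda>x1 x2 x3 x4. of_bool (x1 = x2 \<and> x3 = x4)) = (\<Sum>x1\<in>A. \<Sum>x2\<in>A. \<Sum>x3\<in>A. of_bool (x1 = x2) :: 'a)"
    by (simp only: of_bool_conj sum_distrib_left[symmetric]) (simp add: d mult.commute)
  also have "\<dots> = (\<Sum>x1\<in>A. of_nat (card A) * (\<Sum>x2\<in>A. of_bool (x1 = x2)))"
    by (simp only: sum_constant sum_distrib_left)
  finally show "sum4 A (\<lambda>x1 x2 x3 x4. of_bool (x1 = x2 \<and> x3 = x4)) = (of_nat (card A) ^ 2 :: 'a)"
    by (simp add: d power2_eq_square)
  have "sum4 A (\<lambda>x1 x2 x3 x4. of_bool (x1 = x3 \<and> x2 = x4)) = (\<Sum>x1\<in>A. \<Sum>x2\<in>A. \<Sum>x3\<in>A. of_bool (x1 = x3) :: 'a)"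
    by (simp only: of_bool_conj sum_distrib_left[symmetric]) (simp add: d)
  then show "sum4 A (\<lambda>x1 x2 x3 x4. of_bool (x1 = x3 \<and> x2 = x4)) = (of_nat (card A) ^ 2 :: 'a)"
    by (simp add: d power2_eq_square)
  have "sum4 A (\<lambda>x1 x2 x3 x4. of_bool (x1 = x4 \<and> x2 = x3)) = (\<Sum>x1\<in>A. \<Sum>x2\<in>A. \<Sum>x3\<in>A. of_bool (x2 = x3) :: 'a)"
    by (simp only: of_bool_conj sum_distrib_right[symmetric]) (simp add: d)
  then show "sum4 A (\<lambda>x1 x2 x3 x4. of_bool (x1 = x4 \<and> x2 = x3)) = (of_nat (card A) ^ 2 :: 'a)"
    by (simp add: d power2_eq_square)
qed

definition paired :: "nat \<Rightarrow> int \<Rightarrow> int \<Rightarrow> int \<Rightarrow> int \<Rightarrow> bool" where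
  "paired m k1 k2 k3 k4 \<longleftrightarrow>
     ([k1 = k2] (mod int m) \<and> [k3 = k4] (mod int m)) \<or>
     ([k1 = k3] (mod int m) \<and> [k2 = k4] (mod int m)) \<or>
     ([k1 = k4] (mod int m) \<and> [k2 = k3] (mod int m))"

section \<open>Character sums modulo a prime\<close>

locale odd_prime =
  fixes p :: nat
  assumes prime_p: "prime p" and odd_p: "odd p"
begin

abbreviation chi :: "int \<Rightarrow> int" where
  "chi x \<equiv> Legendre x (int p)"

lemma p_gt_2: "p > 2"
  using prime_p odd_p prime_ge_2_nat[of p] by (cases "p = 2") auto

lemma prime_int: "prime (int p)"
  using prime_p by simp

lemma chi_cases: "chi x = 0 \<and> int p dvd x \<or> (chi x = 1 \<or> chi x = -1) \<and> \<not> int p dvd x"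
  by (auto simp: Legendre_def cong_0_iff)

lemma abs_chi_le: "\<bar>chi x\<bar> \<le> 1"
  using chi_cases[of x] by auto

lemma chi_eq_0: "int p dvd x \<Longrightarrow> chi x = 0"
  using chi_cases[of x] by auto

lemma abs_chi: "\<not> int p dvd x \<Longrightarrow> \<bar>chi x\<bar> = 1"
  using chi_cases[of x] by auto

lemma chi_square: "\<not> int p dvd x \<Longrightarrow> chi x * chi x = 1"
  using chi_cases[of x] by auto

lemma chi_cong:
  assumes "[x = y] (mod int p)"
  shows "chi x = chi y"
proof -
  have "[x = 0] (mod int p) \<longleftrightarrow> [y = 0] (mod int p)"
    "[z = x] (mod int p) \<longleftrightarrow> [z = y] (mod int p)" for z
    using assms by (simp_all add: cong_def)
  then show ?thesis by (simp add: Legendre_def QuadRes_def)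
qed

lemma periodic_chi: "periodic p chi"
  by (rule periodicI_cong) (rule chi_cong)

lemma chi_mult: "chi (x * y) = chi x * chi y"
proof -
  have E: "[chi z = z ^ ((p - 1) div 2)] (mod int p)" for z
    using euler_criterion[OF prime_p p_gt_2, of z] by simp
  have "[chi (x * y) = chi x * chi y] (mod int p)"
    using E[of "x * y"] cong_mult[OF E[of x] E[of y]]
    by (metis cong_sym cong_trans power_mult_distrib)
  then have d: "int p dvd chi (x * y) - chi x * chi y"
    by (simp add: cong_iff_dvd_diff)
  have "\<bar>chi (x * y) - chi x * chi y\<bar> \<le> 2"
    using chi_cases[of x] chi_cases[of y] chi_cases[of "x * y"] by auto
  then have "\<bar>chi (x * y) - chi x * chi y\<bar> < int p" using p_gt_2 by linarith
  with d show ?thesis using zdvd_not_zless[of "\<bar>chi (x * y) - chi x * chi y\<bar>" "int p"]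
    by (metis abs_ge_zero abs_of_nonneg dvd_abs_iff eq_iff_diff_eq_0 order_le_less zero_less_abs_iff)
qed

lemma exists_nonresidue: "\<exists>u. chi u = -1"
proof (rule ccontr)
  assume no: "\<not> ?thesis"
  let ?A = "{1..<int p}" and ?sq = "\<lambda>y::int. y ^ 2 mod int p"
  have nd: "\<not> int p dvd y" if "y \<in> ?A" for y
    using that zdvd_not_zless[of y "int p"] by auto
  have "?A \<subseteq> ?sq ` ?A"
  proof
    fix x assume x: "x \<in> ?A"
    then have "chi x = 1" using no nd[OF x] chi_cases[of x] by auto
    then have "QuadRes (int p) x" by (auto simp: Legendre_def split: if_splits)
    then obtain y where y: "[y ^ 2 = x] (mod int p)" by (auto simp: QuadRes_def)
    have sq: "?sq (y mod int p) = x" using y x by (simp add: cong_def power_mod)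
    have "y mod int p \<noteq> 0"
    proof
      assume "y mod int p = 0"
      then have "y ^ 2 mod int p = 0" by (metis dvd_imp_mod_0 dvd_mult2 mod_0_imp_dvd power2_eq_square)
      with y x show False by (simp add: cong_def)
    qed
    moreover have "y mod int p \<ge> 0" "y mod int p < int p" using p_gt_2 by simp_all
    ultimately have "y mod int p \<ge> 1" "y mod int p < int p" by linarith+
    then have "y mod int p \<in> ?A" by simp
    with sq show "x \<in> ?sq ` ?A" by (intro image_eqI[of _ _ "y mod int p"]) simp_all
  qed
  then have "card ?A \<le> card (?sq ` ?A)"
    using card_mono[OF finite_imageI[OF finite_atLeastLessThan_int]] by blast
  then have "card (?sq ` ?A) = card ?A"
    using card_image_le[OF finite_atLeastLessThan_int, of ?sq 1 "int p"] by linarith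
  then have inj: "inj_on ?sq ?A" by (intro eq_card_imp_inj_on) simp_all
  have "?sq 1 = ?sq (int p - 1)"
  proof -
    have "(int p - 1) ^ 2 = 1 + int p * (int p - 2)" by (simp add: power2_eq_square algebra_simps)
    then show ?thesis by simp
  qed
  moreover have "1 \<in> ?A" "int p - 1 \<in> ?A" using p_gt_2 by simp_all
  ultimately have "1 = int p - 1" using inj_onD[OF inj] by blast
  with p_gt_2 show False by simp
qed

lemma coprime_p: "\<not> int p dvd u \<Longrightarrow> coprime u (int p)"
  using prime_int prime_imp_coprime[of "int p" u] by (simp add: coprime_commute)

lemma p_pos: "p > 0" using p_gt_2 by simp

lemma sum_chi: "(\<Sum>x\<in>res p. chi x) = 0"
proof -
  obtain u where u: "chi u = -1" using exists_nonresidue by blast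
  then have "\<not> int p dvd u" using chi_eq_0 by auto
  then have "(\<Sum>x\<in>res p. chi (u * x + 0)) = (\<Sum>x\<in>res p. chi x)"
    by (intro sum_residues_affine coprime_p p_pos periodic_chi)
  then show ?thesis by (simp add: chi_mult u sum_negf)
qed

lemma sum_chi_affine:
  assumes "\<not> int p dvd u"
  shows "(\<Sum>x\<in>res p. chi (u * x + v)) = 0"
  using sum_residues_affine[OF p_pos periodic_chi coprime_p[OF assms]] sum_chi by simp

text \<open>Inversion is written as a power, so that it is a total map that fixes zero.\<close>

definition minv :: "int \<Rightarrow> int" where
  "minv x = x ^ (p - 2)"

lemma minv:
  assumes "\<not> int p dvd x"
  shows "[x * minv x = 1] (mod int p)"
proof -
  define h where "h = (p - 1) div 2"
  have hh: "h + h = p - 1" using odd_p unfolding h_def by presburger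
  have "[chi x = x ^ h] (mod int p)"
    using euler_criterion[OF prime_p p_gt_2, of x] by (simp add: h_def)
  then have "[chi x * chi x = x ^ h * x ^ h] (mod int p)" by (intro cong_mult)
  then have "[1 = x ^ (p - 1)] (mod int p)"
    using chi_square[OF assms] by (simp add: power_add[symmetric] hh)
  moreover have "p - 1 = Suc (p - 2)" using p_gt_2 by simp
  ultimately show ?thesis by (simp add: minv_def cong_sym_eq)
qed

lemma minv_dvd: "int p dvd x \<Longrightarrow> int p dvd minv x"
  unfolding minv_def using p_gt_2 by (intro dvd_power_le[of "int p" x 1 "p - 2", simplified]) simp_all

lemma not_dvd_minv: "\<not> int p dvd x \<Longrightarrow> \<not> int p dvd minv x"
  using minv[of x] prime_int by (auto simp: minv_def prime_dvd_power)

lemma cong_cancel: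
  assumes "\<not> int p dvd x" "[x * y = x * z] (mod int p)"
  shows "[y = z] (mod int p)"
  using assms coprime_p by (simp add: cong_mult_lcancel)

lemma minv_inj:
  assumes "[minv x = minv y] (mod int p)"
  shows "[x = y] (mod int p)"
proof (cases "int p dvd x")
  case True
  then have "int p dvd minv y" using assms minv_dvd cong_dvd_iff by blast
  then have "int p dvd y" using not_dvd_minv by blast
  with True show ?thesis by (simp add: cong_def mod_eq_0_iff_dvd[THEN iffD2])
next
  case False
  then have "\<not> int p dvd y" using assms minv_dvd not_dvd_minv cong_dvd_iff by blast
  then have "[minv x * x = minv x * y] (mod int p)"
    using minv[OF False] minv[of y] cong_mult[OF assms cong_refl[of y]]
    by (metis cong_sym cong_trans mult.commute)
  then show ?thesis by (rule cong_cancel[OF not_dvd_minv[OF False]])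
qed

lemma sum_residues_minv:
  fixes f :: "int \<Rightarrow> 'a::comm_monoid_add"
  assumes "periodic p f"
  shows "(\<Sum>x\<in>res p. f (minv x)) = (\<Sum>x\<in>res p. f x)"
proof (rule sum_residues_reindex[OF p_pos assms])
  fix x y assume "x \<in> res p" "y \<in> res p" "[minv x = minv y] (mod int p)"
  then show "x = y" using minv_inj[of x y] by (simp add: cong_def)
qed

lemma periodic_chi_affine: "periodic p (\<lambda>x. chi (u * x + v))"
  by (rule periodicI_cong) (intro chi_cong cong_add cong_mult cong_refl)

lemma periodic_chi_shift: "periodic p (\<lambda>x. chi (x + v))"
  using periodic_chi_affine[of 1 v] by simp

lemma chi_minv_shift:
  assumes "\<not> int p dvd x"
  shows "chi (minv x + d) = chi x * chi (1 + d * x)"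
proof -
  have "[1 + d * x = x * (minv x + d)] (mod int p)"
    using cong_add[OF minv[OF assms] cong_refl[of "d * x"]]
    by (simp add: algebra_simps cong_sym_eq)
  then have "chi (1 + d * x) = chi x * chi (minv x + d)"
    using chi_cong chi_mult by metis
  then show ?thesis using chi_square[OF assms] by (simp add: mult.assoc[symmetric])
qed

text \<open>
  Inverting the variable turns the second factor into a linear one: for \<open>x\<close> prime to \<open>p\<close>, \<open>chi\<close> of
  \<open>1/x * (1/x + d)\<close> equals \<open>chi (1 + d x)\<close>. The value \<open>-1\<close> comes from the missing point \<open>x = 0\<close>.
\<close>

lemma sum_chi_two:
  assumes "\<not> int p dvd a - b"
  shows "(\<Sum>x\<in>res p. chi (x + a) * chi (x + b)) = -1"
proof -
  define d where "d = b - a"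
  have d: "\<not> int p dvd d" using assms unfolding d_def by (metis dvd_minus_iff minus_diff_eq)
  have "(\<Sum>x\<in>res p. chi (x + a) * chi (x + b)) = (\<Sum>x\<in>res p. (\<lambda>y. chi y * chi (y + d)) (x + a))"
    by (simp add: d_def algebra_simps)
  also have "\<dots> = (\<Sum>x\<in>res p. chi x * chi (x + d))"
    by (rule sum_residues_shift[OF p_pos periodic_mult[OF periodic_chi periodic_chi_shift]])
  also have "\<dots> = (\<Sum>x\<in>res p. chi (minv x) * chi (minv x + d))"
    by (rule sum_residues_minv[OF periodic_mult[OF periodic_chi periodic_chi_shift], symmetric])
  also have "\<dots> = (\<Sum>x\<in>res p. chi (d * x + 1) - of_bool (x = 0))"
  proof (rule sum.cong[OF refl])
    fix x assume x: "x \<in> res p"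
    show "chi (minv x) * chi (minv x + d) = chi (d * x + 1) - of_bool (x = 0)"
    proof (cases "x = 0")
      case True
      then have "int p dvd minv x" by (simp add: minv_dvd)
      moreover have "chi 1 = 1" using chi_square[of 1] chi_mult[of 1 1] p_gt_2 by simp
      ultimately show ?thesis using True by (simp add: chi_eq_0)
    next
      case False
      then have nd: "\<not> int p dvd x" using x zdvd_not_zless[of x "int p"] by auto
      have "chi (minv x) = chi x"
        using chi_minv_shift[OF nd, of 0] chi_square[of 1] chi_mult[of 1 1] p_gt_2 by simp
      with False chi_minv_shift[OF nd, of d] chi_square[OF nd] show ?thesis
        by (simp add: mult.assoc[symmetric] add.commute)
    qed
  qed
  also have "\<dots> = (\<Sum>x\<in>res p. chi (d * x + 1)) - (\<Sum>x\<in>res p. of_bool (x = 0))"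
    by (simp add: sum_subtractf)
  also have "\<dots> = -1"
    using sum_chi_affine[OF d, of 1] p_pos by (simp add: of_bool_def sum.delta')
  finally show ?thesis .
qed

text \<open>
  For \<open>mu\<close> other than 0 and 1 this is, up to sign, the trace of Frobenius of the elliptic curve
  \<open>y^2 = x (x - 1) (x - mu)\<close>.
\<close>

definition legendre_sum :: "int \<Rightarrow> int" where
  "legendre_sum mu = (\<Sum>x\<in>res p. chi x * chi (x - 1) * chi (x - mu))"

definition cubic :: "int \<times> int \<times> int \<times> int \<Rightarrow> int \<Rightarrow> int" where
  "cubic c x = (case c of (c0, c1, c2, c3) \<Rightarrow> c0 + c1 * x + c2 * x ^ 2 + c3 * x ^ 3)"

definition cubic_sum :: "int \<times> int \<times> int \<times> int \<Rightarrow> int" where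
  "cubic_sum c = (\<Sum>x\<in>res p. chi (cubic c x))"

text \<open>
  If \<open>x1\<close> differs from the other three points, then \<open>h = (X - x2) (X - x3) (X - x4)\<close> vanishes at these points but
  not at \<open>x1\<close>. Adding \<open>l h\<close> permutes the cubics, keeps their values at \<open>x2, x3, x4\<close>, and lets the value at \<open>x1\<close> run
  through all residues as \<open>l\<close> does.
\<close>

lemma sum_cubics_isolated:
  assumes x: "\<not> int p dvd (x1 - x2) * (x1 - x3) * (x1 - x4)"
  shows "sum4 (res p) (\<lambda>c0 c1 c2 c3. chi (cubic (c0, c1, c2, c3) x1) * (chi (cubic (c0, c1, c2, c3) x2) *
      chi (cubic (c0, c1, c2, c3) x3) * chi (cubic (c0, c1, c2, c3) x4))) = 0"
    (is "sum4 _ ?F = 0")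
proof -
  let ?S = "sum4 (res p) ?F"
  let ?h = "(x1 - x2) * (x1 - x3) * (x1 - x4)"
  let ?R = "\<lambda>c0 c1 c2 c3. chi (cubic (c0, c1, c2, c3) x2) *
      chi (cubic (c0, c1, c2, c3) x3) * chi (cubic (c0, c1, c2, c3) x4)"
  let ?a = "- (x2 * x3 * x4)" and ?b = "x2 * x3 + x2 * x4 + x3 * x4" and ?c = "- (x2 + x3 + x4)"
  have per: "periodic p (\<lambda>c. chi (cubic (c, c1, c2, c3) x))" "periodic p (\<lambda>c. chi (cubic (c1, c, c2, c3) x))"
    "periodic p (\<lambda>c. chi (cubic (c1, c2, c, c3) x))" "periodic p (\<lambda>c. chi (cubic (c1, c2, c3, c) x))"
    for c1 c2 c3 x
    unfolding cubic_def prod.case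
    by (rule periodicI_cong, intro chi_cong cong_add cong_mult cong_refl; assumption)+
  have shift: "cubic (c0 + l * ?a, c1 + l * ?b, c2 + l * ?c, c3 + l) x
      = cubic (c0, c1, c2, c3) x + l * ((x - x2) * (x - x3) * (x - x4))" for c0 c1 c2 c3 l x
    unfolding cubic_def prod.case by (simp add: algebra_simps power2_eq_square power3_eq_cube)
  have E: "?S = sum4 (res p) (\<lambda>c0 c1 c2 c3. chi (?h * l + cubic (c0, c1, c2, c3) x1) * ?R c0 c1 c2 c3)" for l
  proof -
    have "?S = sum4 (res p) (\<lambda>c0 c1 c2 c3. ?F (c0 + l * ?a) (c1 + l * ?b) (c2 + l * ?c) (c3 + l))"
      by (rule sum_residues_shift4[symmetric, OF p_pos]) (intro periodic_mult per)+
    then show ?thesis unfolding shift by (simp add: algebra_simps)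
  qed
  have "(\<Sum>l\<in>res p. ?S) = sum4 (res p) (\<lambda>l c0 c1 c2. \<Sum>c3\<in>res p.
      chi (?h * l + cubic (c0, c1, c2, c3) x1) * ?R c0 c1 c2 c3)"
    by (rule sum.cong[OF refl E])
  also have "\<dots> = sum4 (res p) (\<lambda>c0 c1 c2 c3. \<Sum>l\<in>res p.
      chi (?h * l + cubic (c0, c1, c2, c3) x1) * ?R c0 c1 c2 c3)"
    by (rule sum_swap4)
  also have "\<dots> = 0"
    by (simp only: sum_distrib_right[symmetric] sum_chi_affine[OF x]) simp
  finally show ?thesis using p_pos by simp
qed

lemma not_dvd_diff:
  assumes "a \<in> res p" "b \<in> res p" "a \<noteq> b"
  shows "\<not> int p dvd a - b"
  using assms by (metis atLeastLessThan_iff cong_iff_dvd_diff cong_def mod_pos_pos_trivial)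

lemma sum_cubics_quadruple_le:
  assumes "x1 \<in> res p" "x2 \<in> res p" "x3 \<in> res p" "x4 \<in> res p"
  shows "sum4 (res p) (\<lambda>c0 c1 c2 c3. chi (cubic (c0, c1, c2, c3) x1) * chi (cubic (c0, c1, c2, c3) x2) *
      chi (cubic (c0, c1, c2, c3) x3) * chi (cubic (c0, c1, c2, c3) x4))
    \<le> int p ^ 4 * (of_bool (x1 = x2 \<and> x3 = x4) + of_bool (x1 = x3 \<and> x2 = x4) + of_bool (x1 = x4 \<and> x2 = x3))"
    (is "?S x1 x2 x3 x4 \<le> _")
proof -
  have S_le: "?S x1 x2 x3 x4 \<le> int p ^ 4"
  proof -
    have "chi a * chi b * chi c * chi d \<le> 1" for a b c d
    proof -
      have "\<bar>chi a * chi b * chi c * chi d\<bar> \<le> 1 * 1 * 1 * 1"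
        unfolding abs_mult by (intro mult_mono abs_chi_le) auto
      then show ?thesis by simp
    qed
    then have "?S x1 x2 x3 x4 \<le> sum4 (res p) (\<lambda>c0 c1 c2 c3. 1)"
      by (intro sum_mono)
    then show ?thesis by (simp add: power4_eq_xxxx mult_ac)
  qed
  have isolated: "?S x1 x2 x3 x4 = 0" if
    "x1 \<noteq> x2 \<and> x1 \<noteq> x3 \<and> x1 \<noteq> x4 \<or> x2 \<noteq> x1 \<and> x2 \<noteq> x3 \<and> x2 \<noteq> x4 \<or> x3 \<noteq> x1 \<and> x3 \<noteq> x2 \<and> x3 \<noteq> x4 \<or> x4 \<noteq> x1 \<and> x4 \<noteq> x2 \<and> x4 \<noteq> x3"
    using that
  proof (elim disjE conjE)
    assume "x1 \<noteq> x2" "x1 \<noteq> x3" "x1 \<noteq> x4"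
    then show ?thesis using sum_cubics_isolated[of x1 x2 x3 x4] assms
      by (simp add: prime_dvd_mult_iff[OF prime_int] not_dvd_diff mult_ac)
  next
    assume "x2 \<noteq> x1" "x2 \<noteq> x3" "x2 \<noteq> x4"
    then show ?thesis using sum_cubics_isolated[of x2 x1 x3 x4] assms
      by (simp add: prime_dvd_mult_iff[OF prime_int] not_dvd_diff mult_ac)
  next
    assume "x3 \<noteq> x1" "x3 \<noteq> x2" "x3 \<noteq> x4"
    then show ?thesis using sum_cubics_isolated[of x3 x1 x2 x4] assms
      by (simp add: prime_dvd_mult_iff[OF prime_int] not_dvd_diff mult_ac)
  next
    assume "x4 \<noteq> x1" "x4 \<noteq> x2" "x4 \<noteq> x3"
    then show ?thesis using sum_cubics_isolated[of x4 x1 x2 x3] assms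
      by (simp add: prime_dvd_mult_iff[OF prime_int] not_dvd_diff mult_ac)
  qed
  show ?thesis
  proof (cases "(x1 = x2 \<and> x3 = x4) \<or> (x1 = x3 \<and> x2 = x4) \<or> (x1 = x4 \<and> x2 = x3)")
    case True
    then have "1 \<le> of_bool (x1 = x2 \<and> x3 = x4) + of_bool (x1 = x3 \<and> x2 = x4) + (of_bool (x1 = x4 \<and> x2 = x3) :: int)"
      by auto
    from mult_left_mono[OF this, of "int p ^ 4"] S_le show ?thesis by simp
  next
    case False
    then have "?S x1 x2 x3 x4 = 0" by (intro isolated) blast
    then show ?thesis by (simp only: zero_le_mult_iff) simp
  qed
qed

abbreviation cubics :: "(int \<times> int \<times> int \<times> int) set" where
  "cubics \<equiv> res p \<times> res p \<times> res p \<times> res p"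

lemma sum_cubics: "(\<Sum>c\<in>cubics. f c) = sum4 (res p) (\<lambda>c0 c1 c2 c3. f (c0, c1, c2, c3))"
  by (simp add: sum.cartesian_product case_prod_unfold)

text \<open>
  Square-root cancellation on average over the cubics: only the quadruples of points that coincide in
  pairs contribute.
\<close>

lemma cubic_fourth_moment: "(\<Sum>c\<in>cubics. cubic_sum c ^ 4) \<le> 3 * int p ^ 6"
proof -
  have "(\<Sum>c\<in>cubics. cubic_sum c ^ 4) = (\<Sum>c\<in>cubics. \<Sum>x1\<in>res p. \<Sum>x2\<in>res p. \<Sum>x3\<in>res p. \<Sum>x4\<in>res p.
      chi (cubic c x1) * chi (cubic c x2) * chi (cubic c x3) * chi (cubic c x4))"
    unfolding cubic_sum_def power4_sum ..
  also have "\<dots> = sum4 (res p) (\<lambda>x1 x2 x3 x4. \<Sum>c\<in>cubics.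
      chi (cubic c x1) * chi (cubic c x2) * chi (cubic c x3) * chi (cubic c x4))"
    by (rule sum_swap4)
  also have "\<dots> \<le> sum4 (res p) (\<lambda>x1 x2 x3 x4. int p ^ 4 * (of_bool (x1 = x2 \<and> x3 = x4) + of_bool (x1 = x3 \<and> x2 = x4) + of_bool (x1 = x4 \<and> x2 = x3)))"
    unfolding sum_cubics by (intro sum_mono sum_cubics_quadruple_le)
  also have "\<dots> = int p ^ 4 * (3 * int p ^ 2)"
    unfolding sum_distrib_left[symmetric] sum.distrib sum_pairings[OF finite_atLeastLessThan_int]
    by simp
  also have "\<dots> = 3 * int p ^ 6" by (simp add: eval_nat_numeral)
  finally show ?thesis .
qed

text \<open>
  The coefficients of \<open>k (X - al) (X - be) (X - ga)\<close>, where \<open>ga\<close> is the image of \<open>mu\<close> under the affine map that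
  sends 0 to \<open>al\<close> and 1 to \<open>be\<close>. These are the affine images and multiples of \<open>X (X - 1) (X - mu)\<close>.
\<close>

definition orbit_cubic :: "int \<Rightarrow> int \<times> int \<times> int \<Rightarrow> int \<times> int \<times> int \<times> int" where
  "orbit_cubic mu = (\<lambda>(k, al, be). let ga = al + mu * (be - al) in
     (- (k * al * be * ga) mod int p, k * (al * be + al * ga + be * ga) mod int p,
      - (k * (al + be + ga)) mod int p, k mod int p))"

definition orbit :: "(int \<times> int \<times> int) set" where
  "orbit = {(k, al, be). k \<in> {1..<int p} \<and> al \<in> res p \<and> be \<in> res p \<and> al \<noteq> be}"

lemma orbit_cubic_eval:
  "[cubic (orbit_cubic mu (k, al, be)) x
     = k * (x - al) * (x - be) * (x - (al + mu * (be - al)))] (mod int p)"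
proof -
  define ga where "ga = al + mu * (be - al)"
  have "[cubic (orbit_cubic mu (k, al, be)) x
    = - (k * al * be * ga) + k * (al * be + al * ga + be * ga) * x
      + - (k * (al + be + ga)) * x ^ 2 + k * x ^ 3] (mod int p)"
    unfolding orbit_cubic_def cubic_def prod.case Let_def ga_def[symmetric]
    by (intro cong_add cong_mult cong_refl) (simp_all add: cong_def)
  also have "- (k * al * be * ga) + k * (al * be + al * ga + be * ga) * x
      + - (k * (al + be + ga)) * x ^ 2 + k * x ^ 3 = k * (x - al) * (x - be) * (x - ga)"
    by (simp add: algebra_simps power2_eq_square power3_eq_cube)
  finally show ?thesis by (simp add: ga_def)
qed

lemma abs_cubic_sum_orbit:
  assumes "c \<in> orbit"
  shows "\<bar>cubic_sum (orbit_cubic mu c)\<bar> = \<bar>legendre_sum mu\<bar>"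
proof -
  obtain k al be where c: "c = (k, al, be)" by (metis prod_cases3)
  from assms have k: "\<not> int p dvd k" and ab: "\<not> int p dvd be - al"
    unfolding c orbit_def using not_dvd_diff zdvd_not_zless[of k "int p"] by auto
  let ?g = "al + mu * (be - al)"
  have "cubic_sum (orbit_cubic mu c) = (\<Sum>x\<in>res p. chi k * (chi (x - al) * chi (x - be) * chi (x - ?g)))"
    unfolding cubic_sum_def c
    by (intro sum.cong refl) (use chi_cong[OF orbit_cubic_eval] in \<open>simp add: chi_mult mult.assoc\<close>)
  also have "\<dots> = chi k * (\<Sum>x\<in>res p. chi (x - al) * chi (x - be) * chi (x - ?g))"
    by (simp add: sum_distrib_left)
  also have "(\<Sum>x\<in>res p. chi (x - al) * chi (x - be) * chi (x - ?g))
     = (\<Sum>z\<in>res p. (\<lambda>x. chi (x - al) * chi (x - be) * chi (x - ?g)) ((be - al) * z + al))"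
    by (rule sum_residues_affine[symmetric, OF p_pos _ coprime_p[OF ab]])
      (use periodic_chi_shift[of "- _"] in \<open>intro periodic_mult; simp\<close>)
  also have "\<dots> = (\<Sum>z\<in>res p. chi (be - al) * chi (be - al) * chi (be - al) * (chi z * chi (z - 1) * chi (z - mu)))"
  proof (intro sum.cong refl)
    fix z
    have "(be - al) * z + al - al = (be - al) * z" "(be - al) * z + al - be = (be - al) * (z - 1)"
      "(be - al) * z + al - ?g = (be - al) * (z - mu)" by (simp_all add: algebra_simps)
    then show "chi ((be - al) * z + al - al) * chi ((be - al) * z + al - be) * chi ((be - al) * z + al - ?g) =
      chi (be - al) * chi (be - al) * chi (be - al) * (chi z * chi (z - 1) * chi (z - mu))"
      by (simp only: chi_mult mult_ac)
  qed
  also have "\<dots> = chi (be - al) * chi (be - al) * chi (be - al) * legendre_sum mu"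
    by (simp add: legendre_sum_def sum_distrib_left)
  finally show ?thesis by (simp add: abs_mult abs_chi k ab)
qed

text \<open>
  A cubic determines its leading coefficient \<open>k\<close>, and both \<open>al\<close> and \<open>be\<close> are among its at most three roots.
\<close>

lemma orbit_fibre_card:
  "card {c \<in> orbit. orbit_cubic mu c = d} \<le> 9"
proof (cases "{c \<in> orbit. orbit_cubic mu c = d} = {}")
  case False
  then obtain k0 a0 b0 where c0: "(k0, a0, b0) \<in> orbit" "orbit_cubic mu (k0, a0, b0) = d" by auto
  define g0 where "g0 = (a0 + mu * (b0 - a0)) mod int p"
  have k0: "k0 \<in> {1..<int p}" "a0 \<in> res p" "b0 \<in> res p" using c0 by (auto simp: orbit_def)
  have nk0: "\<not> int p dvd k0" using k0 zdvd_not_zless[of k0 "int p"] by auto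
  have g0: "g0 \<in> res p" using p_pos by (simp add: g0_def)
  have root: "x \<in> {a0, b0, g0}" if x: "x \<in> res p" "int p dvd cubic d x" for x
  proof -
    have "int p dvd k0 * (x - a0) * (x - b0) * (x - (a0 + mu * (b0 - a0)))"
      using x(2) orbit_cubic_eval[of mu k0 a0 b0 x] c0(2) cong_dvd_iff by blast
    then have "int p dvd x - a0 \<or> int p dvd x - b0 \<or> int p dvd x - (a0 + mu * (b0 - a0))"
      using nk0 by (auto simp: prime_dvd_mult_iff[OF prime_int])
    moreover have "x = g0" if "int p dvd x - (a0 + mu * (b0 - a0))"
    proof -
      have "x mod int p = g0" using that by (simp add: g0_def mod_eq_dvd_iff)
      then show ?thesis using x by simp
    qed
    ultimately show ?thesis using not_dvd_diff[OF x(1)] k0 by blast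
  qed
  have "{c \<in> orbit. orbit_cubic mu c = d} \<subseteq> {k0} \<times> {a0, b0, g0} \<times> {a0, b0, g0}"
  proof
    fix c assume c: "c \<in> {c \<in> orbit. orbit_cubic mu c = d}"
    obtain k al be where c': "c = (k, al, be)" by (metis prod_cases3)
    have m: "k \<in> {1..<int p}" "al \<in> res p" "be \<in> res p" and e: "orbit_cubic mu (k, al, be) = d"
      using c c' by (auto simp: orbit_def)
    have "k mod int p = k0 mod int p"
      using e c0(2) by (auto simp: orbit_cubic_def Let_def)
    then have "k = k0" using m k0 by simp
    moreover have "int p dvd cubic d al" "int p dvd cubic d be"
      using orbit_cubic_eval[of mu k al be al] orbit_cubic_eval[of mu k al be be] e
      by (simp_all add: cong_0_iff)
    ultimately show "c \<in> {k0} \<times> {a0, b0, g0} \<times> {a0, b0, g0}"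
      using root m c' by blast
  qed
  then have "card {c \<in> orbit. orbit_cubic mu c = d} \<le> card ({k0} \<times> {a0, b0, g0} \<times> {a0, b0, g0})"
    by (intro card_mono) auto
  also have "\<dots> \<le> 1 * (3 * 3)"
    unfolding card_cartesian_product by (intro mult_mono card_insert_le_m1) (auto intro!: card_insert_le_m1)
  finally show ?thesis by simp
next
  case True
  then show ?thesis by (simp only: card.empty)
qed

lemma card_orbit: "card orbit = (p - 1) * (p * (p - 1))"
proof -
  have "orbit = {1..<int p} \<times> (SIGMA al:res p. res p - {al})"
    by (auto simp: orbit_def)
  moreover have "card (SIGMA al:res p. res p - {al}) = p * (p - 1)"
    by (subst card_SigmaI) auto
  ultimately show ?thesis using p_pos by (simp add: card_cartesian_product nat_diff_distrib)
qed

text \<open>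
  The orbit of one cubic carries \<open>p (p - 1)^2\<close> equal terms of the fourth moment, each of them hit at most 9
  times. This includes the degenerate values 0 and 1 of \<open>mu\<close>.
\<close>

lemma legendre_sum_fourth_power_le:
  "(int p - 1) ^ 2 * legendre_sum mu ^ 4 \<le> 27 * int p ^ 5"
proof -
  have fin: "finite orbit" by (rule card_ge_0_finite) (use card_orbit p_gt_2 in simp)
  have img: "orbit_cubic mu ` orbit \<subseteq> cubics"
    using p_pos by (auto simp: orbit_cubic_def Let_def)
  have "int (card orbit) * legendre_sum mu ^ 4 = (\<Sum>c\<in>orbit. cubic_sum (orbit_cubic mu c) ^ 4)"
  proof -
    have "cubic_sum (orbit_cubic mu c) ^ 4 = legendre_sum mu ^ 4" if "c \<in> orbit" for c
      using abs_cubic_sum_orbit[OF that] by (metis even_numeral power_even_abs)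
    then show ?thesis by simp
  qed
  also have "\<dots> = (\<Sum>d\<in>cubics. \<Sum>c\<in>{c\<in>orbit. orbit_cubic mu c = d}. cubic_sum (orbit_cubic mu c) ^ 4)"
    by (rule sum.group[OF fin _ img, symmetric]) auto
  also have "\<dots> = (\<Sum>d\<in>cubics. int (card {c\<in>orbit. orbit_cubic mu c = d}) * cubic_sum d ^ 4)"
    by (intro sum.cong refl) simp
  also have "\<dots> \<le> (\<Sum>d\<in>cubics. 9 * cubic_sum d ^ 4)"
    using orbit_fibre_card by (intro sum_mono mult_right_mono) (auto simp: of_nat_le_iff[of _ 9, simplified])
  also have "\<dots> \<le> 27 * int p ^ 6"
    using cubic_fourth_moment by (simp add: sum_distrib_left[symmetric])
  finally have "int p * ((int p - 1) ^ 2 * legendre_sum mu ^ 4) \<le> int p * (27 * int p ^ 5)"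
    using p_pos by (simp add: card_orbit of_nat_diff eval_nat_numeral mult_ac)
  then show ?thesis using p_pos by simp
qed

lemma abs_legendre_sum_le: "\<bar>real_of_int (legendre_sum mu)\<bar> \<le> 3 * real p powr (3/4)"
proof -
  let ?P = "real p" and ?L = "real_of_int (legendre_sum mu)"
  have P: "?P \<ge> 3" using p_gt_2 by simp
  have "real_of_int ((int p - 1) ^ 2 * legendre_sum mu ^ 4) \<le> real_of_int (27 * int p ^ 5)"
    using legendre_sum_fourth_power_le by (simp only: of_int_le_iff)
  then have le: "(?P - 1) ^ 2 * ?L ^ 4 \<le> 27 * ?P ^ 5" by simp
  \<comment> \<open>\<open>p - 1\<close> is at least \<open>2 p / 3\<close>, since \<open>p\<close> is at least 3; this gives \<open>?L ^ 4 \<le> 243 / 4 * p^3\<close>, and \<open>243 / 4 < 81\<close>.\<close>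
  have "(2 / 3 * ?P) ^ 2 * ?L ^ 4 \<le> (?P - 1) ^ 2 * ?L ^ 4"
    using P by (intro mult_right_mono power_mono) auto
  with le have "?P ^ 2 * (4 * ?L ^ 4) \<le> ?P ^ 2 * (243 * ?P ^ 3)"
    by (simp add: power_mult_distrib power2_eq_square power3_eq_cube eval_nat_numeral)
  then have "4 * ?L ^ 4 \<le> 243 * ?P ^ 3" using P by (simp only: mult_le_cancel_left_pos zero_less_power)
  moreover have "(3 * ?P powr (3/4)) ^ 4 = 81 * ?P ^ 3"
    using P by (simp add: power_mult_distrib powr_power powr_numeral)
  moreover have "?P ^ 3 \<ge> 0" by simp
  ultimately have "?L ^ 4 \<le> (3 * ?P powr (3/4)) ^ 4" by linarith
  then have "\<bar>?L\<bar> ^ 4 \<le> (3 * ?P powr (3/4)) ^ 4" by (simp add: power_even_abs)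
  then show ?thesis by (rule power_mono_iff[THEN iffD1, rotated 3]) simp_all
qed

definition four_sum :: "int \<Rightarrow> int \<Rightarrow> int \<Rightarrow> int \<Rightarrow> int" where
  "four_sum k1 k2 k3 k4 = (\<Sum>x\<in>res p. chi (x + k1) * chi (x + k2) * chi (x + k3) * chi (x + k4))"

lemma four_sum_shift: "four_sum (k1 + a) (k2 + a) (k3 + a) (k4 + a) = four_sum k1 k2 k3 k4"
proof -
  let ?f = "\<lambda>x. chi (x + k1) * chi (x + k2) * chi (x + k3) * chi (x + k4)"
  have "(\<Sum>x\<in>res p. ?f (x + a)) = (\<Sum>x\<in>res p. ?f x)"
    by (intro sum_residues_shift p_pos periodic_mult periodic_chi_shift)
  then show ?thesis by (simp add: four_sum_def algebra_simps)
qed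

lemma four_sum_normalise: "four_sum k1 k2 k3 k4 = four_sum 0 (k2 - k1) (k3 - k1) (k4 - k1)"
  using four_sum_shift[of 0 k1 "k2 - k1" "k3 - k1" "k4 - k1"] by simp

lemma chi_1: "chi 1 = 1"
  using chi_cases[of 1] chi_mult[of 1 1] p_gt_2 by auto

lemma residue_dvd: "x \<in> res p \<Longrightarrow> int p dvd x \<longleftrightarrow> x = 0"
  using zdvd_not_zless[of x "int p"] by (cases "x > 0") auto

text \<open>
  The affine substitution that sends 0 and 1 to the roots \<open>- a\<close> and \<open>- b\<close> reduces the sum to \<open>legendre_sum\<close>.
\<close>

lemma abs_three_chi_sum_le:
  assumes "\<not> int p dvd a - b"
  shows "\<bar>real_of_int (\<Sum>x\<in>res p. chi (x + a) * chi (x + b) * chi (x + c))\<bar> \<le> 3 * real p powr (3/4)"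
proof -
  define mu where "mu = (a - c) * minv (a - b)"
  let ?f = "\<lambda>x. chi (x + a) * chi (x + b) * chi (x + c)"
  have "(\<Sum>x\<in>res p. ?f x) = (\<Sum>z\<in>res p. ?f ((a - b) * z + (- a)))"
    by (rule sum_residues_affine[symmetric, OF p_pos _ coprime_p[OF assms]])
      (intro periodic_mult periodic_chi_shift)
  also have "\<dots> = (\<Sum>z\<in>res p. chi (a - b) * chi (a - b) * chi (a - b) * (chi z * chi (z - 1) * chi (z - mu)))"
  proof (intro sum.cong refl)
    fix z
    have "[(a - b) * minv (a - b) * (a - c) = 1 * (a - c)] (mod int p)"
      by (intro cong_mult minv assms cong_refl)
    then have "[(a - b) * z - (a - b) * minv (a - b) * (a - c) = (a - b) * z - 1 * (a - c)] (mod int p)"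
      by (intro cong_diff cong_refl)
    then have "[(a - b) * z + - a + c = (a - b) * (z - mu)] (mod int p)"
      by (simp add: mu_def algebra_simps cong_sym_eq)
    then have 3: "chi ((a - b) * z + - a + c) = chi (a - b) * chi (z - mu)"
      using chi_cong chi_mult by metis
    have "(a - b) * z + - a + a = (a - b) * z" "(a - b) * z + - a + b = (a - b) * (z - 1)"
      by (simp_all add: algebra_simps)
    with 3 show "?f ((a - b) * z + - a) = chi (a - b) * chi (a - b) * chi (a - b) * (chi z * chi (z - 1) * chi (z - mu))"
      by (simp only: chi_mult mult_ac)
  qed
  also have "\<dots> = chi (a - b) * chi (a - b) * chi (a - b) * legendre_sum mu"
    by (simp add: legendre_sum_def sum_distrib_left)
  finally have "\<bar>\<Sum>x\<in>res p. ?f x\<bar> = \<bar>legendre_sum mu\<bar>"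
    by (simp add: abs_mult abs_chi assms)
  then show ?thesis using abs_legendre_sum_le[of mu]
    by (simp only: of_int_abs[symmetric])
qed

text \<open>
  Moving one root to infinity: after a shift that sends the root \<open>- k1\<close> to 0, the inversion of the variable
  turns the quartic into the cubic with roots at the negative inverses of the differences \<open>ki - k1\<close>.
\<close>

lemma abs_four_sum_distinct_le:
  assumes "\<not> int p dvd k1 - k2" "\<not> int p dvd k1 - k3" "\<not> int p dvd k1 - k4" "\<not> int p dvd k2 - k3"
  shows "\<bar>real_of_int (four_sum k1 k2 k3 k4)\<bar> \<le> 3 * real p powr (3/4) + 1"
proof -
  define a b c where "a = k2 - k1" and "b = k3 - k1" and "c = k4 - k1"
  have nd: "\<not> int p dvd a" "\<not> int p dvd b" "\<not> int p dvd c" "\<not> int p dvd a - b"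
    using assms unfolding a_def b_def c_def by (simp_all add: dvd_diff_commute)
  have "four_sum k1 k2 k3 k4 = four_sum 0 a b c"
    using four_sum_normalise by (simp add: a_def b_def c_def)
  also have "\<dots> = (\<Sum>x\<in>res p. chi (minv x) * chi (minv x + a) * chi (minv x + b) * chi (minv x + c))"
    unfolding four_sum_def add_0_right
    by (rule sum_residues_minv[symmetric]) (intro periodic_mult periodic_chi periodic_chi_shift)
  also have "\<dots> = (\<Sum>x\<in>res p. chi (1 + a * x) * chi (1 + b * x) * chi (1 + c * x) - of_bool (x = 0))"
  proof (rule sum.cong[OF refl])
    fix x assume x: "x \<in> res p"
    show "chi (minv x) * chi (minv x + a) * chi (minv x + b) * chi (minv x + c)
      = chi (1 + a * x) * chi (1 + b * x) * chi (1 + c * x) - of_bool (x = 0)"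
    proof (cases "x = 0")
      case True
      then have "int p dvd minv x" by (simp add: minv_dvd)
      then show ?thesis using True by (simp add: chi_eq_0 chi_1)
    next
      case False
      then have n: "\<not> int p dvd x" using x residue_dvd by blast
      have "chi (minv x) = chi x" using chi_minv_shift[OF n, of 0] by (simp add: chi_1)
      then have "chi (minv x) * chi (minv x + a) * chi (minv x + b) * chi (minv x + c)
        = (chi x * chi x) * (chi x * chi x) * (chi (1 + a * x) * chi (1 + b * x) * chi (1 + c * x))"
        unfolding chi_minv_shift[OF n] by (simp only: mult_ac)
      then show ?thesis using False by (simp add: chi_square[OF n])
    qed
  qed
  also have "\<dots> = (\<Sum>x\<in>res p. chi (1 + a * x) * chi (1 + b * x) * chi (1 + c * x)) - 1"
    using p_pos by (simp add: sum_subtractf of_bool_def)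
  also have "(\<Sum>x\<in>res p. chi (1 + a * x) * chi (1 + b * x) * chi (1 + c * x))
    = (\<Sum>x\<in>res p. chi a * chi b * chi c * (chi (x + minv a) * chi (x + minv b) * chi (x + minv c)))"
  proof (intro sum.cong refl)
    fix x
    have "chi (1 + u * x) = chi u * chi (x + minv u)" if "\<not> int p dvd u" for u
    proof -
      have "[u * minv u + u * x = 1 + u * x] (mod int p)"
        by (intro cong_add minv that cong_refl)
      then have "chi (1 + u * x) = chi (u * (x + minv u))"
        using chi_cong by (simp add: algebra_simps)
      then show ?thesis by (simp add: chi_mult)
    qed
    then show "chi (1 + a * x) * chi (1 + b * x) * chi (1 + c * x)
      = chi a * chi b * chi c * (chi (x + minv a) * chi (x + minv b) * chi (x + minv c))"
      by (simp add: nd)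
  qed
  also have "\<dots> = chi a * chi b * chi c * (\<Sum>x\<in>res p. chi (x + minv a) * chi (x + minv b) * chi (x + minv c))"
    by (simp add: sum_distrib_left)
  finally have eq: "four_sum k1 k2 k3 k4
    = chi a * chi b * chi c * (\<Sum>x\<in>res p. chi (x + minv a) * chi (x + minv b) * chi (x + minv c)) - 1" .
  have "\<not> int p dvd minv a - minv b"
    using nd(4) minv_inj[of a b] by (auto simp: cong_iff_dvd_diff)
  then have "\<bar>real_of_int (\<Sum>x\<in>res p. chi (x + minv a) * chi (x + minv b) * chi (x + minv c))\<bar> \<le> 3 * real p powr (3/4)"
    by (rule abs_three_chi_sum_le)
  moreover have "\<bar>chi a * chi b * chi c\<bar> = 1" by (simp add: abs_mult abs_chi nd)
  then have "\<bar>real_of_int (chi a * chi b * chi c)\<bar> = 1" by linarith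
  ultimately have "\<bar>real_of_int (chi a * chi b * chi c * (\<Sum>x\<in>res p. chi (x + minv a) * chi (x + minv b) * chi (x + minv c)))\<bar> \<le> 3 * real p powr (3/4)"
    by (simp only: of_int_mult abs_mult mult_1)
  then show ?thesis unfolding eq by linarith
qed

lemma sum_dvd_shift: "(\<Sum>x\<in>res p. of_bool (int p dvd x + k)) = (1 :: int)"
proof -
  have "(\<Sum>x\<in>res p. of_bool (int p dvd x + k)) = (\<Sum>x\<in>res p. of_bool (int p dvd x) :: int)"
    by (rule sum_residues_shift[OF p_pos, where f = "\<lambda>y. of_bool (int p dvd y)"])
      (simp add: periodic_def dvd_mod_iff)
  also have "\<dots> = (\<Sum>x\<in>res p. of_bool (x = 0))"
    by (intro sum.cong refl) (simp add: residue_dvd)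
  also have "\<dots> = 1" using p_pos by (simp add: of_bool_def)
  finally show ?thesis .
qed

lemma abs_four_sum_one_pair_le:
  assumes "int p dvd k1 - k2" "\<not> int p dvd k3 - k4"
  shows "\<bar>four_sum k1 k2 k3 k4\<bar> \<le> 2"
proof -
  let ?f = "\<lambda>x. chi (x + k3) * chi (x + k4)"
  have eq: "chi (x + k2) = chi (x + k1)" for x
    using assms(1) by (intro chi_cong) (simp add: cong_iff_dvd_diff dvd_diff_commute)
  have "four_sum k1 k2 k3 k4 = (\<Sum>x\<in>res p. ?f x - of_bool (int p dvd x + k1) * ?f x)"
    unfolding four_sum_def
  proof (intro sum.cong refl)
    fix x
    show "chi (x + k1) * chi (x + k2) * chi (x + k3) * chi (x + k4) = ?f x - of_bool (int p dvd x + k1) * ?f x"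
      using chi_square[of "x + k1"] chi_eq_0[of "x + k1"]
      by (cases "int p dvd x + k1") (simp_all add: eq)
  qed
  also have "\<dots> = -1 - (\<Sum>x\<in>res p. of_bool (int p dvd x + k1) * ?f x)"
    by (simp add: sum_subtractf sum_chi_two[OF assms(2)])
  also have "\<bar>\<dots>\<bar> \<le> 1 + (\<Sum>x\<in>res p. of_bool (int p dvd x + k1))"
  proof -
    have "\<bar>\<Sum>x\<in>res p. of_bool (int p dvd x + k1) * ?f x\<bar> \<le> (\<Sum>x\<in>res p. of_bool (int p dvd x + k1))"
    proof (rule order_trans[OF sum_abs], rule sum_mono)
      fix x
      have "\<bar>?f x\<bar> \<le> 1 * 1" unfolding abs_mult by (intro mult_mono abs_chi_le) auto
      then show "\<bar>of_bool (int p dvd x + k1) * ?f x\<bar> \<le> of_bool (int p dvd x + k1)" by simp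
    qed
    then show ?thesis by linarith
  qed
  finally show ?thesis by (simp add: sum_dvd_shift)
qed

lemma four_sum_two_pairs:
  assumes "int p dvd k1 - k2" "int p dvd k3 - k4"
  shows "\<bar>four_sum k1 k2 k3 k4 - int p\<bar> \<le> 2"
proof -
  have eq: "chi (x + k2) = chi (x + k1)" "chi (x + k4) = chi (x + k3)" for x
    using assms by (intro chi_cong; simp add: cong_iff_dvd_diff dvd_diff_commute)+
  let ?t = "\<lambda>x. chi (x + k1) * chi (x + k2) * chi (x + k3) * chi (x + k4)"
  have t: "\<bar>?t x - 1\<bar> \<le> of_bool (int p dvd x + k1) + of_bool (int p dvd x + k3)" for x
    using chi_cases[of "x + k1"] chi_cases[of "x + k3"] unfolding eq by auto
  have eq: "four_sum k1 k2 k3 k4 - int p = (\<Sum>x\<in>res p. ?t x - 1)"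
    unfolding four_sum_def by (simp add: sum_subtractf)
  have "\<bar>four_sum k1 k2 k3 k4 - int p\<bar> \<le> (\<Sum>x\<in>res p. of_bool (int p dvd x + k1) + of_bool (int p dvd x + k3))"
    unfolding eq by (rule order_trans[OF sum_abs], rule sum_mono) (rule t)
  also have "\<dots> = 2" unfolding sum.distrib sum_dvd_shift by simp
  finally show ?thesis .
qed

lemma four_sum_perm:
  "four_sum k1 k2 k3 k4 = four_sum k1 k3 k2 k4" "four_sum k1 k2 k3 k4 = four_sum k1 k4 k3 k2"
  "four_sum k1 k2 k3 k4 = four_sum k3 k4 k1 k2"
  by (simp_all add: four_sum_def mult_ac)

lemma four_sum_paired:
  assumes "paired p k1 k2 k3 k4"
  shows "\<bar>four_sum k1 k2 k3 k4 - int p\<bar> \<le> 2"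
  using assms unfolding paired_def cong_iff_dvd_diff
proof (elim disjE conjE)
  assume "int p dvd k1 - k2" "int p dvd k3 - k4"
  then show ?thesis by (rule four_sum_two_pairs)
next
  assume "int p dvd k1 - k3" "int p dvd k2 - k4"
  then show ?thesis unfolding four_sum_perm(1)[of k1 k2 k3 k4] by (rule four_sum_two_pairs)
next
  assume "int p dvd k1 - k4" "int p dvd k2 - k3"
  then show ?thesis unfolding four_sum_perm(2)[of k1 k2 k3 k4]
    by (intro four_sum_two_pairs) (simp_all add: dvd_diff_commute)
qed

text \<open>
  Either the four shifts are distinct, or one pair of factors cancels and a sum over two distinct
  linear factors is left, up to the zero of the cancelled factor.
\<close>

lemma four_sum_unpaired:
  assumes "\<not> paired p k1 k2 k3 k4"
  shows "\<bar>real_of_int (four_sum k1 k2 k3 k4)\<bar> \<le> 3 * real p powr (3/4) + 1"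
proof -
  have "1 \<le> real p powr (3/4)" using p_gt_2 by (intro ge_one_powr_ge_zero) auto
  then have small: ?thesis if "\<bar>four_sum k1 k2 k3 k4\<bar> \<le> 2"
    using that by linarith
  have one_pair: "\<bar>four_sum a b c d\<bar> \<le> 2"
    if "int p dvd a - b" "\<not> (int p dvd a - b \<and> int p dvd c - d)" for a b c d
    using that abs_four_sum_one_pair_le by blast
  show ?thesis
  proof (cases "int p dvd k1 - k2 \<or> int p dvd k1 - k3 \<or> int p dvd k1 - k4 \<or> int p dvd k2 - k3")
    case False
    then show ?thesis by (intro abs_four_sum_distinct_le) auto
  next
    case True
    have np: "\<not> (int p dvd k1 - k2 \<and> int p dvd k3 - k4)" "\<not> (int p dvd k1 - k3 \<and> int p dvd k2 - k4)"
      "\<not> (int p dvd k1 - k4 \<and> int p dvd k3 - k2)" "\<not> (int p dvd k2 - k3 \<and> int p dvd k1 - k4)"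
      using assms unfolding paired_def cong_iff_dvd_diff by (auto simp: dvd_diff_commute)
    have perm: "four_sum k1 k2 k3 k4 = four_sum k1 k3 k2 k4" "four_sum k1 k2 k3 k4 = four_sum k1 k4 k3 k2"
      "four_sum k1 k2 k3 k4 = four_sum k2 k3 k1 k4" by (simp_all add: four_sum_def mult_ac)
    from True show ?thesis
    proof (elim disjE)
      assume "int p dvd k1 - k2"
      then show ?thesis by (intro small one_pair np(1))
    next
      assume "int p dvd k1 - k3"
      then show ?thesis by (intro small) (subst perm(1), intro one_pair np(2))
    next
      assume "int p dvd k1 - k4"
      then show ?thesis by (intro small) (subst perm(2), intro one_pair np(3))
    next
      assume "int p dvd k2 - k3"
      then show ?thesis by (intro small) (subst perm(3), intro one_pair np(4))
    qed
  qed
qed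

end

section \<open>The discrete Fourier transform\<close>

text \<open>
  The function \<open>e(x) = exp(2 \<pi> \<i> x)\<close> of analytic number theory.
\<close>

definition ee :: "real \<Rightarrow> complex" where
  "ee x = cis (2 * pi * x)"

lemma ee_add: "ee (x + y) = ee x * ee y"
  by (simp add: ee_def cis_mult algebra_simps)

lemma ee_0 [simp]: "ee 0 = 1"
  by (simp add: ee_def)

lemma norm_ee [simp]: "norm (ee x) = 1"
  by (simp add: ee_def)

lemma cnj_ee: "cnj (ee x) = ee (- x)"
  by (simp add: ee_def cis_cnj)

lemma ee_of_int [simp]: "ee (of_int k) = 1"
  by (simp add: ee_def cis_multiple_2pi)

lemma ee_eq_1D: "ee x = 1 \<Longrightarrow> x \<in> \<int>"
proof -
  assume "ee x = 1"
  then have "cos (2 * pi * x) = 1" by (simp add: ee_def complex_eq_iff)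
  then obtain k :: int where "2 * pi * x = of_int k * 2 * pi" using cos_one_2pi_int by blast
  then have "x = of_int k" by simp
  then show ?thesis by simp
qed

lemma ee_periodic: "ee (x + of_int k) = ee x"
  by (simp add: ee_add)

lemma periodic_ee:
  assumes "m > 0"
  shows "periodic m (\<lambda>x. ee (of_int (x * y) / of_nat m))"
proof (rule periodicI_add)
  fix x
  have "real_of_int ((x + int m) * y) / real m = real_of_int (x * y) / real m + of_int y"
    using assms by (simp add: field_simps)
  then show "ee (real_of_int ((x + int m) * y) / real m) = ee (real_of_int (x * y) / real m)"
    by (simp only: ee_periodic)
qed

lemma periodic_ee_minus:
  assumes "m > 0"
  shows "periodic m (\<lambda>x. ee (- of_int (x * y) / of_nat m))"
  using periodic_ee[OF assms, of "- y"] by simp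

lemma sum_ee:
  assumes "m > 0"
  shows "(\<Sum>k\<in>res m. ee (of_int (k * x) / of_nat m)) = (if int m dvd x then of_nat m else 0)"
proof (cases "int m dvd x")
  case True
  then obtain y where "x = int m * y" by blast
  then have "real_of_int (k * x) / real m = of_int (k * y)" for k using assms by simp
  then have "ee (real_of_int (k * x) / real m) = 1" for k by (simp only: ee_of_int)
  with True show ?thesis by simp
next
  case False
  let ?f = "\<lambda>k. ee (of_int (k * x) / of_nat m)"
  have "(\<Sum>k\<in>res m. ?f (k + 1)) = (\<Sum>k\<in>res m. ?f k)"
    by (rule sum_residues_shift[OF assms periodic_ee[OF assms]])
  moreover have "?f (k + 1) = ?f k * ?f 1" for k
    by (simp add: ee_add[symmetric] add_divide_distrib[symmetric] algebra_simps)
  ultimately have "(\<Sum>k\<in>res m. ?f k) * ?f 1 = (\<Sum>k\<in>res m. ?f k)"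
    by (simp add: sum_distrib_right)
  moreover have "?f 1 \<noteq> 1"
  proof
    assume "?f 1 = 1"
    then have "real_of_int (1 * x) / real m \<in> \<int>" by (rule ee_eq_1D)
    then obtain y where "real_of_int x / real m = of_int y" by (auto elim!: Ints_cases)
    then have "real_of_int x = of_int (y * int m)" using assms by (simp add: field_simps)
    then have "x = y * int m" by (simp only: of_int_eq_iff)
    with False show False by simp
  qed
  ultimately have "(\<Sum>k\<in>res m. ?f k) = 0" unfolding mult_cancel_left2 by blast
  with False show ?thesis by simp
qed

definition dft :: "nat \<Rightarrow> (int \<Rightarrow> complex) \<Rightarrow> int \<Rightarrow> complex" where
  "dft m c k = (\<Sum>j\<in>res m. c j * ee (- of_int (j * k) / of_nat m))"

lemma periodic_dft:
  assumes "m > 0"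
  shows "periodic m (dft m c)"
  using periodic_ee_minus[OF assms]
  by (simp add: periodic_def dft_def mult.commute[of _ "_ mod _"]) (simp add: mult.commute)

lemma dft_inversion:
  assumes "m > 0" "periodic m c"
  shows "c j = (\<Sum>k\<in>res m. dft m c k * ee (of_int (j * k) / of_nat m)) / of_nat m"
proof -
  have "(\<Sum>k\<in>res m. dft m c k * ee (of_int (j * k) / of_nat m))
     = (\<Sum>k\<in>res m. \<Sum>i\<in>res m. c i * ee (of_int (k * (j - i)) / of_nat m))"
    unfolding dft_def sum_distrib_right
    by (intro sum.cong refl)
       (simp add: mult.assoc ee_add[symmetric] add_divide_distrib[symmetric] diff_divide_distrib[symmetric] algebra_simps)
  also have "\<dots> = (\<Sum>i\<in>res m. c i * (\<Sum>k\<in>res m. ee (of_int (k * (j - i)) / of_nat m)))"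
    by (subst sum.swap) (simp add: sum_distrib_left)
  also have "\<dots> = (\<Sum>i\<in>res m. if i = j mod int m then c i * of_nat m else 0)"
  proof (intro sum.cong refl)
    fix i assume i: "i \<in> res m"
    have "int m dvd j - i \<longleftrightarrow> i = j mod int m"
      using i by (auto simp: mod_eq_dvd_iff[symmetric])
    then show "c i * (\<Sum>k\<in>res m. ee (of_int (k * (j - i)) / of_nat m)) = (if i = j mod int m then c i * of_nat m else 0)"
      unfolding sum_ee[OF assms(1)] by simp
  qed
  also have "\<dots> = c (j mod int m) * of_nat m"
    using assms(1) by (simp add: sum.delta')
  finally show ?thesis using assms by (simp add: periodic_def)
qed

text \<open>
  The Chinese remainder theorem in additive form; in contrast to the usual form it is linear in \<open>i\<close> and \<open>j\<close>,
  so that it splits additive characters as well.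
\<close>

lemma sum_crt:
  fixes f :: "int \<Rightarrow> 'a::comm_monoid_add"
  assumes ab: "a > 0" "b > 0" "coprime a b" and f: "periodic (a * b) f"
  shows "(\<Sum>x\<in>res (a * b). f x) = (\<Sum>i\<in>res a. \<Sum>j\<in>res b. f (int b * i + int a * j))"
proof -
  let ?h = "\<lambda>(i, j). (int b * i + int a * j) mod int (a * b)"
  have cop: "coprime (int b) (int a)" "coprime (int a) (int b)"
    using ab(3) by (simp_all add: coprime_commute)
  have inj: "inj_on ?h (res a \<times> res b)"
  proof (rule inj_onI, clarify)
    fix i j i' j' assume m: "i \<in> res a" "j \<in> res b" "i' \<in> res a" "j' \<in> res b"
      and "(int b * i + int a * j) mod int (a * b) = (int b * i' + int a * j') mod int (a * b)"
    then have c: "[int b * i + int a * j = int b * i' + int a * j'] (mod int a * int b)"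
      by (simp add: cong_def)
    have "[int b * i + int a * j = int b * i' + int a * j'] (mod int a)"
      using c by (rule cong_modulus_mult)
    then have "[int b * i = int b * i'] (mod int a)" by (simp add: cong_def)
    then have 1: "[i = i'] (mod int a)" using cop by (simp add: cong_mult_lcancel)
    have "[int b * i + int a * j = int b * i' + int a * j'] (mod int b)"
      using c by (metis cong_modulus_mult mult.commute)
    then have "[int a * j = int a * j'] (mod int b)" by (simp add: cong_def)
    then have 2: "[j = j'] (mod int b)" using cop by (simp add: cong_mult_lcancel)
    show "i = i' \<and> j = j'" using 1 2 m by (simp add: cong_def)
  qed
  have sub: "?h ` (res a \<times> res b) \<subseteq> res (a * b)" using ab by (auto simp del: of_nat_mult)
  have "?h ` (res a \<times> res b) = res (a * b)"
    by (rule card_subset_eq[OF _ sub]) (simp, simp only: card_image[OF inj] card_cartesian_product, simp add: nat_mult_distrib)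
  then have "(\<Sum>x\<in>res (a * b). f x) = (\<Sum>z\<in>res a \<times> res b. f (?h z))"
    using sum.reindex[OF inj, of f] by (simp only: o_def)
  also have "\<dots> = (\<Sum>(i, j)\<in>res a \<times> res b. f (int b * i + int a * j))"
    using f by (intro sum.cong refl) (auto simp: periodic_def)
  finally show ?thesis by (simp add: sum.cartesian_product)
qed

lemma periodic_times:
  assumes "periodic a f"
  shows "periodic (a * b) f" "periodic (b * a) f"
proof -
  show "periodic (a * b) f"
    by (rule periodicI_cong, rule periodic_congD[OF assms]) (simp add: cong_modulus_mult)
  then show "periodic (b * a) f" by (simp add: mult.commute)
qed

lemma sum_crt_mult:
  fixes f g :: "int \<Rightarrow> 'a::comm_semiring_1"
  assumes ab: "a > 0" "b > 0" "coprime a b" and f: "periodic a f" and g: "periodic b g"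
  shows "(\<Sum>x\<in>res (a * b). f x * g x) = (\<Sum>x\<in>res a. f x) * (\<Sum>x\<in>res b. g x)"
proof -
  have "(\<Sum>x\<in>res (a * b). f x * g x)
      = (\<Sum>i\<in>res a. \<Sum>j\<in>res b. f (int b * i + int a * j) * g (int b * i + int a * j))"
    by (rule sum_crt[OF ab]) (intro periodic_mult periodic_times f g)
  also have "\<dots> = (\<Sum>i\<in>res a. \<Sum>j\<in>res b. f (int b * i + 0) * g (int a * j + 0))"
    by (intro sum.cong refl arg_cong2[of _ _ _ _ "(*)"] periodic_congD[OF f] periodic_congD[OF g])
      (simp_all add: cong_def)
  also have "\<dots> = (\<Sum>i\<in>res a. f (int b * i + 0)) * (\<Sum>j\<in>res b. g (int a * j + 0))"
    by (simp only: sum_product)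
  also have "(\<Sum>i\<in>res a. f (int b * i + 0)) = (\<Sum>x\<in>res a. f x)"
    using ab(3) by (intro sum_residues_affine ab f) (simp add: coprime_commute)
  also have "(\<Sum>j\<in>res b. g (int a * j + 0)) = (\<Sum>x\<in>res b. g x)"
    using ab(3) by (intro sum_residues_affine ab g) simp
  finally show ?thesis .
qed

text \<open>
  Dilations appear on the sequences and not on the frequency. So a product formula over several primes
  stays a formula in one and the same \<open>k\<close>, and the family of Jacobi sequences is closed under the dilations.
\<close>

lemma dft_mult:
  assumes ab: "a > 0" "b > 0" "coprime a b" and c: "periodic a c" and d: "periodic b d"
  shows "dft (a * b) (\<lambda>j. c j * d j) k = dft a (\<lambda>j. c (int b * j)) k * dft b (\<lambda>j. d (int a * j)) k"
proof -
  have "dft (a * b) (\<lambda>j. c j * d j) k = (\<Sum>i\<in>res a. \<Sum>j\<in>res b. c (int b * i + int a * j) * d (int b * i + int a * j)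
      * ee (- of_int ((int b * i + int a * j) * k) / of_nat (a * b)))"
    unfolding dft_def using ab
    by (intro sum_crt ab periodic_mult periodic_times c d periodic_ee_minus) simp
  also have "\<dots> = (\<Sum>i\<in>res a. \<Sum>j\<in>res b. (c (int b * i) * ee (- of_int (i * k) / of_nat a)) * (d (int a * j) * ee (- of_int (j * k) / of_nat b)))"
  proof (intro sum.cong refl)
    fix i j
    have "c (int b * i + int a * j) = c (int b * i)" by (rule periodic_congD[OF c]) (simp add: cong_def)
    moreover have "d (int b * i + int a * j) = d (int a * j)" by (rule periodic_congD[OF d]) (simp add: cong_def)
    moreover have "- real_of_int ((int b * i + int a * j) * k) / real (a * b) = - of_int (i * k) / of_nat a + - of_int (j * k) / of_nat b"
      using ab by (simp add: field_simps)
    ultimately show "c (int b * i + int a * j) * d (int b * i + int a * j) * ee (- of_int ((int b * i + int a * j) * k) / of_nat (a * b))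
      = (c (int b * i) * ee (- of_int (i * k) / of_nat a)) * (d (int a * j) * ee (- of_int (j * k) / of_nat b))"
      by (simp only: ee_add mult_ac)
  qed
  also have "\<dots> = dft a (\<lambda>j. c (int b * j)) k * dft b (\<lambda>j. d (int a * j)) k"
    by (simp only: dft_def sum_product)
  finally show ?thesis .
qed

section \<open>Spectrum of the Jacobi sequence\<close>

text \<open>
  The local factor at \<open>p\<close> of the Jacobi sequence; the value 1 at the multiples of \<open>p\<close> is what the passage
  from \<open>n\<close> to \<open>n / gcd j n\<close> amounts to.
\<close>

definition loc :: "nat \<Rightarrow> int \<Rightarrow> int" where
  "loc p j = (if int p dvd j then 1 else Legendre j (int p))"

context odd_prime
begin

definition gauss :: complex where
  "gauss = dft p (\<lambda>j. of_int (chi j)) 1"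

lemma dft_chi: "dft p (\<lambda>j. of_int (chi j)) k = of_int (chi k) * gauss"
proof (cases "int p dvd k")
  case True
  then obtain l where l: "k = int p * l" by blast
  have "ee (- of_int (j * k) / of_nat p) = 1" for j
  proof -
    have "- real_of_int (j * k) / real p = of_int (- (j * l))" using p_pos l by simp
    then show ?thesis by (simp only: ee_of_int)
  qed
  then have "dft p (\<lambda>j. of_int (chi j)) k = of_int (\<Sum>j\<in>res p. chi j)" by (simp add: dft_def)
  then show ?thesis using True by (simp add: sum_chi chi_eq_0)
next
  case False
  let ?f = "\<lambda>j. of_int (chi j) * ee (- of_int (j * 1) / of_nat p)"
  have per: "periodic p ?f"
    using periodic_chi by (intro periodic_mult periodic_ee_minus p_pos) (simp add: periodic_def)
  have "gauss = (\<Sum>j\<in>res p. ?f (k * j + 0))"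
    unfolding gauss_def dft_def by (rule sum_residues_affine[symmetric, OF p_pos per coprime_p[OF False]])
  also have "\<dots> = of_int (chi k) * dft p (\<lambda>j. of_int (chi j)) k"
    by (simp add: dft_def sum_distrib_left chi_mult mult_ac)
  finally show ?thesis using chi_square[OF False]
    by (simp add: mult.assoc[symmetric] of_int_mult[symmetric] del: of_int_mult)
qed

text \<open>
  The transform of \<open>chi\<close> is \<open>gauss * chi\<close>, so Fourier inversion at \<open>-1\<close> gives \<open>gauss^2 = p chi(-1)\<close>.
\<close>

lemma norm_gauss: "norm gauss ^ 2 = real p"
proof -
  have "of_int (chi (-1)) = (\<Sum>k\<in>res p. dft p (\<lambda>j. of_int (chi j)) k * ee (of_int (-1 * k) / of_nat p)) / of_nat p"
    using periodic_chi by (intro dft_inversion p_pos) (simp add: periodic_def)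
  also have "(\<Sum>k\<in>res p. dft p (\<lambda>j. of_int (chi j)) k * ee (of_int (-1 * k) / of_nat p)) = gauss * gauss"
    unfolding dft_chi gauss_def[unfolded dft_def] by (simp add: sum_distrib_left mult_ac)
  finally have "of_nat p * of_int (chi (-1)) = gauss * gauss" using p_pos by (simp add: field_simps)
  then have "norm (gauss * gauss) = norm (of_nat p * of_int (chi (-1)) :: complex)" by simp
  moreover have "\<not> int p dvd -1" using p_gt_2 by simp
  then have "\<bar>chi (-1)\<bar> = 1" by (rule abs_chi)
  ultimately show ?thesis by (simp add: norm_mult power2_eq_square) (metis norm_of_int of_int_abs of_int_1 mult.right_neutral)
qed

lemma periodic_loc: "periodic p (loc p)"
  by (rule periodicI_cong) (auto simp: loc_def chi_cong cong_dvd_iff)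

lemma dft_loc:
  assumes "\<not> int p dvd v"
  shows "dft p (\<lambda>j. of_int (loc p (v * j))) k = of_int (chi v) * gauss * of_int (chi k) + 1"
proof -
  have "dft p (\<lambda>j. of_int (loc p (v * j))) k
    = (\<Sum>j\<in>res p. of_int (chi v) * (of_int (chi j) * ee (- of_int (j * k) / of_nat p)) + (if j = 0 then 1 else 0))"
    unfolding dft_def
  proof (intro sum.cong refl)
    fix j assume "j \<in> res p"
    then show "of_int (loc p (v * j)) * ee (- of_int (j * k) / of_nat p)
      = of_int (chi v) * (of_int (chi j) * ee (- of_int (j * k) / of_nat p)) + (if j = 0 then 1 else 0)"
      using assms by (simp add: loc_def prime_dvd_mult_iff[OF prime_int] residue_dvd chi_mult chi_eq_0)
  qed
  also have "\<dots> = of_int (chi v) * dft p (\<lambda>j. of_int (chi j)) k + 1"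
    using p_pos by (simp add: sum.distrib dft_def sum_distrib_left)
  finally show ?thesis by (simp add: dft_chi mult_ac)
qed

end

definition jac :: "nat set \<Rightarrow> int \<Rightarrow> int" where
  "jac Q j = (\<Prod>p\<in>Q. loc p j)"

lemma periodic_jac:
  assumes "finite Q" "\<And>p. p \<in> Q \<Longrightarrow> odd_prime p"
  shows "periodic (\<Prod>Q) (jac Q)"
proof (rule periodicI_cong)
  fix x y assume c: "[x = y] (mod int (\<Prod>Q))"
  show "jac Q x = jac Q y" unfolding jac_def
  proof (rule prod.cong[OF refl])
    fix p assume p: "p \<in> Q"
    then have "p dvd \<Prod>Q" using dvd_prodI[OF assms(1) p, of "\<lambda>x. x"] by simp
    then have "[x = y] (mod int p)" using c cong_dvd_modulus by (metis int_dvd_int_iff)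
    then show "loc p x = loc p y"
      using periodic_congD[OF odd_prime.periodic_loc[OF assms(2)[OF p]]] by blast
  qed
qed

lemma coprime_prod_primes:
  assumes "finite Q" "\<And>q. q \<in> Q \<Longrightarrow> odd_prime q" "odd_prime p" "p \<notin> Q"
  shows "coprime p (\<Prod>Q)"
proof (rule prod_coprime_right)
  fix q assume "q \<in> Q"
  then show "coprime p q" using assms by (intro primes_coprime) (auto simp: odd_prime_def)
qed

lemma prod_primes_pos:
  assumes "\<And>q. q \<in> Q \<Longrightarrow> odd_prime q"
  shows "\<Prod>Q > 0"
  using assms odd_prime.p_pos by (intro prod_pos) auto

text \<open>
  The dilation \<open>v\<close> is there for the induction: splitting off a prime \<open>p\<close> by \<open>dft_mult\<close> dilates the remaining
  sequence by \<open>p\<close>, and the local factor at \<open>p\<close> by the product of the other primes. It changes the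
  numbers \<open>g p\<close> only by signs.
\<close>

lemma dft_jac:
  assumes "finite Q" "\<And>p. p \<in> Q \<Longrightarrow> odd_prime p" "\<And>p. p \<in> Q \<Longrightarrow> \<not> int p dvd v"
  shows "\<exists>g. (\<forall>p\<in>Q. norm (g p :: complex) ^ 2 = real p) \<and>
    (\<forall>k. dft (\<Prod>Q) (\<lambda>j. of_int (jac Q (v * j))) k = (\<Prod>p\<in>Q. g p * of_int (Legendre k (int p)) + 1))"
  using assms
proof (induction Q arbitrary: v)
  case empty
  have "{0..<1::int} = {0}" by auto
  then show ?case by (simp add: dft_def jac_def)
next
  case (insert p Q)
  interpret odd_prime p using insert.prems by simp
  let ?n = "\<Prod>Q"
  have opQ: "odd_prime q" if "q \<in> Q" for q using insert.prems that by simp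
  have cop: "coprime p ?n"
    using insert opQ odd_prime_axioms by (intro coprime_prod_primes) auto
  have "\<not> p dvd ?n" using cop prime_p by (metis coprime_absorb_left not_prime_unit)
  then have nv: "\<not> int p dvd v * int ?n"
    using insert.prems(2)[of p] by (simp add: prime_dvd_mult_iff[OF prime_int] del: of_nat_prod)
  have qv: "\<not> int q dvd v * int p" if "q \<in> Q" for q
  proof -
    interpret q: odd_prime q by (rule opQ[OF that])
    have "\<not> q dvd p" using prime_p q.prime_p insert.hyps that primes_dvd_imp_eq by metis
    then show ?thesis using insert.prems(2)[of q] that by (simp add: prime_dvd_mult_iff[OF q.prime_int])
  qed
  from insert.IH[OF opQ qv] obtain g where g: "\<forall>q\<in>Q. norm (g q :: complex) ^ 2 = real q"
    "\<And>k. dft ?n (\<lambda>j. of_int (jac Q (v * int p * j))) k = (\<Prod>q\<in>Q. g q * of_int (Legendre k (int q)) + 1)"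
    by blast
  let ?g = "g(p := of_int (chi (v * int ?n)) * gauss)"
  have "dft (\<Prod>(insert p Q)) (\<lambda>j. of_int (jac (insert p Q) (v * j))) k = (\<Prod>q\<in>insert p Q. ?g q * of_int (Legendre k (int q)) + 1)" for k
  proof -
    have "dft (\<Prod>(insert p Q)) (\<lambda>j. of_int (jac (insert p Q) (v * j))) k
      = dft (p * ?n) (\<lambda>j. of_int (loc p (v * j)) * of_int (jac Q (v * j))) k"
      using insert.hyps by (simp add: jac_def)
    also have "\<dots> = dft p (\<lambda>j. of_int (loc p (v * (int ?n * j)))) k * dft ?n (\<lambda>j. of_int (jac Q (v * (int p * j)))) k"
    proof (rule dft_mult[OF p_pos prod_primes_pos[OF opQ] cop])
      show "periodic p (\<lambda>j. complex_of_int (loc p (v * j)))"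
        by (rule periodicI_cong) (use periodic_congD[OF periodic_loc] cong_mult[OF cong_refl] in metis)
      show "periodic ?n (\<lambda>j. complex_of_int (jac Q (v * j)))"
        by (rule periodicI_cong) (use periodic_congD[OF periodic_jac[OF insert.hyps(1) opQ]] cong_mult[OF cong_refl] in metis)
    qed
    also have "\<dots> = (?g p * of_int (chi k) + 1) * (\<Prod>q\<in>Q. g q * of_int (Legendre k (int q)) + 1)"
      using dft_loc[OF nv, of k] g(2)[of k] by (simp only: mult.assoc fun_upd_same)
    also have "(\<Prod>q\<in>Q. g q * of_int (Legendre k (int q)) + 1) = (\<Prod>q\<in>Q. ?g q * of_int (Legendre k (int q)) + 1)"
      using insert.hyps by (intro prod.cong refl) auto
    finally show ?thesis using insert.hyps by simp
  qed
  moreover have "norm (?g p) ^ 2 = real p"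
    using abs_chi[OF nv] norm_gauss by (simp add: norm_mult power_mult_distrib of_int_abs[symmetric] del: of_int_abs)
  then have "\<forall>q\<in>insert p Q. norm (?g q) ^ 2 = real q" using g(1) by simp
  ultimately show ?case by blast
qed

section \<open>Fourth-order correlations of the spectrum\<close>

definition corr4 :: "nat \<Rightarrow> (int \<Rightarrow> complex) \<Rightarrow> int \<Rightarrow> int \<Rightarrow> int \<Rightarrow> int \<Rightarrow> complex" where
  "corr4 m B k1 k2 k3 k4 = (\<Sum>x\<in>res m. B (x + k1) * B (x + k2) * cnj (B (x + k3)) * cnj (B (x + k4)))"

lemma periodic_shift:
  assumes "periodic m f"
  shows "periodic m (\<lambda>x. f (x + k))"
  by (rule periodicI_cong, rule periodic_congD[OF assms]) (intro cong_add cong_refl)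

lemma periodic_cnj: "periodic m f \<Longrightarrow> periodic m (\<lambda>x. cnj (f x))"
  by (simp add: periodic_def)

lemma corr4_mult:
  assumes ab: "a > 0" "b > 0" "coprime a b" and F: "periodic a F" and G: "periodic b G"
  shows "corr4 (a * b) (\<lambda>k. F k * G k) k1 k2 k3 k4 = corr4 a F k1 k2 k3 k4 * corr4 b G k1 k2 k3 k4"
proof -
  have "corr4 (a * b) (\<lambda>k. F k * G k) k1 k2 k3 k4
    = (\<Sum>x\<in>res (a * b). (F (x + k1) * F (x + k2) * cnj (F (x + k3)) * cnj (F (x + k4)))
         * (G (x + k1) * G (x + k2) * cnj (G (x + k3)) * cnj (G (x + k4))))"
    unfolding corr4_def by (intro sum.cong refl) (simp add: mult_ac)
  also have "\<dots> = corr4 a F k1 k2 k3 k4 * corr4 b G k1 k2 k3 k4"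
    unfolding corr4_def
    by (intro sum_crt_mult ab periodic_mult periodic_cnj periodic_shift F G)
  finally show ?thesis .
qed

lemma corr4_prod:
  assumes "finite Q" "\<And>p. p \<in> Q \<Longrightarrow> odd_prime p" "\<And>p. p \<in> Q \<Longrightarrow> periodic p (F p)"
  shows "corr4 (\<Prod>Q) (\<lambda>k. \<Prod>p\<in>Q. F p k) k1 k2 k3 k4 = (\<Prod>p\<in>Q. corr4 p (F p) k1 k2 k3 k4)
    \<and> periodic (\<Prod>Q) (\<lambda>k. \<Prod>p\<in>Q. F p k)"
  using assms
proof (induction Q)
  case empty
  have "{0..<1::int} = {0}" by auto
  then show ?case by (simp add: corr4_def periodic_def)
next
  case (insert p Q)
  have Q: "\<And>q. q \<in> Q \<Longrightarrow> odd_prime q" and p: "odd_prime p" using insert.prems by simp_all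
  let ?G = "\<lambda>k. \<Prod>q\<in>Q. F q k"
  have IH: "corr4 (\<Prod>Q) ?G k1 k2 k3 k4 = (\<Prod>p\<in>Q. corr4 p (F p) k1 k2 k3 k4)" and per: "periodic (\<Prod>Q) ?G"
    using insert by simp_all
  have Fp: "periodic p (F p)" using insert.prems by simp
  have cop: "coprime p (\<Prod>Q)" by (rule coprime_prod_primes[OF insert.hyps(1) Q p insert.hyps(2)])
  have "corr4 (p * \<Prod>Q) (\<lambda>k. F p k * ?G k) k1 k2 k3 k4 = corr4 p (F p) k1 k2 k3 k4 * corr4 (\<Prod>Q) ?G k1 k2 k3 k4"
    by (rule corr4_mult[OF odd_prime.p_pos[OF p] prod_primes_pos[OF Q] cop Fp per])
  moreover have "periodic (p * \<Prod>Q) (\<lambda>k. F p k * ?G k)"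
    by (intro periodic_mult periodic_times Fp per)
  ultimately show ?case using insert.hyps IH by simp
qed

lemma norm_prod4_perturb:
  fixes a b c d :: complex
  assumes s: "s \<ge> 1" and n: "norm a \<le> s" "norm b \<le> s" "norm c \<le> s" "norm d \<le> s"
  shows "norm ((a + 1) * (b + 1) * (c + 1) * (d + 1) - a * b * c * d) \<le> 15 * s ^ 3"
proof -
  have two: "norm (x + y + 1) \<le> 3 * s" if "norm x \<le> s" "norm y \<le> s" for x y :: complex
    using that s norm_triangle_ineq[of "x + y" 1] norm_triangle_ineq[of x y] by simp
  have "norm (c + 1) \<le> 2 * s" "norm (d + 1) \<le> 2 * s"
    using n s norm_triangle_ineq[of c 1] norm_triangle_ineq[of d 1] by simp_all
  then have cd: "norm ((c + 1) * (d + 1)) \<le> (2 * s) * (2 * s)"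
    unfolding norm_mult using s by (intro mult_mono) auto
  have ab: "norm (a * b) \<le> s * s" unfolding norm_mult using n s by (intro mult_mono) auto
  have "(a + 1) * (b + 1) * (c + 1) * (d + 1) - a * b * c * d
     = (a + b + 1) * ((c + 1) * (d + 1)) + (a * b) * (c + d + 1)" by (simp add: algebra_simps)
  also have "norm \<dots> \<le> norm (a + b + 1) * norm ((c + 1) * (d + 1)) + norm (a * b) * norm (c + d + 1)"
    using norm_triangle_ineq by (metis norm_mult)
  also have "\<dots> \<le> (3 * s) * ((2 * s) * (2 * s)) + (s * s) * (3 * s)"
    using s by (intro add_mono mult_mono two n cd ab) auto
  finally show ?thesis by (simp add: power3_eq_cube algebra_simps)
qed

context odd_prime
begin

definition spec :: "complex \<Rightarrow> int \<Rightarrow> complex" where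
  "spec g k = g * of_int (chi k) + 1"

lemma periodic_spec: "periodic p (spec g)"
  using periodic_chi by (simp add: periodic_def spec_def)

text \<open>
  Of the 16 terms of the product of four factors \<open>g chi + 1\<close>, only the one with all four \<open>chi\<close> has size \<open>p^2\<close>; the
  other 15 have size at most \<open>p^(3/2)\<close>. Two of the factors are conjugated, so the coefficient of the main term is
  \<open>|g|^4 = p^2\<close>.
\<close>

lemma corr4_spec_near:
  assumes g: "norm g ^ 2 = real p"
  shows "norm (corr4 p (spec g) k1 k2 k3 k4 - of_nat p ^ 2 * of_int (four_sum k1 k2 k3 k4)) \<le> 15 * real p ^ 2 * sqrt (real p)"
proof -
  have ng: "norm g = sqrt (real p)" using g by (metis norm_ge_zero real_sqrt_abs abs_of_nonneg)
  have p1: "1 \<le> sqrt (real p)" using p_gt_2 by simp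
  have gg: "g * g * cnj g * cnj g = of_nat p ^ 2"
  proof -
    have "g * cnj g = of_nat p" using g by (simp add: complex_norm_square[symmetric])
    moreover have "g * g * cnj g * cnj g = (g * cnj g) * (g * cnj g)" by simp
    ultimately show ?thesis by (simp add: power2_eq_square)
  qed
  let ?X = "\<lambda>x k. g * of_int (chi (x + k))" and ?Y = "\<lambda>x k. cnj g * of_int (chi (x + k))"
  have le: "norm (?X x k) \<le> sqrt (real p)" "norm (?Y x k) \<le> sqrt (real p)" for x k
  proof -
    have "real_of_int \<bar>chi (x + k)\<bar> \<le> 1" using abs_chi_le[of "x + k"] by linarith
    then have "sqrt (real p) * real_of_int \<bar>chi (x + k)\<bar> \<le> sqrt (real p) * 1"
      using p1 by (intro mult_left_mono) auto
    then show "norm (?X x k) \<le> sqrt (real p)" "norm (?Y x k) \<le> sqrt (real p)"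
      by (simp_all add: norm_mult ng)
  qed
  have "corr4 p (spec g) k1 k2 k3 k4 - of_nat p ^ 2 * of_int (four_sum k1 k2 k3 k4)
    = (\<Sum>x\<in>res p. (?X x k1 + 1) * (?X x k2 + 1) * (?Y x k3 + 1) * (?Y x k4 + 1) - ?X x k1 * ?X x k2 * ?Y x k3 * ?Y x k4)"
  proof -
    have "of_nat p ^ 2 * of_int (four_sum k1 k2 k3 k4) = (\<Sum>x\<in>res p. ?X x k1 * ?X x k2 * ?Y x k3 * ?Y x k4)"
      unfolding gg[symmetric] four_sum_def of_int_sum sum_distrib_left
      by (intro sum.cong refl) (simp add: mult_ac)
    then show ?thesis unfolding corr4_def spec_def by (simp add: sum_subtractf)
  qed
  also have "norm \<dots> \<le> of_nat (card (res p)) * (15 * sqrt (real p) ^ 3)"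
    by (intro sum_norm_bound norm_prod4_perturb p1 le)
  also have "\<dots> = 15 * real p ^ 2 * sqrt (real p)"
    by (simp add: power3_eq_cube power2_eq_square)
  finally show ?thesis .
qed

lemma powr_facts:
  shows "real p ^ 2 * real p powr (3/4) = real p ^ 3 * real p powr (-1/4)"
    "1 \<le> real p powr (3/4)" "sqrt (real p) \<le> real p powr (3/4)"
proof -
  have p1: "1 \<le> real p" "0 < real p" using p_gt_2 by simp_all
  show "sqrt (real p) \<le> real p powr (3/4)"
    using p1 by (simp add: powr_half_sqrt[symmetric] powr_mono)
  show "1 \<le> real p powr (3/4)" using p1 by (intro ge_one_powr_ge_zero) auto
  have "real p ^ 2 * real p powr (3/4) = real p powr (2 + 3/4)"
    unfolding powr_add using p1 by (simp add: powr_numeral)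
  also have "\<dots> = real p powr (3 + (-1/4))" by simp
  also have "\<dots> = real p ^ 3 * real p powr (-1/4)" unfolding powr_add using p1 by (simp add: powr_numeral)
  finally show "real p ^ 2 * real p powr (3/4) = real p ^ 3 * real p powr (-1/4)" .
qed

lemma corr4_spec_unpaired:
  assumes g: "norm g ^ 2 = real p" and u: "\<not> paired p k1 k2 k3 k4"
  shows "norm (corr4 p (spec g) k1 k2 k3 k4 / of_nat p ^ 3) \<le> 19 * real p powr (-1/4)"
proof -
  let ?W = "corr4 p (spec g) k1 k2 k3 k4" and ?V = "of_nat p ^ 2 * of_int (four_sum k1 k2 k3 k4) :: complex"
  have "norm ?V = real p ^ 2 * \<bar>real_of_int (four_sum k1 k2 k3 k4)\<bar>" by (simp add: norm_mult norm_power)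
  also have "\<dots> \<le> real p ^ 2 * (3 * real p powr (3/4) + 1)"
    by (intro mult_left_mono four_sum_unpaired[OF u]) simp
  also have "\<dots> \<le> real p ^ 2 * (4 * real p powr (3/4))"
    using powr_facts(2) by (intro mult_left_mono) auto
  finally have V: "norm ?V \<le> 4 * (real p ^ 2 * real p powr (3/4))" by simp
  have "norm ?W \<le> norm (?W - ?V) + norm ?V" using norm_triangle_ineq[of "?W - ?V" ?V] by simp
  also have "\<dots> \<le> 15 * real p ^ 2 * sqrt (real p) + 4 * (real p ^ 2 * real p powr (3/4))"
    by (intro add_mono corr4_spec_near[OF g] V)
  also have "\<dots> \<le> 15 * (real p ^ 2 * real p powr (3/4)) + 4 * (real p ^ 2 * real p powr (3/4))"
    using mult_left_mono[OF powr_facts(3), of "15 * real p ^ 2"] by (simp add: mult_ac)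
  also have "\<dots> = 19 * real p powr (-1/4) * real p ^ 3" unfolding powr_facts(1) by simp
  finally show ?thesis using p_pos by (simp add: norm_divide norm_power divide_le_eq)
qed

lemma corr4_spec_paired:
  assumes g: "norm g ^ 2 = real p" and u: "paired p k1 k2 k3 k4"
  shows "norm (corr4 p (spec g) k1 k2 k3 k4 / of_nat p ^ 3 - 1) \<le> 17 / sqrt (real p)"
proof -
  let ?W = "corr4 p (spec g) k1 k2 k3 k4" and ?V = "of_nat p ^ 2 * of_int (four_sum k1 k2 k3 k4) :: complex"
  have "?V - of_nat p ^ 3 = of_nat p ^ 2 * of_int (four_sum k1 k2 k3 k4 - int p)"
    by (simp add: power3_eq_cube power2_eq_square algebra_simps)
  then have "norm (?V - of_nat p ^ 3) = real p ^ 2 * \<bar>real_of_int (four_sum k1 k2 k3 k4 - int p)\<bar>"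
    by (simp only: norm_mult norm_power norm_of_nat norm_of_int)
  also have "\<bar>real_of_int (four_sum k1 k2 k3 k4 - int p)\<bar> \<le> 2"
    using four_sum_paired[OF u] by linarith
  finally have V: "norm (?V - of_nat p ^ 3) \<le> real p ^ 2 * 2" by (simp add: mult_left_mono)
  have p1: "1 \<le> sqrt (real p)" using p_gt_2 by simp
  have "norm (?W - of_nat p ^ 3) \<le> norm (?W - ?V) + norm (?V - of_nat p ^ 3)"
    using norm_triangle_ineq[of "?W - ?V" "?V - of_nat p ^ 3"] by simp
  also have "\<dots> \<le> 15 * real p ^ 2 * sqrt (real p) + real p ^ 2 * 2"
    by (intro add_mono corr4_spec_near[OF g] V)
  also have "\<dots> \<le> 17 * (real p ^ 2 * sqrt (real p))"
    using mult_left_mono[OF p1, of "2 * real p ^ 2"] by (simp add: mult_ac)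
  finally have "norm (?W - of_nat p ^ 3) \<le> 17 * (real p ^ 2 * sqrt (real p))" .
  moreover have "?W / of_nat p ^ 3 - 1 = (?W - of_nat p ^ 3) / of_nat p ^ 3" using p_pos by (simp add: field_simps)
  ultimately have "norm (?W / of_nat p ^ 3 - 1) \<le> 17 * (real p ^ 2 * sqrt (real p)) / real p ^ 3"
    by (simp add: norm_divide norm_power divide_right_mono)
  also have "\<dots> = 17 / sqrt (real p)"
  proof -
    have "real p ^ 3 = real p ^ 2 * (sqrt (real p) * sqrt (real p))"
      by (simp add: power3_eq_cube power2_eq_square)
    then show ?thesis using p1 p_pos by (simp add: field_simps)
  qed
  finally show ?thesis .
qed

lemma corr4_spec_le:
  assumes g: "norm g ^ 2 = real p"
  shows "norm (corr4 p (spec g) k1 k2 k3 k4 / of_nat p ^ 3) \<le> 19"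
proof (cases "paired p k1 k2 k3 k4")
  case True
  have "17 / sqrt (real p) \<le> 17" using p_gt_2 by (simp add: divide_le_eq)
  then show ?thesis using corr4_spec_paired[OF g True]
      norm_triangle_ineq[of "corr4 p (spec g) k1 k2 k3 k4 / of_nat p ^ 3 - 1" 1] by simp
next
  case False
  have "real p powr (-1/4) \<le> real p powr 0" using p_gt_2 by (intro powr_mono) auto
  then show ?thesis using corr4_spec_unpaired[OF g False] p_pos by simp
qed

end

lemma prod_primes_cong:
  assumes "finite E" "\<And>p. p \<in> E \<Longrightarrow> odd_prime p" "\<And>p. p \<in> E \<Longrightarrow> [a = b] (mod int p)"
  shows "[a = b] (mod int (\<Prod>E))"
  using assms
proof (induction E)
  case (insert p E)
  have "coprime (int p) (int (\<Prod>E))"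
    using coprime_prod_primes[of E p] insert by (simp only: coprime_int_iff) auto
  moreover have "[a = b] (mod int p)" "[a = b] (mod int (\<Prod>E))" using insert by auto
  ultimately show ?case using insert.hyps
    by (simp add: coprime_cong_mult del: of_nat_prod)
qed simp

lemma paired_dvd:
  assumes "paired n k1 k2 k3 k4" "p dvd n"
  shows "paired p k1 k2 k3 k4"
proof -
  have "int p dvd int n" using assms(2) by simp
  then show ?thesis using assms(1) unfolding paired_def by (meson cong_dvd_modulus)
qed

definition pairing_count :: "nat \<Rightarrow> int \<Rightarrow> int \<Rightarrow> int \<Rightarrow> int \<Rightarrow> real" where
  "pairing_count e k1 k2 k3 k4 =
     of_bool ([k1 = k2] (mod int e) \<and> [k3 = k4] (mod int e)) +
     of_bool ([k1 = k3] (mod int e) \<and> [k2 = k4] (mod int e)) +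
     of_bool ([k1 = k4] (mod int e) \<and> [k2 = k3] (mod int e))"

lemma pairing_count_nonneg: "0 \<le> pairing_count e k1 k2 k3 k4"
  by (simp add: pairing_count_def)

locale jacobi_spectrum =
  fixes Q :: "nat set" and g :: "nat \<Rightarrow> complex"
  assumes finQ: "finite Q" and opQ: "\<And>p. p \<in> Q \<Longrightarrow> odd_prime p"
    and norm_g: "\<And>p. p \<in> Q \<Longrightarrow> norm (g p) ^ 2 = real p"
begin

abbreviation n :: nat where "n \<equiv> \<Prod>Q"

definition jspec :: "int \<Rightarrow> complex" where
  "jspec k = (\<Prod>p\<in>Q. g p * of_int (Legendre k (int p)) + 1)"

definition W :: "nat \<Rightarrow> int \<Rightarrow> int \<Rightarrow> int \<Rightarrow> int \<Rightarrow> complex" where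
  "W p k1 k2 k3 k4 = corr4 p (\<lambda>k. g p * of_int (Legendre k (int p)) + 1) k1 k2 k3 k4 / of_nat p ^ 3"

lemma spec_eq: "p \<in> Q \<Longrightarrow> odd_prime.spec p (g p) = (\<lambda>k. g p * of_int (Legendre k (int p)) + 1)"
  by (rule ext) (simp add: odd_prime.spec_def[OF opQ])

lemma W_eq: "p \<in> Q \<Longrightarrow> W p k1 k2 k3 k4 = corr4 p (odd_prime.spec p (g p)) k1 k2 k3 k4 / of_nat p ^ 3"
  by (simp only: W_def spec_eq)

lemma n_pos: "n > 0"
  by (rule prod_primes_pos[OF opQ])

lemma jspec_corr4: "corr4 n jspec k1 k2 k3 k4 = of_nat n ^ 3 * (\<Prod>p\<in>Q. W p k1 k2 k3 k4)"
  and periodic_jspec: "periodic n jspec"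
proof -
  have per: "periodic p (\<lambda>k. g p * of_int (Legendre k (int p)) + 1)" if "p \<in> Q" for p
    using odd_prime.periodic_spec[OF opQ[OF that], of "g p"] by (simp only: spec_eq[OF that])
  have c: "corr4 n (\<lambda>k. \<Prod>p\<in>Q. g p * of_int (Legendre k (int p)) + 1) k1 k2 k3 k4
    = (\<Prod>p\<in>Q. corr4 p (\<lambda>k. g p * of_int (Legendre k (int p)) + 1) k1 k2 k3 k4)"
    and p: "periodic n (\<lambda>k. \<Prod>p\<in>Q. g p * of_int (Legendre k (int p)) + 1)" for k1 k2 k3 k4
    using corr4_prod[OF finQ opQ per] by blast+
  have "(\<Prod>p\<in>Q. W p k1 k2 k3 k4) = (\<Prod>p\<in>Q. corr4 p (\<lambda>k. g p * of_int (Legendre k (int p)) + 1) k1 k2 k3 k4) / of_nat n ^ 3"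
    by (simp add: W_def prod_dividef prod_power_distrib)
  moreover have "of_nat n \<noteq> (0 :: complex)" using n_pos by (simp del: of_nat_prod)
  ultimately show "corr4 n jspec k1 k2 k3 k4 = of_nat n ^ 3 * (\<Prod>p\<in>Q. W p k1 k2 k3 k4)"
    using c by (simp add: jspec_def[abs_def] del: of_nat_prod)
  show "periodic n jspec" using p by (simp add: jspec_def[abs_def])
qed

lemma W_paired:
  assumes "paired n k1 k2 k3 k4" "K > 0" "\<And>p. p \<in> Q \<Longrightarrow> K \<le> real p"
  shows "norm ((\<Prod>p\<in>Q. W p k1 k2 k3 k4) - 1) \<le> exp (17 * real (card Q) / sqrt K) - 1"
proof -
  have W1: "norm (W p k1 k2 k3 k4 - 1) \<le> 17 / sqrt K" if p: "p \<in> Q" for p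
  proof -
    interpret odd_prime p by (rule opQ[OF p])
    have "p dvd n" using dvd_prodI[OF finQ p, of "\<lambda>x. x"] by simp
    then have "norm (W p k1 k2 k3 k4 - 1) \<le> 17 / sqrt (real p)"
      unfolding W_eq[OF p] by (intro corr4_spec_paired norm_g p paired_dvd[OF assms(1)])
    also have "\<dots> \<le> 17 / sqrt K" using assms(2) assms(3)[OF p] by (intro divide_left_mono) auto
    finally show ?thesis .
  qed
  have "norm ((\<Prod>p\<in>Q. 1 + (W p k1 k2 k3 k4 - 1)) - 1) \<le> (\<Prod>p\<in>Q. 1 + norm (W p k1 k2 k3 k4 - 1)) - 1"
    by (rule norm_prod_minus1_le_prod_minus1)
  also have "(\<Prod>p\<in>Q. 1 + norm (W p k1 k2 k3 k4 - 1)) \<le> (\<Prod>p\<in>Q. exp (17 / sqrt K))"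
  proof (rule prod_mono, intro conjI)
    fix p assume "p \<in> Q"
    have "1 + norm (W p k1 k2 k3 k4 - 1) \<le> 1 + 17 / sqrt K" using W1[OF \<open>p \<in> Q\<close>] by simp
    also have "\<dots> \<le> exp (17 / sqrt K)" by (rule exp_ge_add_one_self)
    finally show "1 + norm (W p k1 k2 k3 k4 - 1) \<le> exp (17 / sqrt K)" .
  qed (simp add: add_nonneg_nonneg)
  also have "\<dots> = exp (17 * real (card Q) / sqrt K)" by (simp add: exp_of_nat_mult[symmetric] mult_ac)
  finally show ?thesis by simp
qed

text \<open>
  Let \<open>Q0\<close> be the set of primes at which the frequencies are unpaired, and \<open>Q1, Q2, Q3\<close> the sets of primes at
  which they are paired in one of the three ways. These sets cover \<open>Q\<close>, so one of the four products is at least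
  \<open>n^(1/4)\<close>. If it is the one over \<open>Q0\<close>, the local savings \<open>p^(-1/4)\<close> multiply to \<open>n^(-1/16)\<close>; otherwise the
  frequencies are paired modulo a large divisor, and the sum on the right is at least 1.
\<close>

lemma W_le:
  "norm (\<Prod>p\<in>Q. W p k1 k2 k3 k4) \<le> 19 ^ card Q *
     (real n powr (-1/16) + (\<Sum>E\<in>{E\<in>Pow Q. real n powr (1/4) \<le> real (\<Prod>E)}. pairing_count (\<Prod>E) k1 k2 k3 k4))"
    (is "_ \<le> _ * (_ + ?S)")
proof -
  define Q0 where "Q0 = {p\<in>Q. \<not> paired p k1 k2 k3 k4}"
  define Q1 where "Q1 = {p\<in>Q. [k1 = k2] (mod int p) \<and> [k3 = k4] (mod int p)}"
  define Q2 where "Q2 = {p\<in>Q. [k1 = k3] (mod int p) \<and> [k2 = k4] (mod int p)}"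
  define Q3 where "Q3 = {p\<in>Q. [k1 = k4] (mod int p) \<and> [k2 = k3] (mod int p)}"
  have sub: "Q0 \<subseteq> Q" "Q1 \<subseteq> Q" "Q2 \<subseteq> Q" "Q3 \<subseteq> Q" by (auto simp: Q0_def Q1_def Q2_def Q3_def)
  have fin: "finite E" if "E \<subseteq> Q" for E using finQ that finite_subset by blast
  have pos: "1 \<le> real (\<Prod>E)" if "E \<subseteq> Q" for E
  proof -
    have "\<Prod>E > 0" using that opQ by (intro prod_primes_pos) auto
    then show ?thesis by linarith
  qed
  have S0: "?S \<ge> 0" by (intro sum_nonneg pairing_count_nonneg)
  have "norm (\<Prod>p\<in>Q. W p k1 k2 k3 k4) \<le> (\<Prod>p\<in>Q. 19 * (if p \<in> Q0 then real p powr (-1/4) else 1))"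
    unfolding prod_norm[symmetric]
  proof (rule prod_mono, intro conjI)
    fix p assume p: "p \<in> Q"
    interpret odd_prime p by (rule opQ[OF p])
    show "norm (W p k1 k2 k3 k4) \<le> 19 * (if p \<in> Q0 then real p powr (-1/4) else 1)"
      using corr4_spec_le[OF norm_g[OF p]] corr4_spec_unpaired[OF norm_g[OF p]] p
      unfolding W_eq[OF p] by (auto simp: Q0_def)
  qed simp
  also have "\<dots> = 19 ^ card Q * (\<Prod>p\<in>Q. if p \<in> Q0 then real p powr (-1/4) else 1)"
    by (simp add: prod.distrib)
  also have "(\<Prod>p\<in>Q. if p \<in> Q0 then real p powr (-1/4) else 1) = (\<Prod>p\<in>Q0. real p powr (-1/4))"
    using sub(1) finQ by (simp add: prod.If_cases Int_absorb1 Collect_mem_eq)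
  also have "\<dots> = real (\<Prod>Q0) powr (-1/4)"
    by (simp add: prod_powr_distrib)
  finally have le: "norm (\<Prod>p\<in>Q. W p k1 k2 k3 k4) \<le> 19 ^ card Q * real (\<Prod>Q0) powr (-1/4)" .
  have "real (\<Prod>Q0) powr (-1/4) \<le> real n powr (-1/16) + ?S"
  proof (cases "real n powr (1/4) \<le> real (\<Prod>Q0)")
    case True
    have np: "real n powr (1/4) > 0" using n_pos by (simp del: of_nat_prod)
    have "real (\<Prod>Q0) powr (-1/4) \<le> (real n powr (1/4)) powr (-1/4)"
      using True np by (intro powr_mono2') auto
    also have "\<dots> = real n powr (-1/16)" by (simp add: powr_powr)
    finally show ?thesis using S0 by simp
  next
    case False
    have QU: "Q = Q0 \<union> (Q1 \<union> (Q2 \<union> Q3))" by (auto simp: Q0_def Q1_def Q2_def Q3_def paired_def)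
    have un: "real (\<Prod>(A \<union> B)) \<le> real (\<Prod>A) * real (\<Prod>B)" if "A \<subseteq> Q" "B \<subseteq> Q" for A B
    proof -
      have "real (\<Prod>(A \<union> B)) = real (\<Prod>A) * real (\<Prod>(B - A))"
        using fin[OF that(1)] fin[OF that(2)] prod.union_disjoint[of A "B - A" "\<lambda>x. x"]
        by (simp add: Un_Diff_cancel)
      also have "\<Prod>(B - A) dvd \<Prod>B" using fin[OF that(2)] by (intro prod_dvd_prod_subset) auto
      then have "real (\<Prod>(B - A)) \<le> real (\<Prod>B)" using pos[OF that(2)] by (simp add: dvd_imp_le del: of_nat_prod)
      then have "real (\<Prod>A) * real (\<Prod>(B - A)) \<le> real (\<Prod>A) * real (\<Prod>B)" by (intro mult_left_mono) (simp_all del: of_nat_prod)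
      finally show ?thesis .
    qed
    have "real n \<le> real (\<Prod>Q0) * real (\<Prod>(Q1 \<union> (Q2 \<union> Q3)))"
      using un[of Q0 "Q1 \<union> (Q2 \<union> Q3)"] sub QU by simp
    also have "\<dots> \<le> real (\<Prod>Q0) * (real (\<Prod>Q1) * real (\<Prod>(Q2 \<union> Q3)))"
      using un[of Q1 "Q2 \<union> Q3"] sub by (intro mult_left_mono) (simp_all del: of_nat_prod)
    also have "\<dots> \<le> real (\<Prod>Q0) * (real (\<Prod>Q1) * (real (\<Prod>Q2) * real (\<Prod>Q3)))"
      using un[of Q2 Q3] sub by (intro mult_left_mono) (simp_all del: of_nat_prod)
    finally have n4: "real n \<le> real (\<Prod>Q0) * (real (\<Prod>Q1) * (real (\<Prod>Q2) * real (\<Prod>Q3)))" .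
    let ?t = "real n powr (1/4)"
    have tt: "real n = ?t * (?t * (?t * ?t))"
      using n_pos by (simp add: powr_add[symmetric] del: of_nat_prod)
    have "?t \<le> real (\<Prod>Q1) \<or> ?t \<le> real (\<Prod>Q2) \<or> ?t \<le> real (\<Prod>Q3)"
    proof (rule ccontr)
      assume "\<not> ?thesis"
      then have lt: "real (\<Prod>Q1) < ?t" "real (\<Prod>Q2) < ?t" "real (\<Prod>Q3) < ?t" "real (\<Prod>Q0) < ?t"
        using False by auto
      have "real (\<Prod>Q0) * (real (\<Prod>Q1) * (real (\<Prod>Q2) * real (\<Prod>Q3))) < ?t * (?t * (?t * ?t))"
        by (intro mult_strict_mono lt mult_nonneg_nonneg) (use n_pos in \<open>simp_all del: of_nat_prod\<close>)
      with n4 tt show False by simp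
    qed
    then obtain E where E: "E \<in> {Q1, Q2, Q3}" "?t \<le> real (\<Prod>E)" by blast
    have EQ: "E \<subseteq> Q" using E sub by auto
    have "1 \<le> pairing_count (\<Prod>E) k1 k2 k3 k4"
    proof -
      have c: "[a = b] (mod int (\<Prod>E))" if "\<And>p. p \<in> E \<Longrightarrow> [a = b] (mod int p)" for a b
        using that EQ opQ fin[OF EQ] by (intro prod_primes_cong) auto
      from E(1) consider "E = Q1" | "E = Q2" | "E = Q3" by blast
      then show ?thesis
      proof cases
        case 1
        have "[k1 = k2] (mod int (\<Prod>E))" "[k3 = k4] (mod int (\<Prod>E))"
          by (rule c, simp add: 1 Q1_def)+
        then show ?thesis by (simp add: pairing_count_def del: of_nat_prod)
      next
        case 2
        have "[k1 = k3] (mod int (\<Prod>E))" "[k2 = k4] (mod int (\<Prod>E))"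
          by (rule c, simp add: 2 Q2_def)+
        then show ?thesis by (simp add: pairing_count_def del: of_nat_prod)
      next
        case 3
        have "[k1 = k4] (mod int (\<Prod>E))" "[k2 = k3] (mod int (\<Prod>E))"
          by (rule c, simp add: 3 Q3_def)+
        then show ?thesis by (simp add: pairing_count_def del: of_nat_prod)
      qed
    qed
    also have "pairing_count (\<Prod>E) k1 k2 k3 k4 \<le> ?S"
      using E EQ finQ by (intro member_le_sum pairing_count_nonneg) auto
    finally have "1 \<le> ?S" .
    moreover have "real (\<Prod>Q0) powr (-1/4) \<le> real (\<Prod>Q0) powr 0"
      using pos[OF sub(1)] by (intro powr_mono) auto
    then have "real (\<Prod>Q0) powr (-1/4) \<le> 1" using pos[OF sub(1)] by (simp del: of_nat_prod split: if_splits)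
    moreover have "0 \<le> real n powr (-1/16)" by simp
    ultimately show ?thesis by linarith
  qed
  then have "19 ^ card Q * real (\<Prod>Q0) powr (-1/4) \<le> 19 ^ card Q * (real n powr (-1/16) + ?S)"
    by (intro mult_left_mono) auto
  with le show ?thesis by linarith
qed

end

section \<open>The Dirichlet kernel\<close>

definition dker :: "nat \<Rightarrow> real \<Rightarrow> complex" where
  "dker t x = (\<Sum>j\<in>res t. ee (of_int j * x))"

lemma dker_periodic: "dker t (x + of_int z) = dker t x"
proof -
  have "ee (of_int j * (x + of_int z)) = ee (of_int j * x)" for j
    using ee_periodic[of "of_int j * x" "j * z"] by (simp add: algebra_simps)
  then show ?thesis by (simp add: dker_def)
qed

lemma norm_dker_le: "norm (dker t x) \<le> real t"
proof -
  have "norm (dker t x) \<le> of_nat (card (res t)) * 1"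
    unfolding dker_def by (rule sum_norm_bound) simp
  then show ?thesis by simp
qed

lemma sin_pi_ge:
  assumes "0 \<le> x" "x \<le> 1 / 2"
  shows "x \<le> sin (pi * x)"
proof (cases "x \<le> 1 / 3")
  case True
  show ?thesis
  proof (cases "x = 0")
    case False
    then have "0 < pi * x" using assms by simp
    then obtain z where z: "0 < z" "z < pi * x" "sin (pi * x) - sin 0 = (pi * x - 0) * cos z"
      using MVT2[of 0 "pi * x" sin cos] DERIV_sin by blast
    have "pi * x \<le> pi / 3" using True by (simp add: field_simps)
    then have "z \<le> pi / 3" using z by linarith
    then have "cos (pi / 3) \<le> cos z" using z by (intro cos_monotone_0_pi_le) auto
    then have "1 / 2 \<le> cos z" by (simp add: cos_60)
    then have "pi * x * (1 / 2) \<le> pi * x * cos z" using assms by (intro mult_left_mono) auto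
    moreover have "2 * x \<le> pi * x" using assms pi_ge_two by (intro mult_right_mono) auto
    ultimately have "x \<le> pi * x * cos z" by linarith
    then show ?thesis using z(3) by simp
  qed simp
next
  case False
  have "pi / 3 \<le> pi * x" "pi * x \<le> pi / 2" using False assms by (simp_all add: field_simps)
  moreover have "- (pi / 2) \<le> pi / 3" using pi_gt_zero by linarith
  ultimately have "sin (pi / 3) \<le> sin (pi * x)" by (intro sin_monotone_2pi_le)
  then have "sqrt 3 / 2 \<le> sin (pi * x)" by (simp only: sin_60)
  moreover have "1 \<le> sqrt 3" by simp
  ultimately show ?thesis using assms by linarith
qed

lemma norm_dker_le_inverse:
  assumes "0 < x" "x < 1"
  shows "norm (dker t x) \<le> 1 / min x (1 - x)"
proof -
  have geo: "dker t x * (ee x - 1) = ee (of_nat t * x) - 1"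
  proof (induction t)
    case (Suc t)
    have "res (Suc t) = insert (int t) (res t)" by auto
    then have "dker (Suc t) x = dker t x + ee (of_nat t * x)" by (simp add: dker_def)
    with Suc show ?case by (simp add: algebra_simps ee_add)
  qed (simp add: dker_def)
  have m: "min x (1 - x) \<le> sin (pi * x)"
  proof (cases "x \<le> 1 / 2")
    case True
    then show ?thesis using sin_pi_ge[of x] assms by simp
  next
    case False
    have "sin (pi * (1 - x)) = sin (pi * x)" by (simp add: right_diff_distrib)
    then show ?thesis using sin_pi_ge[of "1 - x"] assms False by simp
  qed
  have "norm (ee x - 1) = 2 * \<bar>sin (pi * x)\<bar>"
    using dist_exp_i_1[of "2 * pi * x"] by (simp add: ee_def cis_conv_exp)
  moreover have "min x (1 - x) \<le> \<bar>sin (pi * x)\<bar>" by (rule order_trans[OF m abs_ge_self])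
  ultimately have low: "2 * min x (1 - x) \<le> norm (ee x - 1)" by (simp only: mult_left_mono)
  have "norm (dker t x) * (2 * min x (1 - x)) \<le> norm (dker t x) * norm (ee x - 1)"
    using low by (intro mult_left_mono) auto
  also have "\<dots> = norm (ee (of_nat t * x) - 1)" by (simp add: norm_mult[symmetric] geo)
  also have "\<dots> \<le> 2" using norm_triangle_ineq4[of "ee (of_nat t * x)" 1] by simp
  finally have "norm (dker t x) * min x (1 - x) \<le> 1" by simp
  then show ?thesis using assms by (simp add: le_divide_eq)
qed

definition near :: "real \<Rightarrow> real \<Rightarrow> bool" where
  "near d x \<longleftrightarrow> (\<exists>z::int. \<bar>x - of_int z\<bar> < d)"

lemma near_periodic: "near d (x + of_int z) = near d x"
proof -
  have "near d (x + of_int z)" if "near d x" for x and z :: int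
  proof -
    from that obtain y :: int where "\<bar>x - of_int y\<bar> < d" by (auto simp: near_def)
    then have "\<bar>(x + of_int z) - of_int (y + z)\<bar> < d" by simp
    then show ?thesis unfolding near_def by blast
  qed
  from this[of x z] this[of "x + of_int z" "- z"] show ?thesis by auto
qed

text \<open>
  The Dirichlet kernel with its peak removed. Among \<open>f\<close> equally spaced points of the circle at most one
  is lost in this way, and the remaining values have a sum of order \<open>f ln f\<close> that does not depend on \<open>t\<close>.
\<close>

definition far_kernel :: "nat \<Rightarrow> nat \<Rightarrow> real \<Rightarrow> real" where
  "far_kernel t f x = (if near (1 / (2 * real f)) x then 0 else norm (dker t x))"

lemma far_kernel_periodic: "far_kernel t f (x + of_int z) = far_kernel t f x"
  by (simp add: far_kernel_def near_periodic dker_periodic)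

lemma far_kernel_nonneg: "0 \<le> far_kernel t f x"
  by (simp add: far_kernel_def)

lemma harm_le: "n > 0 \<Longrightarrow> harm n \<le> 1 + ln (real n)"
proof -
  assume "n > 0"
  then obtain k where k: "n = Suc k" by (cases n) auto
  have "harm (Suc k) - ln (real (Suc k)) \<le> harm (Suc 0) - ln (real (Suc 0))"
    using decseq_harm_diff_ln by (rule decseqD) simp
  then show ?thesis by (simp add: k harm_def)
qed

text \<open>
  The kernel at \<open>x\<close> is at most the larger of \<open>1/x\<close> and \<open>1/(1 - x)\<close>. The bound is uniform in \<open>th\<close>: in the interior
  of the range this costs a factor 2, and at its two ends the removal of the peak gives \<open>1 / (2 f) \<le> x \<le> 1 - 1 / (2 f)\<close>.
\<close>

lemma far_kernel_le:
  assumes f: "f > 0" and th: "0 \<le> th" "th < 1" and i: "i \<in> res f"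
  shows "far_kernel t f ((th + of_int i) / real f) \<le> 2 * real f / (of_int i + 1) + 2 * real f / (real f - of_int i)"
proof -
  let ?x = "(th + of_int i) / real f"
  have i1: "0 \<le> i" "real_of_int i + 1 \<le> real f"
  proof -
    have "i + 1 \<le> int f" using i by simp
    then have "real_of_int (i + 1) \<le> real_of_int (int f)" by (simp only: of_int_le_iff)
    then show "real_of_int i + 1 \<le> real f" by simp
  qed (use i in simp)
  have pos: "2 * real f / (of_int i + 1) \<ge> 0" "2 * real f / (real f - of_int i) \<ge> 0" using i1 by simp_all
  show ?thesis
  proof (cases "near (1 / (2 * real f)) ?x")
    case True
    then show ?thesis using pos by (simp add: far_kernel_def)
  next
    case False
    then have nn: "1 / (2 * real f) \<le> \<bar>?x - of_int z\<bar>" for z :: int unfolding near_def by (meson not_le)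
    have x01: "0 \<le> ?x" "?x < 1" using th i1 f by (simp_all add: divide_less_eq)
    have d: "0 < 1 / (2 * real f)" using f by simp
    have x0: "1 / (2 * real f) \<le> ?x" using nn[of 0] x01 by simp
    have x1: "1 / (2 * real f) \<le> 1 - ?x" using nn[of 1] x01 by simp
    have "norm (dker t ?x) \<le> 1 / min ?x (1 - ?x)"
      using x0 x1 d by (intro norm_dker_le_inverse) linarith+
    also have "\<dots> \<le> 2 * real f / (of_int i + 1) + 2 * real f / (real f - of_int i)"
    proof -
      have a: "1 / ?x \<le> 2 * real f / (of_int i + 1)"
      proof -
        have "(of_int i + 1) / (2 * real f) \<le> ?x"
        proof (cases "i = 0")
          case True
          then show ?thesis using x0 by simp
        next
          case False
          then have "1 \<le> real_of_int i" using i1 by linarith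
          then have "(of_int i + 1) \<le> 2 * (th + of_int i)" using th by simp
          then have "(of_int i + 1) / (2 * real f) \<le> 2 * (th + of_int i) / (2 * real f)"
            using f by (intro divide_right_mono) auto
          also have "2 * (th + of_int i) / (2 * real f) = ?x" by (rule mult_divide_mult_cancel_left) simp
          finally show ?thesis .
        qed
        moreover have "0 < (of_int i + 1) / (2 * real f)" using i1 f by simp
        ultimately have "1 / ?x \<le> 1 / ((of_int i + 1) / (2 * real f))" by (intro divide_left_mono mult_pos_pos) linarith+
        then show ?thesis by simp
      qed
      have b: "1 / (1 - ?x) \<le> 2 * real f / (real f - of_int i)"
      proof -
        have "(real f - of_int i) / (2 * real f) \<le> 1 - ?x"
        proof (cases "i = int f - 1")
          case True
          then have "real f - of_int i = 1" by simp
          then show ?thesis using x1 by simp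
        next
          case False
          then have "i + 2 \<le> int f" using i by simp
          then have "real_of_int (i + 2) \<le> real_of_int (int f)" by (simp only: of_int_le_iff)
          then have "2 * (th + of_int i) + (real f - of_int i) \<le> 2 * real f" using th by simp
          then have "real f - of_int i \<le> 2 * (real f - (th + of_int i))" by simp
          then have "(real f - of_int i) / (2 * real f) \<le> 2 * (real f - (th + of_int i)) / (2 * real f)"
            using f by (intro divide_right_mono) auto
          also have "2 * (real f - (th + of_int i)) / (2 * real f) = (real f - (th + of_int i)) / real f"
            by (rule mult_divide_mult_cancel_left) simp
          also have "\<dots> = 1 - ?x" using f by (simp add: diff_divide_distrib)
          finally show ?thesis .
        qed
        moreover have "0 < (real f - of_int i) / (2 * real f)" using i1 f by simp
        ultimately have "1 / (1 - ?x) \<le> 1 / ((real f - of_int i) / (2 * real f))" by (intro divide_left_mono mult_pos_pos) linarith+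
        then show ?thesis by simp
      qed
      show ?thesis using a b pos by (auto simp: min_def)
    qed
    finally show ?thesis using False by (simp add: far_kernel_def)
  qed
qed

lemma far_kernel_sum:
  assumes f: "f > 0"
  shows "(\<Sum>i\<in>res f. far_kernel t f (x + of_int i / real f)) \<le> 4 * real f * (1 + ln (real f))"
proof -
  define q where "q = \<lfloor>real f * x\<rfloor>"
  define th where "th = real f * x - of_int q"
  have th: "0 \<le> th" "th < 1" unfolding th_def q_def by linarith+
  let ?F = "\<lambda>i. far_kernel t f (x + of_int i / real f)"
  have "periodic f ?F"
  proof (rule periodicI_add)
    fix i
    have "x + of_int (i + int f) / real f = (x + of_int i / real f) + of_int 1" using f by (simp add: field_simps)
    then show "?F (i + int f) = ?F i" by (simp only: far_kernel_periodic)
  qed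
  then have "(\<Sum>i\<in>res f. ?F i) = (\<Sum>i\<in>res f. ?F (i + (- q)))"
    by (rule sum_residues_shift[OF f, symmetric])
  also have "\<dots> = (\<Sum>i\<in>res f. far_kernel t f ((th + of_int i) / real f))"
    using f by (intro sum.cong refl arg_cong[of _ _ "far_kernel t f"]) (simp add: th_def field_simps)
  also have "\<dots> \<le> (\<Sum>i\<in>res f. 2 * real f / (of_int i + 1) + 2 * real f / (real f - of_int i))"
    by (intro sum_mono far_kernel_le f th)
  also have "\<dots> = 2 * real f * (\<Sum>i\<in>res f. 1 / (of_int i + 1)) + 2 * real f * (\<Sum>i\<in>res f. 1 / (real f - of_int i))"
    by (simp add: sum.distrib sum_distrib_left)
  also have "(\<Sum>i\<in>res f. 1 / (of_int i + 1)) = (harm f :: real)"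
    unfolding harm_def
    by (rule sum.reindex_bij_witness[of _ "\<lambda>k. int k - 1" "\<lambda>i. nat (i + 1)"]) (auto simp: inverse_eq_divide)
  also have "(\<Sum>i\<in>res f. 1 / (real f - of_int i)) = (harm f :: real)"
    unfolding harm_def
    by (rule sum.reindex_bij_witness[of _ "\<lambda>k. int f - int k" "\<lambda>i. nat (int f - i)"]) (auto simp: inverse_eq_divide)
  also have "2 * real f * harm f + 2 * real f * harm f \<le> 4 * real f * (1 + ln (real f))"
    using mult_left_mono[OF harm_le[OF f], of "4 * real f"] by (simp add: mult.commute)
  finally show ?thesis .
qed

lemma near_unique:
  assumes f: "f > 0" and "near (1 / (2 * real f)) x" "near (1 / (2 * real f)) (x + of_int q / real f)"
  shows "int f dvd q"
proof -
  obtain y z :: int where y: "\<bar>x - of_int y\<bar> < 1 / (2 * real f)"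
    and z: "\<bar>x + of_int q / real f - of_int z\<bar> < 1 / (2 * real f)"
    using assms by (auto simp: near_def)
  have "\<bar>of_int q / real f - of_int (z - y)\<bar> \<le> \<bar>x + of_int q / real f - of_int z\<bar> + \<bar>x - of_int y\<bar>" by simp
  also have "\<dots> < 1 / (2 * real f) + 1 / (2 * real f)" using y z by linarith
  also have "\<dots> = 1 / real f" by simp
  finally have "\<bar>of_int q / real f - of_int (z - y)\<bar> * real f < 1" using f by (simp add: less_divide_eq)
  moreover have "\<bar>of_int q / real f - of_int (z - y)\<bar> * real f = \<bar>(of_int q / real f - of_int (z - y)) * real f\<bar>"
    by (simp add: abs_mult)
  moreover have "(of_int q / real f - of_int (z - y)) * real f = of_int (q - (z - y) * int f)"
    using f by (simp add: field_simps)
  ultimately have "\<bar>q - (z - y) * int f\<bar> < 1" by linarith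
  then have "q = (z - y) * int f" by simp
  then show ?thesis by simp
qed

lemma kernel_sum_le:
  assumes m: "m > 0"
  shows "(\<Sum>k\<in>res m. norm (dker t (x + of_int k / real m))) \<le> real t + 4 * real m * (1 + ln (real m))"
proof -
  let ?N = "{k\<in>res m. near (1 / (2 * real m)) (x + of_int k / real m)}"
  have "k = l" if "k \<in> ?N" "l \<in> ?N" for k l
  proof -
    have "x + of_int k / real m + of_int (l - k) / real m = x + of_int l / real m" by (simp add: diff_divide_distrib)
    then have "int m dvd l - k" using near_unique[OF m, of "x + of_int k / real m" "l - k"] that
      by (simp only: mem_Collect_eq)
    then show ?thesis using that zdvd_not_zless[of "l - k" "int m"] zdvd_not_zless[of "k - l" "int m"]
      by (cases "l > k"; cases "l < k") (auto simp: dvd_diff_commute)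
  qed
  moreover have "finite ?N" by (rule finite_subset[of _ "res m"]) auto
  ultimately have "card ?N \<le> Suc 0" by (subst card_le_Suc0_iff_eq) blast+
  then have card: "card ?N \<le> 1" by simp
  have "(\<Sum>k\<in>res m. norm (dker t (x + of_int k / real m)))
    \<le> (\<Sum>k\<in>res m. (if k \<in> ?N then real t else 0) + far_kernel t m (x + of_int k / real m))"
    by (intro sum_mono) (auto simp: far_kernel_def norm_dker_le)
  also have "\<dots> = real (card ?N) * real t + (\<Sum>k\<in>res m. far_kernel t m (x + of_int k / real m))"
    by (simp add: sum.distrib sum.If_cases Int_def)
  also have "\<dots> \<le> 1 * real t + 4 * real m * (1 + ln (real m))"
    using card by (intro add_mono mult_right_mono far_kernel_sum m) auto
  finally show ?thesis by simp
qed

lemma sum_congruence_class: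
  fixes F :: "int \<Rightarrow> 'a::semiring_1"
  assumes m: "m = e * f" "e > 0" "f > 0" and F: "periodic m F"
  shows "(\<Sum>l\<in>res m. of_bool ([k = l] (mod int e)) * F l) = (\<Sum>i\<in>res f. F (k + int e * i))"
proof -
  have m0: "m > 0" using m by simp
  let ?h = "\<lambda>i. (k + int e * i) mod int m"
  have inj: "inj_on ?h (res f)"
  proof (rule inj_onI)
    fix i j assume ij: "i \<in> res f" "j \<in> res f" "?h i = ?h j"
    then have "int m dvd int e * i - int e * j" by (simp add: mod_eq_dvd_iff)
    then have "int e * int f dvd int e * (i - j)" by (simp add: m right_diff_distrib)
    then have "int f dvd i - j" using m by simp
    then have "i mod int f = j mod int f" by (simp add: mod_eq_dvd_iff)
    with ij show "i = j" by simp
  qed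
  have img: "?h ` res f = {l\<in>res m. [k = l] (mod int e)}"
  proof (intro equalityI subsetI)
    fix l assume "l \<in> ?h ` res f"
    then obtain i where i: "l = ?h i" by blast
    have "[?h i = k + int e * i] (mod int m)" by (simp add: cong_def)
    then have "[?h i = k + int e * i] (mod int e)" unfolding m(1) of_nat_mult by (rule cong_modulus_mult)
    then have "[k = ?h i] (mod int e)" by (simp add: cong_def)
    then show "l \<in> {l\<in>res m. [k = l] (mod int e)}" using i m0 by simp
  next
    fix l assume l: "l \<in> {l\<in>res m. [k = l] (mod int e)}"
    then have "int e dvd l - k" by (simp add: cong_iff_dvd_diff dvd_diff_commute)
    then obtain q where q: "l - k = int e * q" by blast
    have "?h (q mod int f) = l"
    proof -
      have "int m dvd int e * q - int e * (q mod int f)"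
      proof -
        have "int f dvd q - q mod int f" by (simp add: dvd_minus_mod)
        then have "int e * int f dvd int e * (q - q mod int f)" by simp
        then show ?thesis by (simp add: m right_diff_distrib)
      qed
      then have "(k + int e * (q mod int f)) mod int m = (k + int e * q) mod int m"
        by (simp add: mod_eq_dvd_iff dvd_diff_commute)
      then show ?thesis using q l by simp
    qed
    moreover have "q mod int f \<in> res f" using m by simp
    ultimately show "l \<in> ?h ` res f" by blast
  qed
  have "(\<Sum>l\<in>res m. of_bool ([k = l] (mod int e)) * F l) = (\<Sum>l\<in>{l\<in>res m. [k = l] (mod int e)}. F l)"
    by (rule sum.mono_neutral_cong_right) auto
  also have "\<dots> = (\<Sum>i\<in>res f. F (?h i))" unfolding img[symmetric] by (simp add: sum.reindex[OF inj])
  also have "\<dots> = (\<Sum>i\<in>res f. F (k + int e * i))" using F by (simp add: periodic_def)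
  finally show ?thesis .
qed

text \<open>
  Two different frequencies that agree modulo \<open>e\<close> give points of the circle whose distance is a multiple of
  \<open>e/m\<close>, so at most one of them lies at the peak of the kernel. The other one can be summed over its class
  modulo \<open>e\<close> at the cost of \<open>m/e\<close> instead of \<open>m\<close>, up to logarithms.
\<close>

lemma kernel_pair_sum_le:
  fixes x :: real and t :: nat
  assumes e: "e dvd m" and m: "m > 0"
  defines "kp \<equiv> \<lambda>k. norm (dker t (x + of_int k / real m))"
  shows "(\<Sum>k\<in>res m. \<Sum>l\<in>res m. of_bool ([k = l] (mod int e) \<and> k \<noteq> l) * (kp k * kp l))
     \<le> 8 * (real m / real e) * (1 + ln (real m)) * (real t + 4 * real m * (1 + ln (real m)))"
proof -
  obtain f where f: "m = e * f" using e by blast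
  have ef: "e > 0" "f > 0" using m f by simp_all
  have mf: "real m / real e = real f" using ef f by simp
  define fk where "fk l = far_kernel t f (x + of_int l / real m)" for l
  let ?R = "4 * real f * (1 + ln (real f))"
  have kp0: "0 \<le> kp k" for k by (simp add: kp_def)
  have fk0: "0 \<le> fk k" for k by (simp add: fk_def far_kernel_nonneg)
  have "periodic m fk"
  proof (rule periodicI_add)
    fix i
    have "x + of_int (i + int m) / real m = (x + of_int i / real m) + of_int 1" using m by (simp add: field_simps)
    then show "fk (i + int m) = fk i" by (simp only: fk_def far_kernel_periodic)
  qed
  then have R: "(\<Sum>l\<in>res m. of_bool ([k = l] (mod int e)) * fk l) \<le> ?R" for k
  proof -
    assume per: "periodic m fk"
    have "(\<Sum>l\<in>res m. of_bool ([k = l] (mod int e)) * fk l) = (\<Sum>i\<in>res f. fk (k + int e * i))"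
      by (rule sum_congruence_class[OF f ef per])
    also have "\<dots> = (\<Sum>i\<in>res f. far_kernel t f ((x + of_int k / real m) + of_int i / real f))"
      unfolding fk_def using ef
      by (intro sum.cong refl arg_cong[of _ _ "far_kernel t f"]) (simp add: f field_simps)
    also have "\<dots> \<le> ?R" by (rule far_kernel_sum[OF ef(2)])
    finally show ?thesis .
  qed
  have pt: "of_bool ([k = l] (mod int e) \<and> k \<noteq> l) * (kp k * kp l)
      \<le> kp k * (of_bool ([k = l] (mod int e)) * fk l) + kp l * (of_bool ([l = k] (mod int e)) * fk k)"
    if kl: "k \<in> res m" "l \<in> res m" for k l
  proof (cases "[k = l] (mod int e) \<and> k \<noteq> l")
    case False
    then have "of_bool ([k = l] (mod int e) \<and> k \<noteq> l) = (0 :: real)" by simp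
    moreover have "0 \<le> kp k * (of_bool ([k = l] (mod int e)) * fk l) + kp l * (of_bool ([l = k] (mod int e)) * fk k)"
      by (intro add_nonneg_nonneg mult_nonneg_nonneg kp0 fk0) simp_all
    ultimately show ?thesis by (simp only: mult_zero_left)
  next
    case True
    let ?n = "\<lambda>l. near (1 / (2 * real f)) (x + of_int l / real m)"
    have "\<not> (?n k \<and> ?n l)"
    proof
      assume nn: "?n k \<and> ?n l"
      have "int e dvd l - k" using True by (simp add: cong_iff_dvd_diff dvd_diff_commute)
      then obtain q where q: "l - k = int e * q" by blast
      then have lq: "l = k + int e * q" by simp
      have "x + of_int l / real m = (x + of_int k / real m) + of_int q / real f"
        using ef by (simp add: lq f field_simps)
      then have "int f dvd q" using near_unique[OF ef(2), of "x + of_int k / real m" q] nn by (simp only:)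
      then have "int m dvd l - k" unfolding q f by simp
      then have "l mod int m = k mod int m" by (simp add: mod_eq_dvd_iff)
      with kl True show False by simp
    qed
    moreover have "fk l = kp l" if "\<not> ?n l" for l using that by (simp add: fk_def kp_def far_kernel_def)
    moreover have "[l = k] (mod int e)" using True by (simp add: cong_sym)
    ultimately show ?thesis using True kp0 fk0 by (auto simp: mult.commute add_increasing add_increasing2)
  qed
  have "(\<Sum>k\<in>res m. \<Sum>l\<in>res m. of_bool ([k = l] (mod int e) \<and> k \<noteq> l) * (kp k * kp l))
     \<le> (\<Sum>k\<in>res m. \<Sum>l\<in>res m. kp k * (of_bool ([k = l] (mod int e)) * fk l) + kp l * (of_bool ([l = k] (mod int e)) * fk k))"
    by (intro sum_mono pt)
  also have "\<dots> = (\<Sum>k\<in>res m. \<Sum>l\<in>res m. kp k * (of_bool ([k = l] (mod int e)) * fk l))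
     + (\<Sum>k\<in>res m. \<Sum>l\<in>res m. kp l * (of_bool ([l = k] (mod int e)) * fk k))"
    by (simp add: sum.distrib)
  also have "(\<Sum>k\<in>res m. \<Sum>l\<in>res m. kp l * (of_bool ([l = k] (mod int e)) * fk k))
     = (\<Sum>k\<in>res m. \<Sum>l\<in>res m. kp k * (of_bool ([k = l] (mod int e)) * fk l))"
    by (rule sum.swap)
  also have "(\<Sum>k\<in>res m. \<Sum>l\<in>res m. kp k * (of_bool ([k = l] (mod int e)) * fk l))
     = (\<Sum>k\<in>res m. kp k * (\<Sum>l\<in>res m. of_bool ([k = l] (mod int e)) * fk l))"
    by (simp only: sum_distrib_left)
  also have "\<dots> \<le> (\<Sum>k\<in>res m. kp k * ?R)" by (intro sum_mono mult_left_mono R kp0)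
  also have "\<dots> = (\<Sum>k\<in>res m. kp k) * ?R" by (simp only: sum_distrib_right)
  finally have le: "(\<Sum>k\<in>res m. \<Sum>l\<in>res m. of_bool ([k = l] (mod int e) \<and> k \<noteq> l) * (kp k * kp l)) \<le> 2 * ((\<Sum>k\<in>res m. kp k) * ?R)"
    by (simp only: mult_2)
  have "f \<le> m" using ef f by simp
  then have ln: "ln (real f) \<le> ln (real m)" "0 \<le> ln (real f)" using ef by simp_all
  have "(\<Sum>k\<in>res m. kp k) * ?R \<le> (real t + 4 * real m * (1 + ln (real m))) * (4 * real f * (1 + ln (real m)))"
    using kernel_sum_le[OF m, of t x] ln unfolding kp_def
    by (intro mult_mono) (auto intro!: mult_nonneg_nonneg add_nonneg_nonneg)
  then have "2 * ((\<Sum>k\<in>res m. kp k) * ?R)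
      \<le> 2 * ((real t + 4 * real m * (1 + ln (real m))) * (4 * real f * (1 + ln (real m))))" by simp
  also have "\<dots> = 8 * real f * (1 + ln (real m)) * (real t + 4 * real m * (1 + ln (real m)))"
    by (simp add: mult_ac)
  finally show ?thesis unfolding mf by (rule order_trans[OF le])
qed

lemma kernel_square_sum_le:
  assumes m: "m > 0"
  shows "(\<Sum>k\<in>res m. norm (dker t (x + of_int k / real m)) ^ 2) \<le> real t * (real t + 4 * real m * (1 + ln (real m)))"
proof -
  have "(\<Sum>k\<in>res m. norm (dker t (x + of_int k / real m)) ^ 2) \<le> (\<Sum>k\<in>res m. real t * norm (dker t (x + of_int k / real m)))"
    unfolding power2_eq_square by (intro sum_mono mult_right_mono norm_dker_le) auto
  also have "\<dots> \<le> real t * (real t + 4 * real m * (1 + ln (real m)))"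
    unfolding sum_distrib_left[symmetric] by (intro mult_left_mono kernel_sum_le m) auto
  finally show ?thesis .
qed

section \<open>Additive quadruples\<close>

definition quads :: "nat \<Rightarrow> (int \<times> int \<times> int \<times> int) set" where
  "quads t = {(j1, j2, j3, j4). j1 \<in> res t \<and> j2 \<in> res t \<and> j3 \<in> res t \<and> j4 \<in> res t \<and> j1 + j2 = j3 + j4}"

definition quad_sum :: "(int \<Rightarrow> complex) \<Rightarrow> int \<Rightarrow> nat \<Rightarrow> complex" where
  "quad_sum c r t = (\<Sum>(j1, j2, j3, j4)\<in>quads t. c (j1 + r) * c (j2 + r) * cnj (c (j3 + r)) * cnj (c (j4 + r)))"

definition quad_char :: "nat \<Rightarrow> int \<Rightarrow> nat \<Rightarrow> int \<Rightarrow> int \<Rightarrow> int \<Rightarrow> int \<Rightarrow> complex" where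
  "quad_char m r t k1 k2 k3 k4 = (\<Sum>(j1, j2, j3, j4)\<in>quads t.
     ee (of_int (k1 * (j1 + r) + k2 * (j2 + r) - k3 * (j3 + r) - k4 * (j4 + r)) / of_nat m))"

lemma sum_quads:
  fixes f :: "int \<times> int \<times> int \<times> int \<Rightarrow> 'a::semiring_1"
  shows "(\<Sum>q\<in>quads t. f q) = sum4 (res t) (\<lambda>j1 j2 j3 j4. of_bool (j1 + j2 = j3 + j4) * f (j1, j2, j3, j4))"
proof -
  have "(\<Sum>q\<in>quads t. f q) = (\<Sum>(j1, j2, j3, j4)\<in>res t \<times> res t \<times> res t \<times> res t.
      of_bool (j1 + j2 = j3 + j4) * f (j1, j2, j3, j4))"
    by (rule sum.mono_neutral_cong_left) (auto simp: quads_def split: prod.splits)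
  then show ?thesis
    by (simp add: sum.cartesian_product case_prod_unfold del: sum_of_bool_mult_eq sum_mult_of_bool_eq)
qed

lemma sum4_product:
  fixes a b c d :: "int \<Rightarrow> 'a::comm_semiring_1"
  shows "sum4 A (\<lambda>k1 k2 k3 k4. a k1 * b k2 * c k3 * d k4) = sum a A * sum b A * sum c A * sum d A"
  by (simp only: sum_distrib_left[symmetric] sum_distrib_right[symmetric])

lemma times_sum4: "(c :: 'a::semiring_0) * sum4 A F = sum4 A (\<lambda>k1 k2 k3 k4. c * F k1 k2 k3 k4)"
  by (simp only: sum_distrib_left)

text \<open>
  A common shift by \<open>x\<close> changes the exponent by \<open>x (j1 + j2 - j3 - j4) = 0\<close>.
\<close>

lemma quad_char_shift:
  "quad_char m r t (k1 + x) (k2 + x) (k3 + x) (k4 + x) = quad_char m r t k1 k2 k3 k4"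
proof -
  have "(k1 + x) * (j1 + r) + (k2 + x) * (j2 + r) - (k3 + x) * (j3 + r) - (k4 + x) * (j4 + r)
      = k1 * (j1 + r) + k2 * (j2 + r) - k3 * (j3 + r) - k4 * (j4 + r)"
    if "j1 + j2 = j3 + j4" for j1 j2 j3 j4 :: int
  proof -
    have "x * (j1 + j2) = x * (j3 + j4)" using that by simp
    then show ?thesis by (simp add: algebra_simps)
  qed
  then show ?thesis unfolding quad_char_def by (intro sum.cong refl) (auto simp only: quads_def mem_Collect_eq prod.case)
qed

lemma periodic_ee_step:
  assumes "m > 0" "\<And>k. f (k + int m) = f k + int m * b"
  shows "periodic m (\<lambda>k. ee (of_int (f k) / of_nat m))"
proof (rule periodicI_add)
  fix k
  have "real_of_int (f (k + int m)) / real m = real_of_int (f k) / real m + of_int b"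
    using assms by (simp add: field_simps)
  then show "ee (real_of_int (f (k + int m)) / real m) = ee (real_of_int (f k) / real m)"
    by (simp only: ee_periodic)
qed

lemma periodic_sum:
  assumes "\<And>i. i \<in> I \<Longrightarrow> periodic m (\<lambda>k. f k i)"
  shows "periodic m (\<lambda>k. \<Sum>i\<in>I. f k i)"
  using assms by (simp add: periodic_def)

lemma periodic_quad_char:
  assumes "m > 0"
  shows "periodic m (\<lambda>k. quad_char m r t k k2 k3 k4)" "periodic m (\<lambda>k. quad_char m r t k1 k k3 k4)"
    "periodic m (\<lambda>k. quad_char m r t k1 k2 k k4)" "periodic m (\<lambda>k. quad_char m r t k1 k2 k3 k)"
proof -
  show "periodic m (\<lambda>k. quad_char m r t k k2 k3 k4)" unfolding quad_char_def case_prod_unfold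
  proof (rule periodic_sum)
    fix q :: "int \<times> int \<times> int \<times> int"
    show "periodic m (\<lambda>k. ee (of_int (k * (fst q + r) + k2 * (fst (snd q) + r) - k3 * (fst (snd (snd q)) + r) - k4 * (snd (snd (snd q)) + r)) / of_nat m))"
      by (rule periodic_ee_step[OF assms, where b = "fst q + r"]) (simp add: algebra_simps)
  qed
  show "periodic m (\<lambda>k. quad_char m r t k1 k k3 k4)" unfolding quad_char_def case_prod_unfold
  proof (rule periodic_sum)
    fix q :: "int \<times> int \<times> int \<times> int"
    show "periodic m (\<lambda>k. ee (of_int (k1 * (fst q + r) + k * (fst (snd q) + r) - k3 * (fst (snd (snd q)) + r) - k4 * (snd (snd (snd q)) + r)) / of_nat m))"
      by (rule periodic_ee_step[OF assms, where b = "fst (snd q) + r"]) (simp add: algebra_simps)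
  qed
  show "periodic m (\<lambda>k. quad_char m r t k1 k2 k k4)" unfolding quad_char_def case_prod_unfold
  proof (rule periodic_sum)
    fix q :: "int \<times> int \<times> int \<times> int"
    show "periodic m (\<lambda>k. ee (of_int (k1 * (fst q + r) + k2 * (fst (snd q) + r) - k * (fst (snd (snd q)) + r) - k4 * (snd (snd (snd q)) + r)) / of_nat m))"
      by (rule periodic_ee_step[OF assms, where b = "- (fst (snd (snd q)) + r)"]) (simp add: algebra_simps)
  qed
  show "periodic m (\<lambda>k. quad_char m r t k1 k2 k3 k)" unfolding quad_char_def case_prod_unfold
  proof (rule periodic_sum)
    fix q :: "int \<times> int \<times> int \<times> int"
    show "periodic m (\<lambda>k. ee (of_int (k1 * (fst q + r) + k2 * (fst (snd q) + r) - k3 * (fst (snd (snd q)) + r) - k * (snd (snd (snd q)) + r)) / of_nat m))"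
      by (rule periodic_ee_step[OF assms, where b = "- (snd (snd (snd q)) + r)"]) (simp add: algebra_simps)
  qed
qed

lemma quad_sum_spectral:
  assumes m: "m > 0" and c: "periodic m c"
  shows "quad_sum c r t = sum4 (res m) (\<lambda>k1 k2 k3 k4. corr4 m (dft m c) k1 k2 k3 k4 * quad_char m r t k1 k2 k3 k4) / of_nat m ^ 5"
proof -
  let ?B = "dft m c" and ?D = "quad_char m r t"
  let ?G = "\<lambda>k1 k2 k3 k4. ?B k1 * ?B k2 * cnj (?B k3) * cnj (?B k4)"
  let ?e = "\<lambda>j k. ee (of_int (j * k) / of_nat m)"
  let ?S = "sum4 (res m) (\<lambda>k1 k2 k3 k4. ?G k1 k2 k3 k4 * ?D k1 k2 k3 k4)"
  have m0: "of_nat m \<noteq> (0 :: complex)" using m by simp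
  have inv: "of_nat m * c j = (\<Sum>k\<in>res m. ?B k * ?e j k)" for j
    using dft_inversion[OF m c, of j] m0 by simp
  have cinv: "of_nat m * cnj (c j) = (\<Sum>k\<in>res m. cnj (?B k) * ?e (- j) k)" for j
    using arg_cong[OF inv, of cnj j] by (simp add: cnj_ee)
  have prod: "of_nat m ^ 4 * (c (j1 + r) * c (j2 + r) * cnj (c (j3 + r)) * cnj (c (j4 + r)))
    = sum4 (res m) (\<lambda>k1 k2 k3 k4. ?G k1 k2 k3 k4 *
        ee (of_int (k1 * (j1 + r) + k2 * (j2 + r) - k3 * (j3 + r) - k4 * (j4 + r)) / of_nat m))" for j1 j2 j3 j4
  proof -
    have "of_nat m ^ 4 * (c (j1 + r) * c (j2 + r) * cnj (c (j3 + r)) * cnj (c (j4 + r)))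
      = (of_nat m * c (j1 + r)) * (of_nat m * c (j2 + r)) * (of_nat m * cnj (c (j3 + r))) * (of_nat m * cnj (c (j4 + r)))"
      by (simp add: power4_eq_xxxx mult_ac)
    also have "\<dots> = sum4 (res m) (\<lambda>k1 k2 k3 k4. (?B k1 * ?e (j1 + r) k1) * (?B k2 * ?e (j2 + r) k2)
        * (cnj (?B k3) * ?e (- (j3 + r)) k3) * (cnj (?B k4) * ?e (- (j4 + r)) k4))"
      unfolding inv cinv sum4_product ..
    also have "\<dots> = sum4 (res m) (\<lambda>k1 k2 k3 k4. ?G k1 k2 k3 k4 *
        ee (of_int (k1 * (j1 + r) + k2 * (j2 + r) - k3 * (j3 + r) - k4 * (j4 + r)) / of_nat m))"
    proof (intro sum.cong refl)
      fix k1 k2 k3 k4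
      have "ee (of_int (k1 * (j1 + r) + k2 * (j2 + r) - k3 * (j3 + r) - k4 * (j4 + r)) / of_nat m)
        = ?e (j1 + r) k1 * ?e (j2 + r) k2 * ?e (- (j3 + r)) k3 * ?e (- (j4 + r)) k4"
        unfolding ee_add[symmetric] add_divide_distrib[symmetric] of_int_add[symmetric]
        by (simp add: algebra_simps)
      then show "(?B k1 * ?e (j1 + r) k1) * (?B k2 * ?e (j2 + r) k2)
        * (cnj (?B k3) * ?e (- (j3 + r)) k3) * (cnj (?B k4) * ?e (- (j4 + r)) k4)
        = ?G k1 k2 k3 k4 * ee (of_int (k1 * (j1 + r) + k2 * (j2 + r) - k3 * (j3 + r) - k4 * (j4 + r)) / of_nat m)"
        by (simp only: mult_ac)
    qed
    finally show ?thesis .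
  qed
  have "of_nat m ^ 4 * quad_sum c r t = (\<Sum>q\<in>quads t. sum4 (res m) (\<lambda>k1 k2 k3 k4. ?G k1 k2 k3 k4 *
        (case q of (j1, j2, j3, j4) \<Rightarrow> ee (of_int (k1 * (j1 + r) + k2 * (j2 + r) - k3 * (j3 + r) - k4 * (j4 + r)) / of_nat m))))"
    unfolding quad_sum_def sum_distrib_left case_prod_unfold prod ..
  also have "\<dots> = sum4 (res m) (\<lambda>k1 k2 k3 k4. \<Sum>q\<in>quads t. ?G k1 k2 k3 k4 *
        (case q of (j1, j2, j3, j4) \<Rightarrow> ee (of_int (k1 * (j1 + r) + k2 * (j2 + r) - k3 * (j3 + r) - k4 * (j4 + r)) / of_nat m)))"
    by (rule sum_swap4)
  also have "\<dots> = ?S" by (simp only: quad_char_def sum_distrib_left)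
  finally have 1: "of_nat m ^ 4 * quad_sum c r t = ?S" .
  have perB: "periodic m ?B" by (rule periodic_dft[OF m])
  have const: "periodic m (\<lambda>_. z)" for z :: complex by (simp add: periodic_def)
  have shift: "?S = sum4 (res m) (\<lambda>k1 k2 k3 k4. ?G (x + k1) (x + k2) (x + k3) (x + k4) * ?D k1 k2 k3 k4)" for x
  proof -
    have "?S = sum4 (res m) (\<lambda>k1 k2 k3 k4. ?G (k1 + x) (k2 + x) (k3 + x) (k4 + x) * ?D (k1 + x) (k2 + x) (k3 + x) (k4 + x))"
      by (rule sum_residues_shift4[symmetric, OF m])
        (intro periodic_mult periodic_quad_char m perB periodic_cnj const)+
    then have "?S = sum4 (res m) (\<lambda>k1 k2 k3 k4. ?G (k1 + x) (k2 + x) (k3 + x) (k4 + x) * ?D k1 k2 k3 k4)"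
      by (simp only: quad_char_shift)
    then show ?thesis by (simp only: add.commute[of _ x])
  qed
  have "of_nat m * ?S = (\<Sum>x\<in>res m. ?S)" by simp
  also have "\<dots> = (\<Sum>x\<in>res m. sum4 (res m) (\<lambda>k1 k2 k3 k4. ?G (x + k1) (x + k2) (x + k3) (x + k4) * ?D k1 k2 k3 k4))"
    by (rule sum.cong[OF refl shift])
  also have "\<dots> = sum4 (res m) (\<lambda>k1 k2 k3 k4. \<Sum>x\<in>res m. ?G (x + k1) (x + k2) (x + k3) (x + k4) * ?D k1 k2 k3 k4)"
    by (rule sum_swap4)
  also have "\<dots> = sum4 (res m) (\<lambda>k1 k2 k3 k4. corr4 m ?B k1 k2 k3 k4 * ?D k1 k2 k3 k4)"
    by (simp only: corr4_def sum_distrib_right)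
  finally have 2: "of_nat m * ?S = sum4 (res m) (\<lambda>k1 k2 k3 k4. corr4 m ?B k1 k2 k3 k4 * ?D k1 k2 k3 k4)" .
  show ?thesis unfolding 2[symmetric] 1[symmetric] using m0 by (simp add: eval_nat_numeral)
qed

text \<open>
  The condition \<open>j1 + j2 = j3 + j4\<close> can be tested modulo \<open>2 t\<close>, since both sides differ by less than \<open>2 t\<close>. Its
  expansion into characters modulo \<open>2 t\<close> separates the four variables, each of which contributes a
  Dirichlet kernel.
\<close>

lemma norm_quad_char_le:
  assumes m: "m > 0" and t: "t > 0"
  shows "norm (quad_char m r t k1 k2 k3 k4) \<le> (\<Sum>y\<in>res (2 * t).
     norm (dker t (of_int y / of_nat (2 * t) + of_int k1 / of_nat m)) * norm (dker t (of_int y / of_nat (2 * t) + of_int k2 / of_nat m)) *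
     norm (dker t (of_int y / of_nat (2 * t) + of_int k3 / of_nat m)) * norm (dker t (of_int y / of_nat (2 * t) + of_int k4 / of_nat m)))
     / of_nat (2 * t)"
proof -
  let ?M = "2 * t"
  let ?a = "\<lambda>y k. real_of_int y / of_nat ?M + of_int k / of_nat m"
  have M: "?M > 0" using t by simp
  let ?c = "ee (of_int (r * (k1 + k2 - k3 - k4)) / of_nat m)"
  have summand: "of_nat ?M * (of_bool (j1 + j2 = j3 + j4) * ee (of_int (k1 * (j1 + r) + k2 * (j2 + r) - k3 * (j3 + r) - k4 * (j4 + r)) / of_nat m))
     = (\<Sum>y\<in>res ?M. ?c * (ee (of_int j1 * ?a y k1) * ee (of_int j2 * ?a y k2) * cnj (ee (of_int j3 * ?a y k3)) * cnj (ee (of_int j4 * ?a y k4))))"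
    if j: "j1 \<in> res t" "j2 \<in> res t" "j3 \<in> res t" "j4 \<in> res t" for j1 j2 j3 j4
  proof -
    let ?d = "j1 + j2 - j3 - j4"
    have "int ?M dvd ?d \<longleftrightarrow> j1 + j2 = j3 + j4"
    proof
      assume dv: "int ?M dvd ?d"
      have "\<bar>?d\<bar> < int ?M" using j by auto
      then have "?d = 0" using dv dvd_imp_le_int[of ?d "int ?M"] by linarith
      then show "j1 + j2 = j3 + j4" by simp
    qed simp
    then have "of_nat ?M * (of_bool (j1 + j2 = j3 + j4) :: complex) = (\<Sum>y\<in>res ?M. ee (of_int (y * ?d) / of_nat ?M))"
      unfolding sum_ee[OF M] by simp
    then have "of_nat ?M * (of_bool (j1 + j2 = j3 + j4) * ee (of_int (k1 * (j1 + r) + k2 * (j2 + r) - k3 * (j3 + r) - k4 * (j4 + r)) / of_nat m))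
      = (\<Sum>y\<in>res ?M. ee (of_int (y * ?d) / of_nat ?M) * ee (of_int (k1 * (j1 + r) + k2 * (j2 + r) - k3 * (j3 + r) - k4 * (j4 + r)) / of_nat m))"
      by (simp only: mult.assoc[symmetric] sum_distrib_right)
    also have "\<dots> = (\<Sum>y\<in>res ?M. ?c * (ee (of_int j1 * ?a y k1) * ee (of_int j2 * ?a y k2) * cnj (ee (of_int j3 * ?a y k3)) * cnj (ee (of_int j4 * ?a y k4))))"
    proof (rule sum.cong[OF refl])
      fix y
      have "of_int (y * ?d) / of_nat ?M + of_int (k1 * (j1 + r) + k2 * (j2 + r) - k3 * (j3 + r) - k4 * (j4 + r)) / of_nat m
        = of_int (r * (k1 + k2 - k3 - k4)) / of_nat m + (of_int j1 * ?a y k1 + of_int j2 * ?a y k2 + - (of_int j3 * ?a y k3) + - (of_int j4 * ?a y k4))"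
        using m t by (simp add: field_simps)
      then show "ee (of_int (y * ?d) / of_nat ?M) * ee (of_int (k1 * (j1 + r) + k2 * (j2 + r) - k3 * (j3 + r) - k4 * (j4 + r)) / of_nat m)
        = ?c * (ee (of_int j1 * ?a y k1) * ee (of_int j2 * ?a y k2) * cnj (ee (of_int j3 * ?a y k3)) * cnj (ee (of_int j4 * ?a y k4)))"
        by (simp only: cnj_ee ee_add[symmetric])
    qed
    finally show ?thesis .
  qed
  have "of_nat ?M * quad_char m r t k1 k2 k3 k4 = sum4 (res t) (\<lambda>j1 j2 j3 j4. of_nat ?M * (of_bool (j1 + j2 = j3 + j4)
      * ee (of_int (k1 * (j1 + r) + k2 * (j2 + r) - k3 * (j3 + r) - k4 * (j4 + r)) / of_nat m)))"
    by (simp only: quad_char_def sum_quads sum_distrib_left prod.case)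
  also have "\<dots> = sum4 (res t) (\<lambda>j1 j2 j3 j4. \<Sum>y\<in>res ?M. ?c * (ee (of_int j1 * ?a y k1) * ee (of_int j2 * ?a y k2) * cnj (ee (of_int j3 * ?a y k3)) * cnj (ee (of_int j4 * ?a y k4))))"
    by (intro sum.cong refl summand)
  also have "\<dots> = (\<Sum>y\<in>res ?M. sum4 (res t) (\<lambda>j1 j2 j3 j4. ?c * (ee (of_int j1 * ?a y k1) * ee (of_int j2 * ?a y k2) * cnj (ee (of_int j3 * ?a y k3)) * cnj (ee (of_int j4 * ?a y k4)))))"
    by (rule sum_swap4[symmetric])
  also have "\<dots> = (\<Sum>y\<in>res ?M. ?c * (dker t (?a y k1) * dker t (?a y k2) * cnj (dker t (?a y k3)) * cnj (dker t (?a y k4))))"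
    by (simp only: times_sum4[symmetric] sum4_product dker_def cnj_sum)
  finally have eq: "of_nat ?M * quad_char m r t k1 k2 k3 k4 = \<dots>" .
  have "of_nat ?M * norm (quad_char m r t k1 k2 k3 k4) = norm (of_nat ?M * quad_char m r t k1 k2 k3 k4)"
    by (simp only: norm_mult norm_of_nat)
  also have "\<dots> \<le> (\<Sum>y\<in>res ?M. norm (dker t (?a y k1)) * norm (dker t (?a y k2)) * norm (dker t (?a y k3)) * norm (dker t (?a y k4)))"
    unfolding eq by (rule order_trans[OF norm_sum]) (simp add: norm_mult)
  finally show ?thesis using M by (simp only: le_divide_eq of_nat_0_less_iff if_True mult.commute)
qed

lemma weighted_quad_char_le:
  fixes b :: "int \<Rightarrow> int \<Rightarrow> int \<Rightarrow> int \<Rightarrow> real"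
  assumes m: "m > 0" and t: "t > 0" and b: "\<And>k1 k2 k3 k4. 0 \<le> b k1 k2 k3 k4"
    and V: "\<And>x. sum4 (res m) (\<lambda>k1 k2 k3 k4. b k1 k2 k3 k4 *
      (norm (dker t (x + of_int k1 / of_nat m)) * norm (dker t (x + of_int k2 / of_nat m)) *
       norm (dker t (x + of_int k3 / of_nat m)) * norm (dker t (x + of_int k4 / of_nat m)))) \<le> V"
  shows "sum4 (res m) (\<lambda>k1 k2 k3 k4. b k1 k2 k3 k4 * norm (quad_char m r t k1 k2 k3 k4)) \<le> V"
proof -
  let ?kp = "\<lambda>y k. norm (dker t (of_int y / of_nat (2 * t) + of_int k / of_nat m))"
  have M: "0 < real (2 * t)" using t by simp
  have "sum4 (res m) (\<lambda>k1 k2 k3 k4. b k1 k2 k3 k4 * norm (quad_char m r t k1 k2 k3 k4))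
    \<le> sum4 (res m) (\<lambda>k1 k2 k3 k4. b k1 k2 k3 k4 * ((\<Sum>y\<in>res (2 * t). ?kp y k1 * ?kp y k2 * ?kp y k3 * ?kp y k4) / of_nat (2 * t)))"
    by (intro sum_mono mult_left_mono norm_quad_char_le m t b)
  also have "\<dots> = sum4 (res m) (\<lambda>k1 k2 k3 k4. \<Sum>y\<in>res (2 * t). b k1 k2 k3 k4 * (?kp y k1 * ?kp y k2 * ?kp y k3 * ?kp y k4) / of_nat (2 * t))"
    by (simp only: sum_divide_distrib sum_distrib_left times_divide_eq_right)
  also have "\<dots> = (\<Sum>y\<in>res (2 * t). sum4 (res m) (\<lambda>k1 k2 k3 k4. b k1 k2 k3 k4 * (?kp y k1 * ?kp y k2 * ?kp y k3 * ?kp y k4) / of_nat (2 * t)))"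
    by (rule sum_swap4[symmetric])
  also have "\<dots> = (\<Sum>y\<in>res (2 * t). sum4 (res m) (\<lambda>k1 k2 k3 k4. b k1 k2 k3 k4 * (?kp y k1 * ?kp y k2 * ?kp y k3 * ?kp y k4)) / of_nat (2 * t))"
    by (simp only: sum_divide_distrib)
  also have "\<dots> \<le> (\<Sum>y\<in>res (2 * t). V / of_nat (2 * t))"
    by (intro sum_mono divide_right_mono V) simp
  also have "\<dots> = V" using t by simp
  finally show ?thesis .
qed

section \<open>Replacing the spectral correlations by their ideal values\<close>

lemma sum4_perm23: "sum4 A (\<lambda>a b c d. F a c b d) = sum4 A F"
  by (intro sum.cong refl sum.swap)

lemma sum4_perm34: "sum4 A (\<lambda>a b c d. F a b d c) = sum4 A F"
  by (intro sum.cong refl sum.swap)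

lemma sum4_perm24: "sum4 A (\<lambda>a b c d. F a d c b) = sum4 A F"
proof -
  have "sum4 A (\<lambda>a b c d. F a d c b) = sum4 A (\<lambda>a c b d. F a d c b)" by (rule sum4_perm23[symmetric])
  also have "\<dots> = sum4 A (\<lambda>a c d b. F a d c b)" by (rule sum4_perm34[symmetric])
  also have "\<dots> = sum4 A (\<lambda>a d c b. F a d c b)" by (rule sum4_perm23[symmetric])
  finally show ?thesis .
qed

lemma sum4_add: "sum4 A (\<lambda>a b c d. F a b c d + G a b c d) = sum4 A F + sum4 A G"
  by (simp only: sum.distrib)

lemma sum4_pairs:
  fixes f g :: "int \<Rightarrow> int \<Rightarrow> 'a::comm_semiring_1"
  shows "sum4 A (\<lambda>a b c d. f a b * g c d) = (\<Sum>a\<in>A. \<Sum>b\<in>A. f a b) * (\<Sum>c\<in>A. \<Sum>d\<in>A. g c d)"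
  by (simp only: sum_distrib_left[symmetric] sum_distrib_right[symmetric])

definition offdiag :: "nat \<Rightarrow> int \<Rightarrow> int \<Rightarrow> int \<Rightarrow> int \<Rightarrow> real" where
  "offdiag e k1 k2 k3 k4 = of_bool ([k1 = k2] (mod int e) \<and> [k3 = k4] (mod int e) \<and> \<not> (k1 = k2 \<and> k3 = k4))"

definition diag :: "int \<Rightarrow> int \<Rightarrow> int \<Rightarrow> int \<Rightarrow> real" where
  "diag k1 k2 k3 k4 = of_bool (k1 = k2 \<and> k3 = k4)"

text \<open>
  The off-diagonal sum gains the factor \<open>1/e\<close> from one pair of frequencies with different members; the other
  pair is summed trivially.
\<close>

lemma kernel_quadruple_sums:
  fixes x :: real and t :: nat
  assumes m: "m > 0"
  defines "kp \<equiv> \<lambda>k. norm (dker t (x + of_int k / of_nat m))"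
    and "A \<equiv> real t + 4 * real m * (1 + ln (real m))"
  shows "sum4 (res m) (\<lambda>k1 k2 k3 k4. kp k1 * kp k2 * kp k3 * kp k4) \<le> A ^ 4"
    and "sum4 (res m) (\<lambda>k1 k2 k3 k4. diag k1 k2 k3 k4 * (kp k1 * kp k2 * kp k3 * kp k4)) \<le> (real t * A) ^ 2"
    and "e dvd m \<Longrightarrow> sum4 (res m) (\<lambda>k1 k2 k3 k4. offdiag e k1 k2 k3 k4 * (kp k1 * kp k2 * kp k3 * kp k4))
           \<le> 16 * (real m / real e) * (1 + ln (real m)) * A ^ 3"
proof -
  have kp0: "0 \<le> kp k" for k by (simp add: kp_def)
  have S: "sum kp (res m) \<le> A" unfolding kp_def A_def by (rule kernel_sum_le[OF m])
  have S0: "0 \<le> sum kp (res m)" by (intro sum_nonneg kp0)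
  have A0: "0 \<le> A" using S S0 by linarith
  have "sum4 (res m) (\<lambda>k1 k2 k3 k4. kp k1 * kp k2 * kp k3 * kp k4) = sum kp (res m) ^ 4"
    by (rule power4_sum[symmetric])
  also have "\<dots> \<le> A ^ 4" by (rule power_mono[OF S S0])
  finally show "sum4 (res m) (\<lambda>k1 k2 k3 k4. kp k1 * kp k2 * kp k3 * kp k4) \<le> A ^ 4" .
  have sq: "(\<Sum>a\<in>res m. \<Sum>b\<in>res m. of_bool (a = b) * (kp a * kp b)) \<le> real t * A"
  proof -
    have "(\<Sum>a\<in>res m. \<Sum>b\<in>res m. of_bool (a = b) * (kp a * kp b)) = (\<Sum>a\<in>res m. kp a ^ 2)"
    proof (rule sum.cong[OF refl])
      fix a assume "a \<in> res m"
      then have "(\<Sum>b\<in>res m. of_bool (a = b) * (kp a * kp b)) = (\<Sum>b\<in>{a}. kp a * kp b)"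
        by (intro sum.mono_neutral_cong_right) auto
      then show "(\<Sum>b\<in>res m. of_bool (a = b) * (kp a * kp b)) = kp a ^ 2" by (simp add: power2_eq_square)
    qed
    also have "\<dots> \<le> real t * A" unfolding kp_def A_def by (rule kernel_square_sum_le[OF m])
    finally show ?thesis .
  qed
  have "sum4 (res m) (\<lambda>k1 k2 k3 k4. diag k1 k2 k3 k4 * (kp k1 * kp k2 * kp k3 * kp k4))
    = sum4 (res m) (\<lambda>k1 k2 k3 k4. (of_bool (k1 = k2) * (kp k1 * kp k2)) * (of_bool (k3 = k4) * (kp k3 * kp k4)))"
    by (intro sum.cong refl) (simp add: diag_def)
  also have "\<dots> = (\<Sum>a\<in>res m. \<Sum>b\<in>res m. of_bool (a = b) * (kp a * kp b)) ^ 2"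
    by (simp only: sum4_pairs power2_eq_square)
  also have "\<dots> \<le> (real t * A) ^ 2"
    by (intro power_mono sq sum_nonneg mult_nonneg_nonneg kp0) simp
  finally show "sum4 (res m) (\<lambda>k1 k2 k3 k4. diag k1 k2 k3 k4 * (kp k1 * kp k2 * kp k3 * kp k4)) \<le> (real t * A) ^ 2" .
  assume e: "e dvd m"
  let ?o = "\<lambda>a b. of_bool ([a = b] (mod int e) \<and> a \<noteq> b) * (kp a * kp b)"
  let ?V = "8 * (real m / real e) * (1 + ln (real m)) * A"
  have off: "(\<Sum>a\<in>res m. \<Sum>b\<in>res m. ?o a b) \<le> ?V"
    unfolding kp_def A_def by (rule kernel_pair_sum_le[OF e m])
  have off0: "0 \<le> (\<Sum>a\<in>res m. \<Sum>b\<in>res m. ?o a b)"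
    by (intro sum_nonneg mult_nonneg_nonneg kp0) simp
  have all: "(\<Sum>a\<in>res m. \<Sum>b\<in>res m. kp a * kp b) = sum kp (res m) ^ 2"
    by (simp only: sum_product power2_eq_square)
  have "sum4 (res m) (\<lambda>k1 k2 k3 k4. offdiag e k1 k2 k3 k4 * (kp k1 * kp k2 * kp k3 * kp k4))
    \<le> sum4 (res m) (\<lambda>k1 k2 k3 k4. ?o k1 k2 * (kp k3 * kp k4) + (kp k1 * kp k2) * ?o k3 k4)"
  proof (intro sum_mono)
    fix k1 k2 k3 k4
    have "0 \<le> kp k1 * kp k2 * kp k3 * kp k4" by (intro mult_nonneg_nonneg kp0)
    then have "offdiag e k1 k2 k3 k4 * (kp k1 * kp k2 * kp k3 * kp k4)
      \<le> (of_bool ([k1 = k2] (mod int e) \<and> k1 \<noteq> k2) + of_bool ([k3 = k4] (mod int e) \<and> k3 \<noteq> k4)) * (kp k1 * kp k2 * kp k3 * kp k4)"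
      by (intro mult_right_mono) (auto simp: offdiag_def)
    then show "offdiag e k1 k2 k3 k4 * (kp k1 * kp k2 * kp k3 * kp k4)
      \<le> ?o k1 k2 * (kp k3 * kp k4) + (kp k1 * kp k2) * ?o k3 k4"
      by (simp add: algebra_simps)
  qed
  also have "\<dots> = 2 * ((\<Sum>a\<in>res m. \<Sum>b\<in>res m. ?o a b) * sum kp (res m) ^ 2)"
    unfolding sum4_add sum4_pairs[of ?o "\<lambda>a b. kp a * kp b"] sum4_pairs[of "\<lambda>a b. kp a * kp b" ?o] all
    by simp
  also have "\<dots> \<le> 2 * (?V * A ^ 2)"
    using off off0 S S0 A0 by (intro mult_left_mono mult_mono power_mono) (auto intro: order_trans)
  finally show "sum4 (res m) (\<lambda>k1 k2 k3 k4. offdiag e k1 k2 k3 k4 * (kp k1 * kp k2 * kp k3 * kp k4))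
     \<le> 16 * (real m / real e) * (1 + ln (real m)) * A ^ 3"
    by (simp add: power2_eq_square power3_eq_cube mult_ac)
qed

abbreviation all_pairings :: "(int \<Rightarrow> int \<Rightarrow> int \<Rightarrow> int \<Rightarrow> real) \<Rightarrow> int \<Rightarrow> int \<Rightarrow> int \<Rightarrow> int \<Rightarrow> real" where
  "all_pairings F k1 k2 k3 k4 \<equiv> F k1 k2 k3 k4 + F k1 k3 k2 k4 + F k1 k4 k3 k2"

lemma sum4_all_pairings:
  assumes "sum4 A (\<lambda>a b c d. F a b c d * (f a * f b * f c * f d)) \<le> V"
  shows "sum4 A (\<lambda>a b c d. all_pairings F a b c d * (f a * f b * f c * f d)) \<le> 3 * V"
proof -
  let ?G = "\<lambda>a b c d. F a b c d * (f a * f b * f c * f d)"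
  have "sum4 A (\<lambda>a b c d. all_pairings F a b c d * (f a * f b * f c * f d))
    = sum4 A (\<lambda>a b c d. ?G a b c d + ?G a c b d + ?G a d c b)"
    by (intro sum.cong refl) (simp add: algebra_simps)
  also have "\<dots> = sum4 A ?G + sum4 A (\<lambda>a b c d. ?G a c b d) + sum4 A (\<lambda>a b c d. ?G a d c b)"
    by (simp only: sum4_add)
  also have "\<dots> = sum4 A ?G + sum4 A ?G + sum4 A ?G"
    by (simp only: sum4_perm23[of "?G"] sum4_perm24[of "?G"])
  finally show ?thesis using assms by simp
qed

lemma spectral_error_le:
  fixes w v :: "int \<Rightarrow> int \<Rightarrow> int \<Rightarrow> int \<Rightarrow> complex" and e :: "'i \<Rightarrow> nat" and r :: int and t :: nat
  assumes m: "m > 0" and t: "t > 0" and nn: "0 \<le> \<eta>" "0 \<le> C" "0 \<le> \<nu>" and e: "\<And>i. i \<in> I \<Longrightarrow> e i dvd m"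
    and w: "\<And>k1 k2 k3 k4. k1 \<in> res m \<Longrightarrow> k2 \<in> res m \<Longrightarrow> k3 \<in> res m \<Longrightarrow> k4 \<in> res m \<Longrightarrow>
      norm (w k1 k2 k3 k4 - v k1 k2 k3 k4)
        \<le> \<eta> * all_pairings diag k1 k2 k3 k4 + C * (\<nu> + (\<Sum>i\<in>I. all_pairings (offdiag (e i)) k1 k2 k3 k4))"
  defines "A \<equiv> real t + 4 * real m * (1 + ln (real m))"
  shows "norm (sum4 (res m) (\<lambda>k1 k2 k3 k4. w k1 k2 k3 k4 * quad_char m r t k1 k2 k3 k4)
             - sum4 (res m) (\<lambda>k1 k2 k3 k4. v k1 k2 k3 k4 * quad_char m r t k1 k2 k3 k4))
    \<le> \<eta> * (3 * (real t * A) ^ 2) + C * (\<nu> * A ^ 4 + (\<Sum>i\<in>I. 48 * (real m / real (e i)) * (1 + ln (real m)) * A ^ 3))"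
proof -
  let ?D = "quad_char m r t"
  let ?b = "\<lambda>k1 k2 k3 k4. \<eta> * all_pairings diag k1 k2 k3 k4 + C * (\<nu> + (\<Sum>i\<in>I. all_pairings (offdiag (e i)) k1 k2 k3 k4))"
  let ?V = "\<eta> * (3 * (real t * A) ^ 2) + C * (\<nu> * A ^ 4 + (\<Sum>i\<in>I. 48 * (real m / real (e i)) * (1 + ln (real m)) * A ^ 3))"
  have d0: "0 \<le> diag a b c d" "0 \<le> offdiag f a b c d" for a b c d f by (simp_all add: diag_def offdiag_def)
  have b0: "0 \<le> ?b k1 k2 k3 k4" for k1 k2 k3 k4
    by (intro add_nonneg_nonneg mult_nonneg_nonneg sum_nonneg nn d0)
  have eq: "sum4 (res m) (\<lambda>k1 k2 k3 k4. w k1 k2 k3 k4 * ?D k1 k2 k3 k4) - sum4 (res m) (\<lambda>k1 k2 k3 k4. v k1 k2 k3 k4 * ?D k1 k2 k3 k4)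
     = sum4 (res m) (\<lambda>k1 k2 k3 k4. (w k1 k2 k3 k4 - v k1 k2 k3 k4) * ?D k1 k2 k3 k4)"
    by (simp only: sum_subtractf left_diff_distrib)
  have "norm (sum4 (res m) (\<lambda>k1 k2 k3 k4. (w k1 k2 k3 k4 - v k1 k2 k3 k4) * ?D k1 k2 k3 k4))
      \<le> sum4 (res m) (\<lambda>k1 k2 k3 k4. ?b k1 k2 k3 k4 * norm (?D k1 k2 k3 k4))"
    by (intro sum_norm_le) (simp only: norm_mult, intro mult_right_mono w norm_ge_zero)
  also have "\<dots> \<le> ?V"
  proof (rule weighted_quad_char_le[where b = ?b, OF m t b0])
    fix x
    let ?kp = "\<lambda>k. norm (dker t (x + of_int k / of_nat m))"
    let ?K = "\<lambda>k1 k2 k3 k4. ?kp k1 * ?kp k2 * ?kp k3 * ?kp k4"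
    have "sum4 (res m) (\<lambda>k1 k2 k3 k4. ?b k1 k2 k3 k4 * ?K k1 k2 k3 k4)
      = sum4 (res m) (\<lambda>k1 k2 k3 k4. \<eta> * (all_pairings diag k1 k2 k3 k4 * ?K k1 k2 k3 k4) + C * (\<nu> * ?K k1 k2 k3 k4
         + (\<Sum>i\<in>I. all_pairings (offdiag (e i)) k1 k2 k3 k4 * ?K k1 k2 k3 k4)))"
      by (intro sum.cong refl) (simp only: distrib_right mult.assoc sum_distrib_right)
    also have "\<dots> = \<eta> * sum4 (res m) (\<lambda>k1 k2 k3 k4. all_pairings diag k1 k2 k3 k4 * ?K k1 k2 k3 k4)
      + C * (\<nu> * sum4 (res m) ?K + sum4 (res m) (\<lambda>k1 k2 k3 k4. \<Sum>i\<in>I. all_pairings (offdiag (e i)) k1 k2 k3 k4 * ?K k1 k2 k3 k4))"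
      by (simp only: sum4_add times_sum4[symmetric])
    also have "sum4 (res m) (\<lambda>k1 k2 k3 k4. \<Sum>i\<in>I. all_pairings (offdiag (e i)) k1 k2 k3 k4 * ?K k1 k2 k3 k4)
      = (\<Sum>i\<in>I. sum4 (res m) (\<lambda>k1 k2 k3 k4. all_pairings (offdiag (e i)) k1 k2 k3 k4 * ?K k1 k2 k3 k4))"
      by (rule sum_swap4[symmetric])
    also have "\<eta> * sum4 (res m) (\<lambda>k1 k2 k3 k4. all_pairings diag k1 k2 k3 k4 * ?K k1 k2 k3 k4)
      + C * (\<nu> * sum4 (res m) ?K + (\<Sum>i\<in>I. sum4 (res m) (\<lambda>k1 k2 k3 k4. all_pairings (offdiag (e i)) k1 k2 k3 k4 * ?K k1 k2 k3 k4)))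
      \<le> \<eta> * (3 * (real t * A) ^ 2) + C * (\<nu> * A ^ 4 + (\<Sum>i\<in>I. 3 * (16 * (real m / real (e i)) * (1 + ln (real m)) * A ^ 3)))"
      unfolding A_def
      by (intro add_mono mult_left_mono sum_mono sum4_all_pairings kernel_quadruple_sums m e nn)
    also have "\<dots> = ?V" by (simp add: mult.assoc)
    finally show "sum4 (res m) (\<lambda>k1 k2 k3 k4. ?b k1 k2 k3 k4 * ?K k1 k2 k3 k4) \<le> ?V" .
  qed
  finally show ?thesis unfolding eq .
qed

section \<open>The main term\<close>

text \<open>
  The value of \<open>corr4 / m^3\<close> that the spectrum would give if every local factor were exactly its leading
  term. The last summand makes the value 1 when all four frequencies are equal.
\<close>

definition ideal :: "nat \<Rightarrow> int \<Rightarrow> int \<Rightarrow> int \<Rightarrow> int \<Rightarrow> int \<Rightarrow> complex" where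
  "ideal m h k1 k2 k3 k4 =
     of_bool (k1 = k2 \<and> k3 = k4) * ee (of_int (h * (k1 - k3)) / of_nat m)
     + of_bool (k1 = k3 \<and> k2 = k4) + of_bool (k1 = k4 \<and> k2 = k3)
     - 2 * of_bool (k1 = k2 \<and> k2 = k3 \<and> k3 = k4)"

lemma sum4_diagonal:
  fixes F :: "int \<Rightarrow> int \<Rightarrow> int \<Rightarrow> int \<Rightarrow> 'a::semiring_1"
  assumes "finite A"
  shows "sum4 A (\<lambda>a b c d. of_bool (a = b \<and> c = d) * F a b c d) = (\<Sum>a\<in>A. \<Sum>c\<in>A. F a a c c)"
    and "sum4 A (\<lambda>a b c d. of_bool (a = c \<and> b = d) * F a b c d) = (\<Sum>a\<in>A. \<Sum>c\<in>A. F a c a c)"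
    and "sum4 A (\<lambda>a b c d. of_bool (a = d \<and> b = c) * F a b c d) = (\<Sum>a\<in>A. \<Sum>c\<in>A. F a c c a)"
    and "sum4 A (\<lambda>a b c d. of_bool (a = b \<and> b = c \<and> c = d) * F a b c d) = (\<Sum>a\<in>A. F a a a a)"
proof -
  have one: "(\<Sum>b\<in>A. of_bool (a = b) * f b) = f a" if "a \<in> A" for a and f :: "int \<Rightarrow> 'a"
  proof -
    have "(\<Sum>b\<in>A. of_bool (a = b) * f b) = (\<Sum>b\<in>{a}. f b)"
      using that assms by (intro sum.mono_neutral_cong_right) auto
    then show ?thesis by simp
  qed
  have diag: "sum4 A (\<lambda>a b c d. of_bool (a = b \<and> c = d) * G a b c d) = (\<Sum>a\<in>A. \<Sum>c\<in>A. G a a c c)" for G :: "int \<Rightarrow> int \<Rightarrow> int \<Rightarrow> int \<Rightarrow> 'a"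
  proof (rule sum.cong[OF refl])
    fix a assume a: "a \<in> A"
    have "(\<Sum>b\<in>A. \<Sum>c\<in>A. \<Sum>d\<in>A. of_bool (a = b \<and> c = d) * G a b c d)
      = (\<Sum>b\<in>A. of_bool (a = b) * (\<Sum>c\<in>A. \<Sum>d\<in>A. of_bool (c = d) * G a b c d))"
      by (simp only: sum_distrib_left of_bool_conj mult.assoc)
    also have "\<dots> = (\<Sum>c\<in>A. \<Sum>d\<in>A. of_bool (c = d) * G a a c d)" by (rule one[OF a])
    also have "\<dots> = (\<Sum>c\<in>A. G a a c c)" by (intro sum.cong refl one)
    finally show "(\<Sum>b\<in>A. \<Sum>c\<in>A. \<Sum>d\<in>A. of_bool (a = b \<and> c = d) * G a b c d) = (\<Sum>c\<in>A. G a a c c)" .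
  qed
  show "sum4 A (\<lambda>a b c d. of_bool (a = b \<and> c = d) * F a b c d) = (\<Sum>a\<in>A. \<Sum>c\<in>A. F a a c c)" by (rule diag)
  have "sum4 A (\<lambda>a b c d. of_bool (a = c \<and> b = d) * F a b c d) = sum4 A (\<lambda>a b c d. of_bool (a = b \<and> c = d) * F a c b d)"
    by (rule sum4_perm23)
  then show "sum4 A (\<lambda>a b c d. of_bool (a = c \<and> b = d) * F a b c d) = (\<Sum>a\<in>A. \<Sum>c\<in>A. F a c a c)"
    by (simp only: diag)
  have "sum4 A (\<lambda>a b c d. of_bool (a = d \<and> b = c) * F a b c d) = sum4 A (\<lambda>a b c d. of_bool (a = b \<and> d = c) * F a d c b)"
    by (rule sum4_perm24)
  also have "\<dots> = sum4 A (\<lambda>a b c d. of_bool (a = b \<and> c = d) * F a d c b)"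
    by (intro sum.cong refl) auto
  finally show "sum4 A (\<lambda>a b c d. of_bool (a = d \<and> b = c) * F a b c d) = (\<Sum>a\<in>A. \<Sum>c\<in>A. F a c c a)"
    by (simp only: diag)
  have "sum4 A (\<lambda>a b c d. of_bool (a = b \<and> b = c \<and> c = d) * F a b c d)
    = sum4 A (\<lambda>a b c d. of_bool (a = b \<and> c = d) * (of_bool (a = c) * F a b c d))"
    by (intro sum.cong refl) auto
  also have "\<dots> = (\<Sum>a\<in>A. \<Sum>c\<in>A. of_bool (a = c) * F a a c c)" by (rule diag)
  also have "\<dots> = (\<Sum>a\<in>A. F a a a a)" by (intro sum.cong refl one)
  finally show "sum4 A (\<lambda>a b c d. of_bool (a = b \<and> b = c \<and> c = d) * F a b c d) = (\<Sum>a\<in>A. F a a a a)" .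
qed

lemma sum_swap2: "(\<Sum>a\<in>A. \<Sum>c\<in>B. \<Sum>q\<in>C. f a c q) = (\<Sum>q\<in>C. \<Sum>a\<in>A. \<Sum>c\<in>B. f a c q)"
  by (rule trans[OF sum.cong[OF refl sum.swap] sum.swap])

lemma sum_two_chars:
  assumes m: "m > 0"
  shows "(\<Sum>a\<in>res m. \<Sum>b\<in>res m. ee (of_int (a * N) / of_nat m) * ee (of_int (b * (- N)) / of_nat m))
     = of_nat m ^ 2 * of_bool (int m dvd N)"
proof -
  have "(\<Sum>a\<in>res m. \<Sum>b\<in>res m. ee (of_int (a * N) / of_nat m) * ee (of_int (b * (- N)) / of_nat m))
    = (\<Sum>a\<in>res m. ee (of_int (a * N) / of_nat m)) * (\<Sum>b\<in>res m. ee (of_int (b * (- N)) / of_nat m))"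
    by (simp only: sum_product)
  also have "\<dots> = of_nat m ^ 2 * of_bool (int m dvd N)"
    unfolding sum_ee[OF m] by (simp add: power2_eq_square)
  finally show ?thesis .
qed

lemma sum_quads_two_chars:
  assumes m: "m > 0"
    and G: "\<And>a b. G a b = (\<Sum>q\<in>quads t. ee (of_int (f a b q) / of_nat m))"
    and f: "\<And>a b q. q \<in> quads t \<Longrightarrow> f a b q = a * N q + b * (- N q)"
  shows "(\<Sum>a\<in>res m. \<Sum>b\<in>res m. G a b) = of_nat m ^ 2 * (\<Sum>q\<in>quads t. of_bool (int m dvd N q))"
proof -
  have G': "G a b = (\<Sum>q\<in>quads t. ee (of_int (a * N q) / of_nat m) * ee (of_int (b * (- N q)) / of_nat m))" for a b
    unfolding G by (intro sum.cong refl) (simp only: f ee_add[symmetric] add_divide_distrib[symmetric] of_int_add)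
  have "(\<Sum>a\<in>res m. \<Sum>b\<in>res m. G a b) = (\<Sum>q\<in>quads t. \<Sum>a\<in>res m. \<Sum>b\<in>res m.
      ee (of_int (a * N q) / of_nat m) * ee (of_int (b * (- N q)) / of_nat m))"
    unfolding G' by (rule sum_swap2)
  then show ?thesis by (simp only: sum_two_chars[OF m] sum_distrib_left)
qed

lemma main_term:
  assumes m: "m > 0"
  shows "sum4 (res m) (\<lambda>k1 k2 k3 k4. ideal m h k1 k2 k3 k4 * quad_char m r t k1 k2 k3 k4)
    = of_nat m ^ 2 * ((\<Sum>(j1, j2, j3, j4)\<in>quads t. of_bool (int m dvd j1 + j2 + 2 * r + h))
        + (\<Sum>(j1, j2, j3, j4)\<in>quads t. of_bool (int m dvd j1 - j3))
        + (\<Sum>(j1, j2, j3, j4)\<in>quads t. of_bool (int m dvd j1 - j4)))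
      - 2 * (of_nat m * of_nat (card (quads t)))"
proof -
  let ?D = "quad_char m r t"
  let ?f = "\<lambda>k1 k2 k3 k4 (j1, j2, j3, j4). k1 * (j1 + r) + k2 * (j2 + r) - k3 * (j3 + r) - k4 * (j4 + r)"
  have D: "?D k1 k2 k3 k4 = (\<Sum>q\<in>quads t. ee (of_int (?f k1 k2 k3 k4 q) / of_nat m))" for k1 k2 k3 k4
    unfolding quad_char_def by (intro sum.cong refl) (simp split: prod.splits)
  have j4: "j4 = j1 + j2 - j3" if "(j1, j2, j3, j4) \<in> quads t" for j1 j2 j3 j4
    using that by (simp add: quads_def)
  have "ideal m h k1 k2 k3 k4 * ?D k1 k2 k3 k4
    = of_bool (k1 = k2 \<and> k3 = k4) * (ee (of_int (h * (k1 - k3)) / of_nat m) * ?D k1 k2 k3 k4)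
      + of_bool (k1 = k3 \<and> k2 = k4) * ?D k1 k2 k3 k4 + of_bool (k1 = k4 \<and> k2 = k3) * ?D k1 k2 k3 k4
      - 2 * (of_bool (k1 = k2 \<and> k2 = k3 \<and> k3 = k4) * ?D k1 k2 k3 k4)" for k1 k2 k3 k4
    by (simp only: ideal_def distrib_right left_diff_distrib mult.assoc)
  then have "sum4 (res m) (\<lambda>k1 k2 k3 k4. ideal m h k1 k2 k3 k4 * ?D k1 k2 k3 k4)
    = (\<Sum>a\<in>res m. \<Sum>c\<in>res m. ee (of_int (h * (a - c)) / of_nat m) * ?D a a c c)
      + (\<Sum>a\<in>res m. \<Sum>c\<in>res m. ?D a c a c) + (\<Sum>a\<in>res m. \<Sum>c\<in>res m. ?D a c c a)
      - 2 * (\<Sum>a\<in>res m. ?D a a a a)"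
    by (simp only: sum_subtractf sum.distrib times_sum4[symmetric] sum4_diagonal[OF finite_atLeastLessThan_int])
  also have "(\<Sum>a\<in>res m. \<Sum>c\<in>res m. ee (of_int (h * (a - c)) / of_nat m) * ?D a a c c)
    = of_nat m ^ 2 * (\<Sum>(j1, j2, j3, j4)\<in>quads t. of_bool (int m dvd j1 + j2 + 2 * r + h))"
    unfolding case_prod_unfold
  proof (rule sum_quads_two_chars[OF m])
    show "ee (of_int (h * (a - c)) / of_nat m) * ?D a a c c
      = (\<Sum>q\<in>quads t. ee (of_int (h * (a - c) + ?f a a c c q) / of_nat m))" for a c
      unfolding D sum_distrib_left by (simp only: ee_add[symmetric] add_divide_distrib of_int_add)
    show "h * (a - c) + ?f a a c c q = a * (fst q + fst (snd q) + 2 * r + h) + c * - (fst q + fst (snd q) + 2 * r + h)"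
      if "q \<in> quads t" for a c q
      using that by (cases q) (auto dest!: j4 simp: algebra_simps)
  qed
  also have "(\<Sum>a\<in>res m. \<Sum>c\<in>res m. ?D a c a c) = of_nat m ^ 2 * (\<Sum>(j1, j2, j3, j4)\<in>quads t. of_bool (int m dvd j1 - j3))"
    unfolding case_prod_unfold
    by (rule sum_quads_two_chars[OF m D]) (auto dest!: j4 simp: algebra_simps)
  also have "(\<Sum>a\<in>res m. \<Sum>c\<in>res m. ?D a c c a) = of_nat m ^ 2 * (\<Sum>(j1, j2, j3, j4)\<in>quads t. of_bool (int m dvd j1 - j4))"
    unfolding case_prod_unfold
    by (rule sum_quads_two_chars[OF m D]) (auto dest!: j4 simp: algebra_simps)
  also have "(\<Sum>a\<in>res m. ?D a a a a) = of_nat m * of_nat (card (quads t))"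
  proof -
    have "?f a a a a q = 0" if "q \<in> quads t" for a q
      using that by (cases q) (auto dest!: j4 simp: algebra_simps)
    then have "?D a a a a = of_nat (card (quads t))" for a unfolding D by simp
    then show ?thesis by simp
  qed
  finally show ?thesis by (simp only: distrib_left)
qed

section \<open>Error bound for the quadruple sum\<close>

text \<open>
  The sequence \<open>c\<close> is the Jacobi sequence times a sequence of period \<open>s\<close> with Fourier coefficients \<open>\<beta>\<close> of constant
  modulus. If \<open>k1\<close> is paired with \<open>k3\<close> or \<open>k4\<close>, only this modulus matters; if it is paired with \<open>k2\<close>, the
  squares of \<open>\<beta>\<close> appear, whose phase must be linear, and its slope \<open>h\<close> acts as a shift of the window by \<open>h/2\<close>.
\<close>

locale modulated_spectrum = jacobi_spectrum +
  fixes s :: nat and \<beta> :: "int \<Rightarrow> complex" and h :: int and c :: "int \<Rightarrow> complex"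
  assumes s_pos: "s > 0" and coprime_s: "coprime s n" and per_\<beta>: "periodic s \<beta>"
    and norm_\<beta>: "\<And>k. norm (\<beta> k) ^ 2 = real s"
    and phase_\<beta>: "\<And>k l. \<beta> k ^ 2 * cnj (\<beta> l) ^ 2 = of_nat s ^ 2 * ee (of_int (h * (k - l)) / of_nat (s * n))"
    and per_c: "periodic (s * n) c" and dft_c: "\<And>k. dft (s * n) c k = \<beta> k * jspec k"
begin

abbreviation m :: nat where "m \<equiv> s * n"

lemma m_pos: "m > 0" using s_pos n_pos by simp

lemma corr4_dft: "corr4 m (dft m c) k1 k2 k3 k4 = corr4 s \<beta> k1 k2 k3 k4 * (of_nat n ^ 3 * (\<Prod>p\<in>Q. W p k1 k2 k3 k4))"
proof -
  have "corr4 m (dft m c) k1 k2 k3 k4 = corr4 m (\<lambda>k. \<beta> k * jspec k) k1 k2 k3 k4"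
    by (simp only: corr4_def dft_c)
  then show ?thesis
    unfolding corr4_mult[OF s_pos n_pos coprime_s per_\<beta> periodic_jspec] jspec_corr4 .
qed

lemma \<beta>_cnj: "\<beta> k * cnj (\<beta> k) = of_nat s"
  using norm_\<beta>[of k] by (simp add: complex_norm_square[symmetric])

lemma corr4_\<beta>:
  shows "k1 = k2 \<and> k3 = k4 \<Longrightarrow> corr4 s \<beta> k1 k2 k3 k4 = of_nat s ^ 3 * ee (of_int (h * (k1 - k3)) / of_nat m)"
    and "(k1 = k3 \<and> k2 = k4) \<or> (k1 = k4 \<and> k2 = k3) \<Longrightarrow> corr4 s \<beta> k1 k2 k3 k4 = of_nat s ^ 3"
    and "norm (corr4 s \<beta> k1 k2 k3 k4) \<le> real s ^ 3"
proof -
  show "corr4 s \<beta> k1 k2 k3 k4 = of_nat s ^ 3 * ee (of_int (h * (k1 - k3)) / of_nat m)" if "k1 = k2 \<and> k3 = k4"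
  proof -
    have "corr4 s \<beta> k1 k2 k3 k4 = (\<Sum>x\<in>res s. \<beta> (x + k1) ^ 2 * cnj (\<beta> (x + k3)) ^ 2)"
      unfolding corr4_def using that by (intro sum.cong refl) (simp add: power2_eq_square)
    also have "\<dots> = of_nat s ^ 3 * ee (of_int (h * (k1 - k3)) / of_nat m)"
      unfolding phase_\<beta> by (simp add: power3_eq_cube power2_eq_square)
    finally show ?thesis .
  qed
  show "corr4 s \<beta> k1 k2 k3 k4 = of_nat s ^ 3" if "(k1 = k3 \<and> k2 = k4) \<or> (k1 = k4 \<and> k2 = k3)"
  proof -
    have "corr4 s \<beta> k1 k2 k3 k4 = (\<Sum>x\<in>res s. (\<beta> (x + k1) * cnj (\<beta> (x + k1))) * (\<beta> (x + k2) * cnj (\<beta> (x + k2))))"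
      unfolding corr4_def using that by (intro sum.cong refl) (auto simp: mult_ac)
    then show ?thesis by (simp add: \<beta>_cnj power3_eq_cube)
  qed
  have n\<beta>: "norm (\<beta> k) = sqrt (real s)" for k using norm_\<beta>[of k] by (metis norm_ge_zero real_sqrt_abs abs_of_nonneg)
  have "norm (corr4 s \<beta> k1 k2 k3 k4) \<le> of_nat (card (res s)) * real s ^ 2"
    unfolding corr4_def by (rule sum_norm_bound) (simp add: norm_mult n\<beta> power2_eq_square)
  then show "norm (corr4 s \<beta> k1 k2 k3 k4) \<le> real s ^ 3" by (simp add: power3_eq_cube power2_eq_square)
qed

definition large_divisors :: "nat set set" where
  "large_divisors = {E\<in>Pow Q. real n powr (1/4) \<le> real (\<Prod>E)}"

text \<open>
  On the paired quadruples the phase of \<open>corr4 s \<beta>\<close> is exactly the one in \<open>ideal\<close>, so that only the product of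
  the local factors has to be compared with 1. On the others \<open>ideal\<close> vanishes, and a pairing modulo \<open>\<Prod>E\<close> is never
  one by equalities.
\<close>

lemma weight_close:
  assumes K: "K > 0" "\<And>p. p \<in> Q \<Longrightarrow> K \<le> real p"
  shows "norm (corr4 m (dft m c) k1 k2 k3 k4 / of_nat m ^ 3 - ideal m h k1 k2 k3 k4)
    \<le> (exp (17 * real (card Q) / sqrt K) - 1) * all_pairings diag k1 k2 k3 k4
      + 19 ^ card Q * (real n powr (-1/16) + (\<Sum>E\<in>large_divisors. all_pairings (offdiag (\<Prod>E)) k1 k2 k3 k4))"
proof -
  let ?W = "\<Prod>p\<in>Q. W p k1 k2 k3 k4" and ?\<eta> = "exp (17 * real (card Q) / sqrt K) - 1"
  let ?O = "19 ^ card Q * (real n powr (-1/16) + (\<Sum>E\<in>large_divisors. all_pairings (offdiag (\<Prod>E)) k1 k2 k3 k4))"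
  let ?w = "corr4 m (dft m c) k1 k2 k3 k4 / of_nat m ^ 3"
  have nz: "of_nat n \<noteq> (0::complex)" "of_nat s \<noteq> (0::complex)" using n_pos s_pos by (simp_all del: of_nat_prod)
  have w: "?w = corr4 s \<beta> k1 k2 k3 k4 / of_nat s ^ 3 * ?W"
    unfolding corr4_dft using nz by (simp add: power_mult_distrib del: of_nat_prod)
  have d0: "0 \<le> diag a b c d" "0 \<le> offdiag f a b c d" for a b c d f by (simp_all add: diag_def offdiag_def)
  have O0: "0 \<le> ?O" by (intro mult_nonneg_nonneg add_nonneg_nonneg sum_nonneg d0) simp_all
  have \<eta>0: "0 \<le> ?\<eta>" using K by simp
  have close: ?thesis if u: "norm u = 1" "?w = u * ?W" "ideal m h k1 k2 k3 k4 = u"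
    and p: "paired n k1 k2 k3 k4" and d: "1 \<le> all_pairings diag k1 k2 k3 k4" for u
  proof -
    have "?w - ideal m h k1 k2 k3 k4 = u * (?W - 1)" unfolding u(2,3) by (simp add: right_diff_distrib)
    then have "norm (?w - ideal m h k1 k2 k3 k4) = norm (?W - 1)" by (simp add: norm_mult u)
    also have "\<dots> \<le> ?\<eta>" by (rule W_paired[OF p K])
    also have "\<dots> \<le> ?\<eta> * all_pairings diag k1 k2 k3 k4" using d \<eta>0 by (metis mult_left_mono mult.right_neutral)
    finally show ?thesis using O0 by linarith
  qed
  consider (A) "k1 = k2 \<and> k3 = k4" | (B) "\<not> (k1 = k2 \<and> k3 = k4)" "(k1 = k3 \<and> k2 = k4) \<or> (k1 = k4 \<and> k2 = k3)"
    | (C) "\<not> (k1 = k2 \<and> k3 = k4)" "\<not> (k1 = k3 \<and> k2 = k4)" "\<not> (k1 = k4 \<and> k2 = k3)" by blast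
  then show ?thesis
  proof cases
    case A
    let ?u = "ee (of_int (h * (k1 - k3)) / of_nat m)"
    show ?thesis
    proof (rule close[of ?u])
      show "?w = ?u * ?W" unfolding w corr4_\<beta>(1)[OF A] using nz by simp
      show "ideal m h k1 k2 k3 k4 = ?u"
      proof (cases "k1 = k3")
        case True
        with A show ?thesis by (simp add: ideal_def)
      next
        case False
        with A have "\<not> (k1 = k3 \<and> k2 = k4)" "\<not> (k1 = k4 \<and> k2 = k3)" "\<not> (k1 = k2 \<and> k2 = k3 \<and> k3 = k4)" by blast+
        then show ?thesis unfolding ideal_def using A by (simp only: of_bool_eq) simp
      qed
      show "paired n k1 k2 k3 k4" using A by (simp add: paired_def)
      have "diag k1 k2 k3 k4 = 1" using A by (simp add: diag_def)
      then show "1 \<le> all_pairings diag k1 k2 k3 k4" using d0(1)[of k1 k3 k2 k4] d0(1)[of k1 k4 k3 k2] by linarith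
    qed simp
  next
    case B
    show ?thesis
    proof (rule close[of 1])
      show "?w = 1 * ?W" unfolding w corr4_\<beta>(2)[OF B(2)] using nz by simp
      have ne: "k1 \<noteq> k2" using B by blast
      from B(2) show "ideal m h k1 k2 k3 k4 = 1"
      proof
        assume "k1 = k3 \<and> k2 = k4"
        then have "k3 = k1" "k4 = k2" by simp_all
        with ne show ?thesis by (simp only: ideal_def) simp
      next
        assume "k1 = k4 \<and> k2 = k3"
        then have "k4 = k1" "k3 = k2" by simp_all
        with ne show ?thesis by (simp only: ideal_def) simp
      qed
      show "paired n k1 k2 k3 k4" using B(2) unfolding paired_def by (metis cong_refl)
      have "diag k1 k3 k2 k4 = 1 \<or> diag k1 k4 k3 k2 = 1" using B(2) unfolding diag_def by (metis of_bool_eq(2))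
      then show "1 \<le> all_pairings diag k1 k2 k3 k4"
        using d0(1)[of k1 k2 k3 k4] d0(1)[of k1 k3 k2 k4] d0(1)[of k1 k4 k3 k2] by linarith
    qed simp
  next
    case C
    have "\<not> (k1 = k2 \<and> k2 = k3 \<and> k3 = k4)" using C(1) by blast
    then have id: "ideal m h k1 k2 k3 k4 = 0" unfolding ideal_def using C by (simp only: of_bool_eq(1)) simp
    have "norm (corr4 s \<beta> k1 k2 k3 k4 / of_nat s ^ 3) \<le> 1"
      using corr4_\<beta>(3)[of k1 k2 k3 k4] s_pos by (simp add: norm_divide norm_power divide_le_eq)
    then have "norm ?w \<le> 1 * norm ?W" unfolding w norm_mult by (intro mult_right_mono) auto
    also have "\<dots> \<le> 19 ^ card Q * (real n powr (-1/16) + (\<Sum>E\<in>large_divisors. pairing_count (\<Prod>E) k1 k2 k3 k4))"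
      using W_le unfolding large_divisors_def by simp
    also have "\<dots> \<le> ?O"
      using C by (intro mult_left_mono add_left_mono sum_mono) (auto simp: pairing_count_def offdiag_def cong_sym_eq)
    finally have "norm ?w \<le> ?O" .
    moreover have "0 \<le> ?\<eta> * all_pairings diag k1 k2 k3 k4"
      by (intro mult_nonneg_nonneg add_nonneg_nonneg \<eta>0 d0)
    ultimately show ?thesis unfolding id by simp
  qed
qed

definition main_count :: "int \<Rightarrow> nat \<Rightarrow> real" where
  "main_count r t = (\<Sum>(j1, j2, j3, j4)\<in>quads t. of_bool (int m dvd j1 + j2 + 2 * r + h))
        + (\<Sum>(j1, j2, j3, j4)\<in>quads t. of_bool (int m dvd j1 - j3))
        + (\<Sum>(j1, j2, j3, j4)\<in>quads t. of_bool (int m dvd j1 - j4))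
        - 2 / real m * real (card (quads t))"

text \<open>
  The first summand of the bound comes from the paired frequencies, the second one from all others. In the
  second one \<open>38 = 19 * 2\<close>: the local factors are at most \<open>19 p^3\<close>, and there are at most \<open>2 ^ card Q\<close> divisors \<open>\<Prod>E\<close>.
\<close>

lemma quad_sum_approx:
  assumes K: "K > 0" "\<And>p. p \<in> Q \<Longrightarrow> K \<le> real p" and t: "t > 0" and \<tau>: "real t \<le> \<tau> * real m"
  defines "L \<equiv> 1 + ln (real m)" and "c0 \<equiv> \<tau> + 4"
  shows "norm (quad_sum c r t - of_real (main_count r t)) \<le> real m ^ 2 *
    (3 * (\<tau> * c0) ^ 2 * ((exp (17 * real (card Q) / sqrt K) - 1) * L ^ 2)
     + (c0 ^ 4 + 48 * c0 ^ 3) * (38 ^ card Q * L ^ 4 * real n powr (-1/16)))"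
proof -
  let ?\<eta> = "exp (17 * real (card Q) / sqrt K) - 1" and ?\<nu> = "real n powr (-1/16)"
  let ?D = "quad_char m r t"
  let ?w = "\<lambda>k1 k2 k3 k4. corr4 m (dft m c) k1 k2 k3 k4 / of_nat m ^ 3"
  define A where "A = real t + 4 * real m * (1 + ln (real m))"
  define M where "M = real m"
  have n1: "1 \<le> real n" using n_pos by linarith
  have M1: "1 \<le> M" using m_pos unfolding M_def by linarith
  have L1: "1 \<le> L" using M1 by (simp add: L_def M_def del: of_nat_prod of_nat_mult)
  have \<tau>0: "0 \<le> \<tau>"
  proof (rule ccontr)
    assume "\<not> ?thesis"
    then have "\<tau> * real m < 0" using M1 unfolding M_def by (intro mult_neg_pos) linarith+
    with \<tau> show False by linarith
  qed
  have c0: "0 \<le> c0" "4 \<le> c0" using \<tau>0 by (simp_all add: c0_def)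
  have mz: "of_nat m \<noteq> (0::complex)" using m_pos by (simp del: of_nat_prod of_nat_mult)
  have nn: "0 \<le> ?\<eta>" "0 \<le> (19::real) ^ card Q" "0 \<le> ?\<nu>" using K by simp_all
  have fin: "finite large_divisors" using finQ by (simp add: large_divisors_def)
  have dv: "\<Prod>E dvd m" if "E \<in> large_divisors" for E
  proof -
    have "\<Prod>E dvd n" using that finQ by (intro prod_dvd_prod_subset) (auto simp: large_divisors_def)
    then show ?thesis by (rule dvd_mult)
  qed
  have A0: "0 \<le> A" using L1 by (simp add: A_def L_def del: of_nat_prod of_nat_mult)
  have tM: "real t \<le> \<tau> * M" using \<tau> by (simp add: M_def)
  have A_le: "A \<le> c0 * M * L"
  proof -
    have "\<tau> * M * 1 \<le> \<tau> * M * L" using \<tau>0 M1 L1 by (intro mult_left_mono) auto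
    moreover have "A = real t + 4 * M * L" by (simp only: A_def M_def L_def)
    ultimately show ?thesis using tM unfolding c0_def by (simp add: algebra_simps)
  qed
  have "quad_sum c r t = sum4 (res m) (\<lambda>k1 k2 k3 k4. corr4 m (dft m c) k1 k2 k3 k4 * ?D k1 k2 k3 k4) / of_nat m ^ 5"
    by (rule quad_sum_spectral[OF m_pos per_c])
  also have "\<dots> = sum4 (res m) (\<lambda>k1 k2 k3 k4. ?w k1 k2 k3 k4 * ?D k1 k2 k3 k4) / of_nat m ^ 2"
  proof -
    have "sum4 (res m) (\<lambda>k1 k2 k3 k4. corr4 m (dft m c) k1 k2 k3 k4 * ?D k1 k2 k3 k4)
      = of_nat m ^ 3 * sum4 (res m) (\<lambda>k1 k2 k3 k4. ?w k1 k2 k3 k4 * ?D k1 k2 k3 k4)"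
      unfolding times_sum4 using mz by (intro sum.cong refl) (simp del: of_nat_prod of_nat_mult)
    moreover have "X / z ^ 5 = Y / z ^ 2" if "X = z ^ 3 * Y" "z \<noteq> 0" for X Y z :: complex
      using that by (simp add: eval_nat_numeral)
    ultimately show ?thesis using mz by blast
  qed
  finally have 1: "quad_sum c r t = sum4 (res m) (\<lambda>k1 k2 k3 k4. ?w k1 k2 k3 k4 * ?D k1 k2 k3 k4) / of_nat m ^ 2" .
  have 2: "of_real (main_count r t) = sum4 (res m) (\<lambda>k1 k2 k3 k4. ideal m h k1 k2 k3 k4 * ?D k1 k2 k3 k4) / of_nat m ^ 2"
  proof -
    have cb: "complex_of_real (\<Sum>q\<in>quads t. case q of (j1, j2, j3, j4) \<Rightarrow> of_bool (P j1 j2 j3 j4))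
      = (\<Sum>q\<in>quads t. case q of (j1, j2, j3, j4) \<Rightarrow> of_bool (P j1 j2 j3 j4))" for P
      unfolding of_real_sum by (intro sum.cong refl) (auto split: prod.splits)
    show ?thesis
      unfolding main_term[OF m_pos] main_count_def of_real_add of_real_diff cb
      using mz by (simp add: diff_divide_distrib add_divide_distrib power2_eq_square del: of_nat_prod of_nat_mult)
  qed
  have E: "real (card large_divisors) \<le> 2 ^ card Q"
  proof -
    have "card large_divisors \<le> card (Pow Q)" using finQ by (intro card_mono) (auto simp: large_divisors_def)
    also have "\<dots> = 2 ^ card Q" by (rule card_Pow[OF finQ])
    finally show ?thesis by (metis of_nat_le_iff of_nat_numeral of_nat_power)
  qed
  have "norm (quad_sum c r t - of_real (main_count r t)) * M ^ 2
    = norm (sum4 (res m) (\<lambda>k1 k2 k3 k4. ?w k1 k2 k3 k4 * ?D k1 k2 k3 k4) - sum4 (res m) (\<lambda>k1 k2 k3 k4. ideal m h k1 k2 k3 k4 * ?D k1 k2 k3 k4))"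
    unfolding 1 2 diff_divide_distrib[symmetric] norm_divide norm_power norm_of_nat M_def[symmetric] using M1 by simp
  also have "\<dots> \<le> ?\<eta> * (3 * (real t * A) ^ 2) + 19 ^ card Q * (?\<nu> * A ^ 4 + (\<Sum>E\<in>large_divisors. 48 * (real m / real (\<Prod>E)) * (1 + ln (real m)) * A ^ 3))"
    unfolding A_def by (rule spectral_error_le[OF m_pos t nn dv weight_close[OF K]])
  also have "\<dots> \<le> ?\<eta> * (3 * ((\<tau> * M) * (c0 * M * L)) ^ 2) + 19 ^ card Q * (?\<nu> * (c0 * M * L) ^ 4 + (\<Sum>E\<in>large_divisors. 48 * (M * ?\<nu>) * L * (c0 * M * L) ^ 3))"
  proof -
    have q: "real m / real (\<Prod>E) \<le> M * ?\<nu>" if "E \<in> large_divisors" for E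
    proof -
      have "real n powr (1/4) \<le> real (\<Prod>E)" using that by (simp add: large_divisors_def)
      moreover have "0 < real n powr (1/4)" using n1 by (simp del: of_nat_prod)
      ultimately have "real m / real (\<Prod>E) \<le> M / real n powr (1/4)"
        unfolding M_def by (intro divide_left_mono mult_pos_pos of_nat_0_le_iff) linarith+
      also have "\<dots> = M * real n powr (-1/4)" by (simp add: powr_minus_divide del: of_nat_prod)
      also have "\<dots> \<le> M * ?\<nu>" using n1 M1 by (intro mult_left_mono powr_mono) auto
      finally show ?thesis .
    qed
    have "(1 + ln (real m)) = L" by (simp add: L_def)
    then show ?thesis
      using nn A0 A_le tM \<tau>0 c0 M1 L1
      by (intro add_mono mult_left_mono mult_mono power_mono sum_mono q mult_nonneg_nonneg)
         (auto simp del: of_nat_prod of_nat_mult)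
  qed
  also have "\<dots> = M ^ 2 * (M ^ 2 * (3 * (\<tau> * c0) ^ 2 * (?\<eta> * L ^ 2) + 19 ^ card Q * ((c0 ^ 4 + real (card large_divisors) * (48 * c0 ^ 3)) * (L ^ 4 * ?\<nu>))))"
    by (simp add: eval_nat_numeral algebra_simps del: of_nat_prod of_nat_mult)
  finally have "norm (quad_sum c r t - of_real (main_count r t))
     \<le> M ^ 2 * (3 * (\<tau> * c0) ^ 2 * (?\<eta> * L ^ 2) + 19 ^ card Q * ((c0 ^ 4 + real (card large_divisors) * (48 * c0 ^ 3)) * (L ^ 4 * ?\<nu>)))"
    using M1 by (simp only: mult.commute[of _ "M ^ 2"] mult_le_cancel_left_pos zero_less_power)
  also have "\<dots> \<le> M ^ 2 * (3 * (\<tau> * c0) ^ 2 * (?\<eta> * L ^ 2) + 19 ^ card Q * ((2 ^ card Q * (c0 ^ 4 + 48 * c0 ^ 3)) * (L ^ 4 * ?\<nu>)))"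
  proof -
    have "c0 ^ 4 * 1 \<le> c0 ^ 4 * 2 ^ card Q" using c0 by (intro mult_left_mono) auto
    moreover have "real (card large_divisors) * (48 * c0 ^ 3) \<le> 2 ^ card Q * (48 * c0 ^ 3)"
      using c0 E by (intro mult_right_mono) auto
    ultimately have "c0 ^ 4 + real (card large_divisors) * (48 * c0 ^ 3) \<le> 2 ^ card Q * (c0 ^ 4 + 48 * c0 ^ 3)"
      by (simp add: algebra_simps)
    then show ?thesis using L1 nn by (intro mult_left_mono add_left_mono mult_right_mono) auto
  qed
  also have "\<dots> = M ^ 2 * (3 * (\<tau> * c0) ^ 2 * (?\<eta> * L ^ 2) + (c0 ^ 4 + 48 * c0 ^ 3) * (38 ^ card Q * L ^ 4 * ?\<nu>))"
  proof -
    have "(38::real) ^ card Q = 19 ^ card Q * 2 ^ card Q" by (simp add: power_mult_distrib[symmetric])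
    then show ?thesis by (simp add: mult_ac)
  qed
  finally show ?thesis by (simp only: M_def)
qed

end

section \<open>Counting additive quadruples\<close>

abbreviation shifts :: "nat \<Rightarrow> int set" where
  "shifts t \<equiv> {- int t<..<int t}"

lemma sum4_by_difference:
  fixes f :: "int \<Rightarrow> real"
  shows "sum4 (res t) (\<lambda>a b c d. of_bool (a - b = c - d) * (of_bool (P (a - b)) * (f a * f b * (f c * f d))))
    = (\<Sum>u\<in>shifts t. of_bool (P u) * (\<Sum>a\<in>res t. \<Sum>b\<in>res t. of_bool (a - b = u) * (f a * f b)) ^ 2)"
proof -
  have "sum4 (res t) (\<lambda>a b c d. of_bool (a - b = c - d) * (of_bool (P (a - b)) * (f a * f b * (f c * f d))))
    = sum4 (res t) (\<lambda>a b c d. \<Sum>u\<in>shifts t. of_bool (P u) * ((of_bool (a - b = u) * (f a * f b)) * (of_bool (c - d = u) * (f c * f d))))"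
  proof (intro sum.cong refl)
    fix a b c d assume "a \<in> res t" "b \<in> res t" "c \<in> res t" "d \<in> res t"
    then have mem: "a - b \<in> shifts t" by auto
    have "(\<Sum>u\<in>shifts t. of_bool (P u) * ((of_bool (a - b = u) * (f a * f b)) * (of_bool (c - d = u) * (f c * f d))))
      = (\<Sum>u\<in>{a - b}. of_bool (P u) * ((of_bool (a - b = u) * (f a * f b)) * (of_bool (c - d = u) * (f c * f d))))"
      using mem by (intro sum.mono_neutral_right) auto
    then show "of_bool (a - b = c - d) * (of_bool (P (a - b)) * (f a * f b * (f c * f d)))
      = (\<Sum>u\<in>shifts t. of_bool (P u) * ((of_bool (a - b = u) * (f a * f b)) * (of_bool (c - d = u) * (f c * f d))))"
      by (simp only: sum.insert[OF finite.emptyI] sum.empty) (simp add: eq_commute[of "c - d"] mult_ac)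
  qed
  also have "\<dots> = (\<Sum>u\<in>shifts t. sum4 (res t) (\<lambda>a b c d. of_bool (P u) * ((of_bool (a - b = u) * (f a * f b)) * (of_bool (c - d = u) * (f c * f d)))))"
    by (rule sum_swap4[symmetric])
  also have "\<dots> = (\<Sum>u\<in>shifts t. of_bool (P u) * (\<Sum>a\<in>res t. \<Sum>b\<in>res t. of_bool (a - b = u) * (f a * f b)) ^ 2)"
    unfolding times_sum4[symmetric] sum4_pairs power2_eq_square ..
  finally show ?thesis .
qed

lemma sum4_perm234: "sum4 A (\<lambda>a b c d. G a c d b) = sum4 A G"
proof -
  have "sum4 A (\<lambda>a b c d. G a c d b) = sum4 A (\<lambda>a b c d. G a b d c)" by (rule sum4_perm23)
  also have "\<dots> = sum4 A G" by (rule sum4_perm34)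
  finally show ?thesis .
qed

text \<open>
  An additive quadruple is a pair of pairs \<open>(j1, j3)\<close> and \<open>(j4, j2)\<close> with the same difference \<open>u\<close>.
\<close>

lemma quads_by_difference:
  fixes f :: "int \<Rightarrow> real"
  shows "(\<Sum>(j1, j2, j3, j4)\<in>quads t. of_bool (P (j1 - j3)) * (f j1 * f j2 * f j3 * f j4))
    = (\<Sum>u\<in>shifts t. of_bool (P u) * (\<Sum>a\<in>res t. \<Sum>b\<in>res t. of_bool (a - b = u) * (f a * f b)) ^ 2)"
proof -
  have "(\<Sum>(j1, j2, j3, j4)\<in>quads t. of_bool (P (j1 - j3)) * (f j1 * f j2 * f j3 * f j4))
    = sum4 (res t) (\<lambda>j1 j2 j3 j4. of_bool (j1 - j3 = j4 - j2) * (of_bool (P (j1 - j3)) * (f j1 * f j3 * (f j4 * f j2))))"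
    unfolding sum_quads prod.case by (intro sum.cong refl) (auto simp: mult_ac)
  also have "\<dots> = sum4 (res t) (\<lambda>a b c d. of_bool (a - b = c - d) * (of_bool (P (a - b)) * (f a * f b * (f c * f d))))"
    by (rule sum4_perm234)
  finally show ?thesis unfolding sum4_by_difference .
qed

lemma difference_count:
  assumes u: "u \<in> shifts t"
  shows "(\<Sum>a\<in>res t. \<Sum>b\<in>res t. of_bool (a - b = u) * (1 * 1)) = real t - real_of_int \<bar>u\<bar>"
proof -
  have "(\<Sum>a\<in>res t. \<Sum>b\<in>res t. of_bool (a - b = u) * (1 * 1)) = (\<Sum>a\<in>{max 0 u..<min (int t) (int t + u)}. 1 :: real)"
  proof (rule sum.mono_neutral_cong_right)
    show "\<forall>a\<in>res t - {max 0 u..<min (int t) (int t + u)}. (\<Sum>b\<in>res t. of_bool (a - b = u) * (1 * 1)) = (0 :: real)"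
      by (auto intro!: sum.neutral)
    fix a assume a: "a \<in> {max 0 u..<min (int t) (int t + u)}"
    have "(\<Sum>b\<in>res t. of_bool (a - b = u) * (1 * 1)) = (\<Sum>b\<in>{a - u}. 1 :: real)"
      using a by (intro sum.mono_neutral_cong_right) auto
    then show "(\<Sum>b\<in>res t. of_bool (a - b = u) * (1 * 1)) = (1 :: real)" by simp
  qed auto
  also have "\<dots> = real t - real_of_int \<bar>u\<bar>" using u by (auto simp: of_nat_diff min_def max_def)
  finally show ?thesis .
qed

lemma count_by_difference:
  "(\<Sum>(j1, j2, j3, j4)\<in>quads t. of_bool (P (j1 - j3))) = (\<Sum>u\<in>shifts t. of_bool (P u) * (real t - real_of_int \<bar>u\<bar>) ^ 2)"
proof -
  have "(\<Sum>(j1, j2, j3, j4)\<in>quads t. of_bool (P (j1 - j3))) = (\<Sum>(j1, j2, j3, j4)\<in>quads t. of_bool (P (j1 - j3)) * (1 * 1 * 1 * (1::real)))"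
    by simp
  also have "\<dots> = (\<Sum>u\<in>shifts t. of_bool (P u) * (\<Sum>a\<in>res t. \<Sum>b\<in>res t. of_bool (a - b = u) * (1 * 1)) ^ 2)"
    by (rule quads_by_difference[where f = "\<lambda>_. 1"])
  also have "\<dots> = (\<Sum>u\<in>shifts t. of_bool (P u) * (real t - real_of_int \<bar>u\<bar>) ^ 2)"
    by (intro sum.cong refl) (simp only: difference_count)
  finally show ?thesis .
qed

lemma count_by_difference':
  "(\<Sum>(j1, j2, j3, j4)\<in>quads t. of_bool (P (j1 - j4))) = (\<Sum>u\<in>shifts t. of_bool (P u) * (real t - real_of_int \<bar>u\<bar>) ^ 2)"
proof -
  have "(\<Sum>(j1, j2, j3, j4)\<in>quads t. of_bool (P (j1 - j4)))
    = sum4 (res t) (\<lambda>a b c d. of_bool (a + b = d + c) * (of_bool (P (a - d)) :: real))"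
    unfolding sum_quads prod.case by (intro sum.cong refl) (simp add: add.commute)
  also have "\<dots> = sum4 (res t) (\<lambda>a b c d. of_bool (a + b = c + d) * of_bool (P (a - c)))"
    by (rule sum4_perm34)
  also have "\<dots> = (\<Sum>(j1, j2, j3, j4)\<in>quads t. of_bool (P (j1 - j3)))"
    unfolding sum_quads prod.case ..
  finally show ?thesis unfolding count_by_difference .
qed

lemma sum_res_reflect: "(\<Sum>b\<in>res t. f (int t - 1 - b)) = (\<Sum>b\<in>res t. f b)"
  by (rule sum.reindex_bij_witness[of _ "\<lambda>b. int t - 1 - b" "\<lambda>b. int t - 1 - b"]) auto

lemma sum4_reflect:
  "sum4 (res t) (\<lambda>a b c d. F a (int t - 1 - b) c (int t - 1 - d)) = sum4 (res t) F"
proof -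
  have "sum4 (res t) (\<lambda>a b c d. F a (int t - 1 - b) c (int t - 1 - d)) = sum4 (res t) (\<lambda>a b c d. F a (int t - 1 - b) c d)"
    by (intro sum.cong refl sum_res_reflect)
  also have "\<dots> = sum4 (res t) F"
    by (rule sum.cong[OF refl]) (rule sum_res_reflect)
  finally show ?thesis .
qed

text \<open>
  Reflecting \<open>j2\<close> and \<open>j4\<close> in the window turns the condition on sums into one on differences, which are
  shifted by \<open>t - 1\<close>.
\<close>

lemma count_by_sum:
  "(\<Sum>(j1, j2, j3, j4)\<in>quads t. of_bool (P (j1 + j2)))
     = (\<Sum>u\<in>shifts t. of_bool (P (u + int t - 1)) * (real t - real_of_int \<bar>u\<bar>) ^ 2)"
proof -
  let ?P = "\<lambda>u. P (u + int t - 1)"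
  have "(\<Sum>(j1, j2, j3, j4)\<in>quads t. of_bool (P (j1 + j2)))
    = sum4 (res t) (\<lambda>a b c d. of_bool (a + b = c + d) * (of_bool (P (a + b)) :: real))"
    unfolding sum_quads prod.case ..
  also have "\<dots> = sum4 (res t) (\<lambda>a b c d. of_bool (a + (int t - 1 - b) = c + (int t - 1 - d)) * of_bool (P (a + (int t - 1 - b))))"
    by (rule sum4_reflect[symmetric])
  also have "\<dots> = sum4 (res t) (\<lambda>a b c d. of_bool (a - b = c - d) * (of_bool (?P (a - b)) * (1 * 1 * (1 * 1))))"
    by (intro sum.cong refl) (auto simp: algebra_simps)
  also have "\<dots> = (\<Sum>u\<in>shifts t. of_bool (?P u) * (\<Sum>a\<in>res t. \<Sum>b\<in>res t. of_bool (a - b = u) * (1 * 1)) ^ 2)"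
    by (rule sum4_by_difference[where f = "\<lambda>_. 1"])
  also have "\<dots> = (\<Sum>u\<in>shifts t. of_bool (?P u) * (real t - real_of_int \<bar>u\<bar>) ^ 2)"
    by (intro sum.cong refl) (simp only: difference_count)
  finally show ?thesis .
qed

lemma sum_shifts:
  fixes f :: "int \<Rightarrow> 'a::comm_monoid_add"
  shows "(\<Sum>u\<in>shifts (Suc t). f u) = f 0 + ((\<Sum>u=1..t. f (int u)) + (\<Sum>u=1..t. f (- int u)))"
proof -
  have "shifts (Suc t) = insert 0 (int ` {1..t} \<union> (\<lambda>u. - int u) ` {1..t})"
  proof (intro equalityI subsetI)
    fix u assume u: "u \<in> shifts (Suc t)"
    consider "u = 0" | "u > 0" | "u < 0" by linarith
    then show "u \<in> insert 0 (int ` {1..t} \<union> (\<lambda>u. - int u) ` {1..t})"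
    proof cases
      case 2
      then have "u = int (nat u)" "nat u \<in> {1..t}" using u by auto
      then show ?thesis by blast
    next
      case 3
      then have "u = - int (nat (- u))" "nat (- u) \<in> {1..t}" using u by auto
      then show ?thesis by blast
    qed simp
  qed auto
  moreover have "int ` {1..t} \<inter> (\<lambda>u. - int u) ` {1..t} = {}" by auto
  moreover have "0 \<notin> int ` {1..t} \<union> (\<lambda>u. - int u) ` {1..t}" by auto
  ultimately have "(\<Sum>u\<in>shifts (Suc t). f u) = f 0 + ((\<Sum>u\<in>int ` {1..t}. f u) + (\<Sum>u\<in>(\<lambda>u. - int u) ` {1..t}. f u))"
    by (simp only:) (simp add: sum.union_disjoint)
  then show ?thesis by (simp add: sum.reindex inj_on_def)
qed

lemma card_quads: "real (card (quads t)) = (2 * real t ^ 3 + real t) / 3"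
proof (cases t)
  case 0
  then have "quads t = {}" by (auto simp: quads_def)
  with 0 show ?thesis by simp
next
  case (Suc s)
  have "real (card (quads t)) = (\<Sum>(j1, j2, j3, j4)\<in>quads t. of_bool ((\<lambda>_. True) (j1 - j3)))"
    by (simp add: case_prod_unfold)
  also have "\<dots> = (\<Sum>u\<in>shifts (Suc s). (real t - real_of_int \<bar>u\<bar>) ^ 2)"
    unfolding count_by_difference[of "\<lambda>_. True"] Suc by (simp only: of_bool_eq mult_1)
  also have "\<dots> = real t ^ 2 + 2 * (\<Sum>u=1..s. (real t - real u) ^ 2)"
    unfolding sum_shifts by simp
  also have "(\<Sum>u=1..s. (real t - real u) ^ 2) = (\<Sum>u=1..s. real u ^ 2)"
    by (rule sum.reindex_bij_witness[of _ "\<lambda>u. Suc s - u" "\<lambda>u. Suc s - u"]) (auto simp: Suc of_nat_diff)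
  also have "(\<Sum>u=1..s. real u ^ 2) = real s * (real s + 1) * (2 * real s + 1) / 6"
    by (induction s) (simp_all add: field_simps power2_eq_square)
  also have "real t ^ 2 + 2 * (real s * (real s + 1) * (2 * real s + 1) / 6) = (2 * real t ^ 3 + real t) / 3"
    by (simp add: Suc power2_eq_square power3_eq_cube field_simps)
  finally show ?thesis .
qed

section \<open>Limit of the main term\<close>

text \<open>
  Both families of sums in \<open>limit_merit\<close> are values of this function: \<open>\<xi> = 0\<close> gives 1 plus twice the sum over
  positive integers, and \<open>\<xi> = T + 2 R\<close> the sum over all integers.
\<close>

definition tent_sum :: "real \<Rightarrow> real \<Rightarrow> real" where
  "tent_sum \<xi> T = (\<Sum>\<^sub>\<infinity>i\<in>(UNIV::int set). (max 0 (1 - \<bar>(of_int i - \<xi>) / T\<bar>)) ^ 2)"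

lemma infsum_finite_support:
  fixes f :: "'a \<Rightarrow> real"
  assumes "finite I" "I \<subseteq> A" "\<And>i. i \<in> A \<Longrightarrow> i \<notin> I \<Longrightarrow> f i = 0"
  shows "infsum f A = (\<Sum>i\<in>I. f i)"
proof -
  have "infsum f A = infsum f I" using assms by (intro infsum_cong_neutral) auto
  then show ?thesis using assms(1) by simp
qed

lemma tent_sum_eq:
  assumes T: "T > 0" and N: "T + \<bar>\<xi>\<bar> \<le> real_of_int N"
  shows "tent_sum \<xi> T = (\<Sum>i=-N..N. (max 0 (1 - \<bar>(of_int i - \<xi>) / T\<bar>)) ^ 2)"
  unfolding tent_sum_def
proof (rule infsum_finite_support)
  fix i assume "i \<notin> {-N..N}"
  then have "N < \<bar>i\<bar>" by auto
  then have "real_of_int N < real_of_int \<bar>i\<bar>" by (simp only: of_int_less_iff)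
  then have "T \<le> \<bar>of_int i - \<xi>\<bar>" using N by simp
  then have "1 \<le> \<bar>(of_int i - \<xi>) / T\<bar>" using T by (simp add: abs_divide)
  then show "(max 0 (1 - \<bar>(of_int i - \<xi>) / T\<bar>)) ^ 2 = 0" by simp
qed auto

lemma progression_sum:
  assumes m: "m > 0" and N: "\<And>i. \<bar>i * int m - q\<bar> < int t \<Longrightarrow> i \<in> {-N..N}"
  shows "(\<Sum>u\<in>shifts t. of_bool (int m dvd u + q) * (real t - real_of_int \<bar>u\<bar>) ^ 2)
    = (\<Sum>i=-N..N. (max 0 (real t - \<bar>of_int i * real m - of_int q\<bar>)) ^ 2)"
proof -
  let ?I = "{i. \<bar>i * int m - q\<bar> < int t}"
  have sub: "?I \<subseteq> {-N..N}" using N by auto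
  have "(\<Sum>u\<in>shifts t. of_bool (int m dvd u + q) * (real t - real_of_int \<bar>u\<bar>) ^ 2)
    = (\<Sum>u\<in>{u\<in>shifts t. int m dvd u + q}. (real t - real_of_int \<bar>u\<bar>) ^ 2)"
    by (rule sum.mono_neutral_cong_right) auto
  also have "\<dots> = (\<Sum>i\<in>?I. (real t - real_of_int \<bar>i * int m - q\<bar>) ^ 2)"
    using m by (intro sum.reindex_bij_witness[of _ "\<lambda>i. i * int m - q" "\<lambda>u. (u + q) div int m"]) auto
  also have "\<dots> = (\<Sum>i\<in>?I. (real t - \<bar>of_int i * real m - of_int q\<bar>) ^ 2)" by simp
  also have "\<dots> = (\<Sum>i=-N..N. (max 0 (real t - \<bar>of_int i * real m - of_int q\<bar>)) ^ 2)"
  proof (rule sum.mono_neutral_cong_left)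
    have key: "\<bar>of_int i * real m - of_int q\<bar> = real_of_int \<bar>i * int m - q\<bar>" for i by simp
    show "\<forall>i\<in>{-N..N} - ?I. (max 0 (real t - \<bar>of_int i * real m - of_int q\<bar>)) ^ 2 = 0"
    proof
      fix i assume "i \<in> {-N..N} - ?I"
      then have "int t \<le> \<bar>i * int m - q\<bar>" by auto
      then have "real t \<le> real_of_int \<bar>i * int m - q\<bar>" by linarith
      then show "(max 0 (real t - \<bar>of_int i * real m - of_int q\<bar>)) ^ 2 = 0" unfolding key by simp
    qed
    fix i assume "i \<in> ?I"
    then have "\<bar>i * int m - q\<bar> < int t" by simp
    then have "real_of_int \<bar>i * int m - q\<bar> \<le> real t" by linarith
    then show "(real t - \<bar>of_int i * real m - of_int q\<bar>) ^ 2 = (max 0 (real t - \<bar>of_int i * real m - of_int q\<bar>)) ^ 2"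
      unfolding key by simp
  qed (use sub in auto)
  finally show ?thesis .
qed

text \<open>
  With \<open>u = i m - q\<close> the terms become values of the tent function at \<open>(i - q/m) / (t/m)\<close>. They vanish for all
  \<open>i\<close> outside a fixed finite range, so the limit can be taken term by term.
\<close>

lemma progression_limit:
  fixes m t :: "nat \<Rightarrow> nat" and q :: "nat \<Rightarrow> int"
  assumes T: "T > 0" and mt: "((\<lambda>n. real (t n) / real (m n)) \<longlongrightarrow> T) F"
    and q: "((\<lambda>n. of_int (q n) / real (m n)) \<longlongrightarrow> \<xi>) F" and m: "eventually (\<lambda>n. m n > 0) F"
  shows "((\<lambda>n. (\<Sum>u\<in>shifts (t n). of_bool (int (m n) dvd u + q n) * (real (t n) - real_of_int \<bar>u\<bar>) ^ 2) / real (t n) ^ 2)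
    \<longlongrightarrow> tent_sum \<xi> T) F"
proof -
  define N where "N = \<lceil>T + \<bar>\<xi>\<bar> + 2\<rceil>"
  have N: "T + \<bar>\<xi>\<bar> + 2 \<le> real_of_int N" unfolding N_def by linarith
  have "((\<lambda>n. \<Sum>i=-N..N. (max 0 (1 - \<bar>(of_int i - of_int (q n) / real (m n)) / (real (t n) / real (m n))\<bar>)) ^ 2)
    \<longlongrightarrow> (\<Sum>i=-N..N. (max 0 (1 - \<bar>(of_int i - \<xi>) / T\<bar>)) ^ 2)) F"
    using T by (intro tendsto_intros mt q) auto
  moreover have "(\<Sum>i=-N..N. (max 0 (1 - \<bar>(of_int i - \<xi>) / T\<bar>)) ^ 2) = tent_sum \<xi> T"
    using N T by (intro tent_sum_eq[symmetric]) auto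
  moreover have "\<forall>\<^sub>F n in F. (\<Sum>i=-N..N. (max 0 (1 - \<bar>(of_int i - of_int (q n) / real (m n)) / (real (t n) / real (m n))\<bar>)) ^ 2)
    = (\<Sum>u\<in>shifts (t n). of_bool (int (m n) dvd u + q n) * (real (t n) - real_of_int \<bar>u\<bar>) ^ 2) / real (t n) ^ 2"
  proof -
    have "\<forall>\<^sub>F n in F. real (t n) / real (m n) < T + 1" "\<forall>\<^sub>F n in F. 0 < real (t n) / real (m n)"
      using order_tendstoD[OF mt] T by simp_all
    moreover have "\<forall>\<^sub>F n in F. \<bar>of_int (q n) / real (m n)\<bar> < \<bar>\<xi>\<bar> + 1"
      using order_tendstoD(2)[OF tendsto_rabs[OF q], of "\<bar>\<xi>\<bar> + 1"] by simp
    ultimately show ?thesis using m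
    proof eventually_elim
      case (elim n)
      let ?m = "real (m n)" and ?t = "real (t n)" and ?q = "real_of_int (q n)"
      have m0: "0 < ?m" using elim by simp
      have t0: "0 < ?t" using elim m0 by (simp add: zero_less_divide_iff)
      have "(\<Sum>u\<in>shifts (t n). of_bool (int (m n) dvd u + q n) * (?t - real_of_int \<bar>u\<bar>) ^ 2)
        = (\<Sum>i=-N..N. (max 0 (?t - \<bar>of_int i * ?m - ?q\<bar>)) ^ 2)"
      proof (rule progression_sum)
        fix i assume "\<bar>i * int (m n) - q n\<bar> < int (t n)"
        then have "real_of_int \<bar>i * int (m n) - q n\<bar> < ?t" by linarith
        then have "\<bar>of_int i * ?m - ?q\<bar> / ?m < ?t / ?m" using m0 by (simp add: divide_strict_right_mono)
        moreover have "\<bar>of_int i * ?m - ?q\<bar> / ?m = \<bar>of_int i - ?q / ?m\<bar>"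
        proof -
          have "of_int i - ?q / ?m = (of_int i * ?m - ?q) / ?m" using m0 by (simp add: field_simps)
          then show ?thesis using m0 by (simp add: abs_divide)
        qed
        ultimately have "\<bar>real_of_int i\<bar> < real_of_int N" using elim N by linarith
        then show "i \<in> {-N..N}" by auto
      qed (use elim in simp)
      also have "\<dots> / ?t ^ 2 = (\<Sum>i=-N..N. (max 0 (1 - \<bar>(of_int i - ?q / ?m) / (?t / ?m)\<bar>)) ^ 2)"
        unfolding sum_divide_distrib
      proof (intro sum.cong refl)
        fix i
        have "(of_int i - ?q / ?m) / (?t / ?m) = (of_int i * ?m - ?q) / ?t"
          using m0 t0 by (simp add: field_simps)
        then have "\<bar>(of_int i - ?q / ?m) / (?t / ?m)\<bar> = \<bar>of_int i * ?m - ?q\<bar> / ?t"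
          using t0 by (simp only: abs_divide abs_of_pos)
        then have "1 - \<bar>(of_int i - ?q / ?m) / (?t / ?m)\<bar> = (?t - \<bar>of_int i * ?m - ?q\<bar>) / ?t"
          using t0 by (simp only: diff_divide_distrib) simp
        then have "max 0 (1 - \<bar>(of_int i - ?q / ?m) / (?t / ?m)\<bar>) = max 0 (?t - \<bar>of_int i * ?m - ?q\<bar>) / ?t"
          using t0 by (simp add: max_def divide_le_0_iff zero_le_divide_iff)
        then show "(max 0 (?t - \<bar>of_int i * ?m - ?q\<bar>)) ^ 2 / ?t ^ 2 = (max 0 (1 - \<bar>(of_int i - ?q / ?m) / (?t / ?m)\<bar>)) ^ 2"
          by (simp add: power_divide)
      qed
      finally show ?case by simp
    qed
  qed
  ultimately show ?thesis by (simp add: tendsto_cong)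
qed

definition limit_denominator :: "real \<Rightarrow> real \<Rightarrow> real" where
  "limit_denominator R T = 1 - 4 * T / 3
          + 4 * (\<Sum>\<^sub>\<infinity>m\<in>{1::nat..}. (max 0 (1 - real m / T)) ^ 2)
          + (\<Sum>\<^sub>\<infinity>m\<in>(UNIV::int set). (max 0 (1 - \<bar>1 + (2 * R - real_of_int m) / T\<bar>)) ^ 2)"

lemma limit_merit_eq: "limit_merit R T = 1 / limit_denominator R T"
  by (simp add: limit_merit_def limit_denominator_def)

lemma tent_sum_0:
  assumes T: "T > 0"
  shows "tent_sum 0 T = 1 + 2 * (\<Sum>\<^sub>\<infinity>m\<in>{1::nat..}. (max 0 (1 - real m / T)) ^ 2)"
proof -
  define N where "N = nat \<lceil>T\<rceil>"
  have N: "T \<le> real N" unfolding N_def by linarith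
  have "tent_sum 0 T = (\<Sum>i=-int N..int N. (max 0 (1 - \<bar>(of_int i - 0) / T\<bar>)) ^ 2)"
    using N T by (intro tent_sum_eq) auto
  also have "{-int N..int N} = shifts (Suc N)" by auto
  also have "(\<Sum>i\<in>shifts (Suc N). (max 0 (1 - \<bar>(of_int i - 0) / T\<bar>)) ^ 2) = 1 + 2 * (\<Sum>u=1..N. (max 0 (1 - real u / T)) ^ 2)"
    unfolding sum_shifts using T by (simp add: abs_divide)
  also have "(\<Sum>u=1..N. (max 0 (1 - real u / T)) ^ 2) = (\<Sum>\<^sub>\<infinity>m\<in>{1::nat..}. (max 0 (1 - real m / T)) ^ 2)"
  proof (rule infsum_finite_support[symmetric])
    fix i assume "i \<in> {1..}" "i \<notin> {1..N}"
    then have "T \<le> real i" using N by auto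
    then show "(max 0 (1 - real i / T)) ^ 2 = 0" using T by simp
  qed auto
  finally show ?thesis .
qed

lemma tent_sum_window:
  assumes "T > 0"
  shows "tent_sum (T + 2 * R) T = (\<Sum>\<^sub>\<infinity>m\<in>(UNIV::int set). (max 0 (1 - \<bar>1 + (2 * R - real_of_int m) / T\<bar>)) ^ 2)"
proof -
  have "\<bar>(real_of_int i - (T + 2 * R)) / T\<bar> = \<bar>1 + (2 * R - real_of_int i) / T\<bar>" for i
  proof -
    have "1 + (2 * R - real_of_int i) / T = - ((real_of_int i - (T + 2 * R)) / T)"
      using assms by (simp add: field_simps)
    then show ?thesis by simp
  qed
  then show ?thesis by (simp add: tent_sum_def)
qed

section \<open>Merit factor and quadruple sums\<close>

definition lag_sum :: "(int \<Rightarrow> real) \<Rightarrow> nat \<Rightarrow> int \<Rightarrow> real" where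
  "lag_sum f t u = (\<Sum>a\<in>res t. \<Sum>b\<in>res t. of_bool (a - b = u) * (f a * f b))"

lemma lag_sum_minus: "lag_sum f t (- u) = lag_sum f t u"
proof -
  have "lag_sum f t (- u) = (\<Sum>a\<in>res t. \<Sum>b\<in>res t. of_bool (b - a = - u) * (f b * f a))"
    unfolding lag_sum_def by (rule sum.swap)
  also have "\<dots> = lag_sum f t u" unfolding lag_sum_def by (intro sum.cong refl) (auto simp: mult.commute)
  finally show ?thesis .
qed

lemma lag_sum_nat:
  assumes "u < t"
  shows "lag_sum f t (int u) = (\<Sum>j<t - u. f (int j) * f (int (j + u)))"
proof -
  have "lag_sum f t (int u) = (\<Sum>b\<in>res t. \<Sum>a\<in>res t. of_bool (a - b = int u) * (f a * f b))"
    unfolding lag_sum_def by (rule sum.swap)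
  also have "\<dots> = (\<Sum>b\<in>{0..<int (t - u)}. f b * f (b + int u))"
  proof (rule sum.mono_neutral_cong_right)
    show "\<forall>b\<in>res t - {0..<int (t - u)}. (\<Sum>a\<in>res t. of_bool (a - b = int u) * (f a * f b)) = 0"
      using assms by (auto intro!: sum.neutral)
    fix b assume b: "b \<in> {0..<int (t - u)}"
    have "(\<Sum>a\<in>res t. of_bool (a - b = int u) * (f a * f b)) = (\<Sum>a\<in>{b + int u}. f a * f b)"
      using b assms by (intro sum.mono_neutral_cong_right) auto
    then show "(\<Sum>a\<in>res t. of_bool (a - b = int u) * (f a * f b)) = f b * f (b + int u)" by simp
  qed auto
  also have "\<dots> = (\<Sum>j<t - u. f (int j) * f (int (j + u)))"
    by (rule sum.reindex_bij_witness[of _ int nat]) auto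
  finally show ?thesis .
qed

definition quad_energy :: "(int \<Rightarrow> int) \<Rightarrow> int \<Rightarrow> nat \<Rightarrow> real" where
  "quad_energy x r t = (\<Sum>(j1, j2, j3, j4)\<in>quads t.
     real_of_int (x (j1 + r)) * real_of_int (x (j2 + r)) * real_of_int (x (j3 + r)) * real_of_int (x (j4 + r)))"

text \<open>
  Grouping the quadruples by the common difference gives the sum of the squared autocorrelations; the shift
  0 contributes \<open>t^2\<close>.
\<close>

lemma quad_energy_lags:
  assumes x: "\<And>j. x j = 1 \<or> x j = -1" and t: "t > 0"
  shows "quad_energy x r t = real t ^ 2 + 2 * (\<Sum>u=1..t - 1. (lag_sum (\<lambda>j. real_of_int (x (j + r))) t (int u)) ^ 2)"
proof -
  let ?f = "\<lambda>j. real_of_int (x (j + r))"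
  obtain s where s: "t = Suc s" using t by (cases t) auto
  have "quad_energy x r t = (\<Sum>(j1, j2, j3, j4)\<in>quads t. of_bool ((\<lambda>_. True) (j1 - j3)) * (?f j1 * ?f j2 * ?f j3 * ?f j4))"
    unfolding quad_energy_def by (intro sum.cong refl) (auto split: prod.splits)
  also have "\<dots> = (\<Sum>u\<in>shifts t. of_bool ((\<lambda>_. True) u) * (lag_sum ?f t u) ^ 2)"
    unfolding lag_sum_def by (rule quads_by_difference)
  also have "\<dots> = (lag_sum ?f t 0) ^ 2 + 2 * (\<Sum>u=1..s. (lag_sum ?f t (int u)) ^ 2)"
    unfolding s sum_shifts by (simp add: lag_sum_minus)
  also have "lag_sum ?f t 0 = real t"
  proof -
    have "?f j * ?f j = 1" for j using x[of "j + r"] by auto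
    then show ?thesis using lag_sum_nat[of 0 t ?f] t by simp
  qed
  finally show ?thesis by (simp add: s)
qed

lemma merit_factor_rotate_resize:
  assumes x: "\<And>j. x j = 1 \<or> x j = -1" and t: "t > 0" and B: "\<And>j. periodic_ext B j = x j"
  shows "merit_factor (rotate_resize B r t) = 1 / (quad_energy x r t / real t ^ 2 - 1)"
proof -
  have len: "length (rotate_resize B r t) = t" by (simp add: rotate_resize_def)
  have "real_of_int (autocorrelation (rotate_resize B r t) u) = lag_sum (\<lambda>j. real_of_int (x (j + r))) t (int u)"
    if "u \<in> {1..t - 1}" for u
  proof -
    have "u < t" using that t by auto
    then show ?thesis
      unfolding autocorrelation_def len lag_sum_nat[OF \<open>u < t\<close>]
      by (simp add: rotate_resize_def B add_ac)
  qed
  then have "2 * (\<Sum>u=1..t - 1. real_of_int (autocorrelation (rotate_resize B r t) u) ^ 2) = quad_energy x r t - real t ^ 2"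
    unfolding quad_energy_lags[OF x t] by simp
  then have "merit_factor (rotate_resize B r t) = real t ^ 2 / (quad_energy x r t - real t ^ 2)"
    by (simp add: merit_factor_def len)
  also have "\<dots> = 1 / (quad_energy x r t / real t ^ 2 - 1)"
  proof -
    have "quad_energy x r t / real t ^ 2 - 1 = (quad_energy x r t - real t ^ 2) / real t ^ 2"
      using t by (simp add: diff_divide_distrib)
    then show ?thesis by simp
  qed
  finally show ?thesis .
qed

text \<open>
  The number \<open>m\<close> is a period of \<open>x\<close> up to the sign \<open>\<epsilon>\<close>, so the autocorrelation at shift \<open>m\<close> is \<open>\<epsilon> (t - m)\<close>.
\<close>

lemma quad_energy_ge:
  assumes x: "\<And>j. x j = 1 \<or> x j = -1" and m: "m > 0" "m < t" and per: "\<And>j. x j * x (j + int m) = \<epsilon>" and \<epsilon>: "\<epsilon> * \<epsilon> = 1"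
  shows "real t ^ 2 + 2 * (real t - real m) ^ 2 \<le> quad_energy x r t"
proof -
  let ?f = "\<lambda>j. real_of_int (x (j + r))"
  have "lag_sum ?f t (int m) = (\<Sum>j<t - m. real_of_int \<epsilon>)"
  proof -
    have "?f (int j) * ?f (int (j + m)) = real_of_int \<epsilon>" for j
      using per[of "int j + r"] by (simp add: of_int_mult[symmetric] add_ac del: of_int_mult)
    then show ?thesis unfolding lag_sum_nat[OF m(2)] by simp
  qed
  then have "(lag_sum ?f t (int m)) ^ 2 = (real t - real m) ^ 2 * real_of_int (\<epsilon> * \<epsilon>)"
    using m by (simp add: power_mult_distrib power2_eq_square of_nat_diff)
  then have "(lag_sum ?f t (int m)) ^ 2 = (real t - real m) ^ 2" by (simp add: \<epsilon>)
  moreover have "(lag_sum ?f t (int m)) ^ 2 \<le> (\<Sum>u=1..t - 1. (lag_sum ?f t (int u)) ^ 2)"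
    using m by (intro member_le_sum[of m]) auto
  moreover have "t > 0" using m by simp
  ultimately show ?thesis unfolding quad_energy_lags[OF x \<open>t > 0\<close>] by simp
qed

lemma quad_sum_modulated:
  assumes "\<And>j. c j = of_int (x j) * ee (of_int j * \<theta>)"
  shows "quad_sum c r t = of_real (quad_energy x r t)"
proof -
  have "c (j1 + r) * c (j2 + r) * cnj (c (j3 + r)) * cnj (c (j4 + r))
    = of_real (real_of_int (x (j1 + r)) * real_of_int (x (j2 + r)) * real_of_int (x (j3 + r)) * real_of_int (x (j4 + r)))"
    if "j1 + j2 = j3 + j4" for j1 j2 j3 j4
  proof -
    have "real_of_int (j1 + j2) = real_of_int (j3 + j4)" using that by simp
    then have "of_int (j1 + r) * \<theta> + of_int (j2 + r) * \<theta> + - (of_int (j3 + r) * \<theta>) + - (of_int (j4 + r) * \<theta>) = 0"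
      by (simp add: distrib_right[symmetric] left_diff_distrib[symmetric] flip: mult_minus_left)
    then have "ee (of_int (j1 + r) * \<theta>) * ee (of_int (j2 + r) * \<theta>) * cnj (ee (of_int (j3 + r) * \<theta>)) * cnj (ee (of_int (j4 + r) * \<theta>)) = 1"
      by (simp only: cnj_ee ee_add[symmetric] ee_0)
    then show ?thesis unfolding assms by (simp add: mult_ac)
  qed
  then show ?thesis unfolding quad_sum_def quad_energy_def of_real_sum
    by (intro sum.cong refl) (auto simp only: quads_def mem_Collect_eq prod.case)
qed

section \<open>The Jacobi sequence and its modulations\<close>

lemma prime_factorization_squarefree:
  fixes n :: nat
  assumes "squarefree n"
  shows "prime_factorization n = mset_set (prime_factors n)"
proof (rule multiset_eqI)
  fix p
  have n0: "n \<noteq> 0" using assms by (metis not_squarefree_0)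
  show "count (prime_factorization n) p = count (mset_set (prime_factors n)) p"
  proof (cases "p \<in> prime_factors n")
    case True
    then have pp: "prime p" and pd: "p dvd n" by auto
    have "multiplicity p n \<le> 1"
      using assms pp by (simp add: squarefree_factorial_semiring'[OF n0])
        (metis True dual_order.refl)
    moreover have "multiplicity p n > 0" using True by (simp add: prime_factors_multiplicity)
    ultimately show ?thesis using True pp by (simp add: count_prime_factorization)
  next
    case False
    then show ?thesis by (simp add: not_in_iff[symmetric])
  qed
qed

lemma prod_prime_factors_squarefree:
  fixes n :: nat
  assumes "squarefree n"
  shows "\<Prod>(prime_factors n) = n"
proof -
  have n0: "n \<noteq> 0" using assms by (metis not_squarefree_0)
  have "\<Prod>(prime_factors n) = prod_mset (prime_factorization n)"
    by (subst prime_factorization_squarefree[OF assms]) (simp add: prod_unfold_prod_mset)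
  then show ?thesis using n0 by (simp add: prod_mset_prime_factorization_nat)
qed

lemma odd_prime_factor:
  assumes "odd n" "p \<in> prime_factors n"
  shows "odd_prime p"
proof
  show "prime p" using assms by auto
  have "p dvd n" using assms by auto
  then show "odd p" using assms(1) by (meson dvd_trans)
qed

lemma Jacobi_seq_eq_jac:
  assumes n: "n > 1" "odd n" "squarefree n"
  shows "periodic_ext (Jacobi_seq n) j = jac (prime_factors n) j"
proof -
  have nth: "Jacobi (int i) (n div gcd i n) = jac (prime_factors n) (int i)" for i
  proof -
    let ?g = "gcd i n" and ?k = "n div gcd i n"
    have nk: "n = ?g * ?k" by simp
    have sk: "squarefree ?k" using n(3) nk by (metis squarefree_mono dvd_triv_right)
    have pf: "prime_factors ?k = {p\<in>prime_factors n. \<not> p dvd i}"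
    proof (intro equalityI subsetI)
      fix p assume p: "p \<in> prime_factors ?k"
      then have pp: "prime p" and pk: "p dvd ?k" by auto
      have pn: "p dvd n" using pk nk by (metis dvd_mult)
      have "\<not> p dvd i"
      proof
        assume "p dvd i"
        then have "p dvd ?g" using pn by simp
        then have "p * p dvd ?g * ?k" using pk by (intro mult_dvd_mono)
        then have "p ^ 2 dvd n" using nk by (simp add: power2_eq_square)
        then have "p dvd 1" using n(3) unfolding squarefree_def by blast
        with pp show False by simp
      qed
      then show "p \<in> {p\<in>prime_factors n. \<not> p dvd i}" using pp pn n by (simp add: in_prime_factors_iff)
    next
      fix p assume "p \<in> {p\<in>prime_factors n. \<not> p dvd i}"
      then have pp: "prime p" and pn: "p dvd n" and pi: "\<not> p dvd i" by auto
      have "p dvd ?g * ?k" using pn nk by simp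
      then have "p dvd ?k" using pi pp prime_dvd_mult_iff by (metis gcd_dvd1 dvd_trans)
      moreover have "?k \<noteq> 0" using nk n by (metis mult_0_right not_one_less_zero)
      ultimately show "p \<in> prime_factors ?k" using pp by (simp add: in_prime_factors_iff)
    qed
    have "Jacobi (int i) ?k = (\<Prod>p\<in>prime_factors ?k. Legendre (int i) (int p))"
      unfolding Jacobi_def by (subst prime_factorization_squarefree[OF sk]) (simp add: prod_unfold_prod_mset)
    also have "\<dots> = (\<Prod>p\<in>prime_factors n. loc p (int i))"
      unfolding pf by (rule prod.mono_neutral_cong_left) (auto simp: loc_def)
    finally show ?thesis by (simp add: jac_def)
  qed
  have len: "length (Jacobi_seq n) = n" by (simp add: Jacobi_seq_def)
  have n0: "0 < int n" using n by simp
  have "nat (j mod int n) < n" using n0 by (simp add: nat_less_iff)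
  then have "periodic_ext (Jacobi_seq n) j = jac (prime_factors n) (int (nat (j mod int n)))"
    unfolding periodic_ext_def len by (simp add: Jacobi_seq_def nth)
  also have "\<dots> = jac (prime_factors n) (j mod int n)" using n0 by simp
  also have "\<dots> = jac (prime_factors n) j"
  proof -
    have "periodic (\<Prod>(prime_factors n)) (jac (prime_factors n))"
      by (rule periodic_jac[OF finite_set_mset odd_prime_factor[OF n(2)]])
    then show ?thesis unfolding prod_prime_factors_squarefree[OF n(3)] periodic_def by (rule spec)
  qed
  finally show ?thesis .
qed

definition sigma_N :: "int \<Rightarrow> int" where
  "sigma_N j = (if j mod 4 = 0 \<or> j mod 4 = 1 then 1 else -1)"

definition sigma_P :: "int \<Rightarrow> int" where
  "sigma_P j = (if j mod 4 = 2 then -1 else 1)"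

lemma nat_mod4_cases:
  obtains q where "j = 4 * q" | q where "j = 4 * q + 1" | q where "j = 4 * q + 2" | q where "j = 4 * q + (3::nat)"
proof -
  have "j mod 4 = 0 \<or> j mod 4 = 1 \<or> j mod 4 = 2 \<or> j mod 4 = 3" by linarith
  moreover have "j = 4 * (j div 4) + j mod 4" by simp
  ultimately have "j = 4 * (j div 4) \<or> j = 4 * (j div 4) + 1 \<or> j = 4 * (j div 4) + 2 \<or> j = 4 * (j div 4) + 3"
    by linarith
  then show thesis using that by blast
qed

lemma sign_N: "(-1) ^ (j * (j - 1) div 2) = sigma_N (int j)"
proof (cases rule: nat_mod4_cases[of j])
  case (1 q)
  have "j * (j - 1) div 2 = 2 * (q * (j - 1))" unfolding 1 by simp
  moreover have "int j mod 4 = 0" unfolding 1 by simp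
  ultimately show ?thesis by (simp add: sigma_N_def power_mult)
next
  case (2 q)
  have "j * (j - 1) div 2 = 2 * (q * j)" unfolding 2 by simp
  moreover have "int j mod 4 = 1" unfolding 2 by presburger
  ultimately show ?thesis by (simp add: sigma_N_def power_mult)
next
  case (3 q)
  have "j * (j - 1) = 2 * ((2 * q + 1) * (4 * q + 1))" unfolding 3 by simp
  then have "j * (j - 1) div 2 = (2 * q + 1) * (4 * q + 1)" by simp
  then have "odd (j * (j - 1) div 2)" by simp
  moreover have "int j mod 4 = 2" unfolding 3 by presburger
  ultimately show ?thesis by (simp add: sigma_N_def)
next
  case (4 q)
  have "j * (j - 1) = 2 * ((4 * q + 3) * (2 * q + 1))" unfolding 4 by simp
  then have "j * (j - 1) div 2 = (4 * q + 3) * (2 * q + 1)" by simp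
  then have "odd (j * (j - 1) div 2)" by simp
  moreover have "int j mod 4 = 3" unfolding 4 by presburger
  ultimately show ?thesis by (simp add: sigma_N_def)
qed

lemma sign_P: "(-1) ^ (j * (j - 1) ^ 2 div 2) = sigma_P (int j)"
proof (cases rule: nat_mod4_cases[of j])
  case (1 q)
  have "j * (j - 1) ^ 2 div 2 = 2 * (q * (j - 1) ^ 2)" unfolding 1 by simp
  moreover have "int j mod 4 = 0" unfolding 1 by simp
  ultimately show ?thesis by (simp add: sigma_P_def power_mult)
next
  case (2 q)
  have "j * (j - 1) ^ 2 = 2 * (2 * (4 * q ^ 2 * j))" unfolding 2 by (simp add: power2_eq_square algebra_simps)
  then have "j * (j - 1) ^ 2 div 2 = 2 * (4 * q ^ 2 * j)" by (simp only: nonzero_mult_div_cancel_left)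
  moreover have "int j mod 4 = 1" unfolding 2 by presburger
  ultimately show ?thesis by (simp add: sigma_P_def power_mult)
next
  case (3 q)
  have "j * (j - 1) ^ 2 = 2 * ((2 * q + 1) * (4 * q + 1) ^ 2)" unfolding 3 by (simp add: power2_eq_square algebra_simps)
  then have "j * (j - 1) ^ 2 div 2 = (2 * q + 1) * (4 * q + 1) ^ 2" by simp
  then have "odd (j * (j - 1) ^ 2 div 2)" by simp
  moreover have "int j mod 4 = 2" unfolding 3 by presburger
  ultimately show ?thesis by (simp add: sigma_P_def)
next
  case (4 q)
  have "j * (j - 1) ^ 2 = 2 * (2 * ((4 * q + 3) * (2 * q + 1) ^ 2))" unfolding 4 by (simp add: power2_eq_square algebra_simps)
  then have "j * (j - 1) ^ 2 div 2 = 2 * ((4 * q + 3) * (2 * q + 1) ^ 2)" by simp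
  moreover have "int j mod 4 = 3" unfolding 4 by presburger
  ultimately show ?thesis by (simp add: sigma_P_def power_mult)
qed

lemma periodic_ext_modulated:
  assumes n: "length A > 0" and \<sigma>: "\<And>j. \<sigma> (j mod 4) = \<sigma> j"
    and B: "B = map (\<lambda>j. \<sigma> (int j) * periodic_ext A (int j)) [0..<4 * length A]"
  shows "periodic_ext B j = \<sigma> j * periodic_ext A j"
proof -
  let ?n = "length A" and ?i = "nat (j mod int (4 * length A))"
  have len: "length B = 4 * ?n" by (simp add: B)
  have i: "int ?i = j mod int (4 * ?n)" "?i < 4 * ?n" using n by (simp_all add: nat_less_iff)
  have "periodic_ext B j = \<sigma> (int ?i) * periodic_ext A (int ?i)"
    unfolding periodic_ext_def[of B] len using i(2) by (simp add: B)
  also have "\<sigma> (int ?i) = \<sigma> j"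
  proof -
    have "int ?i mod 4 = j mod 4" unfolding i(1) by (simp add: mod_mod_cancel)
    then show ?thesis by (metis \<sigma>)
  qed
  also have "periodic_ext A (int ?i) = periodic_ext A j"
  proof -
    have "int ?i mod int ?n = j mod int ?n" unfolding i(1) by (simp add: mod_mod_cancel)
    then show ?thesis by (simp add: periodic_ext_def)
  qed
  finally show ?thesis .
qed

lemma N_seq_eq:
  assumes n: "n > 1" "odd n" "squarefree n"
  shows "periodic_ext (N_seq (Jacobi_seq n)) j = sigma_N j * jac (prime_factors n) j"
proof -
  have "periodic_ext (N_seq (Jacobi_seq n)) j = sigma_N j * periodic_ext (Jacobi_seq n) j"
  proof (rule periodic_ext_modulated)
    show "length (Jacobi_seq n) > 0" using n by (simp add: Jacobi_seq_def)
    show "sigma_N (j mod 4) = sigma_N j" for j by (simp add: sigma_N_def)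
  qed (simp only: N_seq_def sign_N)
  then show ?thesis by (simp add: Jacobi_seq_eq_jac[OF n])
qed

lemma P_seq_eq:
  assumes n: "n > 1" "odd n" "squarefree n"
  shows "periodic_ext (P_seq (Jacobi_seq n)) j = sigma_P j * jac (prime_factors n) j"
proof -
  have "periodic_ext (P_seq (Jacobi_seq n)) j = sigma_P j * periodic_ext (Jacobi_seq n) j"
  proof (rule periodic_ext_modulated)
    show "length (Jacobi_seq n) > 0" using n by (simp add: Jacobi_seq_def)
    show "sigma_P (j mod 4) = sigma_P j" for j by (simp add: sigma_P_def)
  qed (simp only: P_seq_def sign_P)
  then show ?thesis by (simp add: Jacobi_seq_eq_jac[OF n])
qed

lemma jac_pm1:
  assumes "\<And>p. p \<in> Q \<Longrightarrow> odd_prime p"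
  shows "jac Q j = 1 \<or> jac Q j = -1"
proof -
  have "\<bar>loc p j\<bar> = 1" if "p \<in> Q" for p
    using odd_prime.chi_cases[OF assms[OF that], of j] by (auto simp: loc_def)
  then have "\<bar>jac Q j\<bar> = 1" unfolding jac_def abs_prod by (intro prod.neutral) auto
  then show ?thesis by linarith
qed

text \<open>
  The hypotheses on the transform of \<open>\<tau>\<close> are finite checks in the three cases, since \<open>s\<close> is 1, 2 or 4 and \<open>\<Prod>Q\<close> is
  odd.
\<close>

lemma modulated_spectrum_exists:
  assumes Q: "finite Q" "\<And>p. p \<in> Q \<Longrightarrow> odd_prime p" and s: "s > 0" "coprime s (\<Prod>Q)" and \<tau>: "periodic s \<tau>"
    and \<beta>: "\<And>k. norm (dft s (\<lambda>j. \<tau> (int (\<Prod>Q) * j)) k) ^ 2 = real s"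
    and ph: "\<And>k l. dft s (\<lambda>j. \<tau> (int (\<Prod>Q) * j)) k ^ 2 * cnj (dft s (\<lambda>j. \<tau> (int (\<Prod>Q) * j)) l) ^ 2
               = of_nat s ^ 2 * ee (of_int (h * (k - l)) / of_nat (s * \<Prod>Q))"
  shows "\<exists>g. modulated_spectrum Q g s (dft s (\<lambda>j. \<tau> (int (\<Prod>Q) * j))) h (\<lambda>j. \<tau> j * of_int (jac Q j))"
proof -
  have nd: "\<not> int p dvd int s" if "p \<in> Q" for p
  proof
    assume "int p dvd int s"
    then have "p dvd s" by simp
    moreover have "p dvd \<Prod>Q" using dvd_prodI[OF Q(1) that, of "\<lambda>x. x"] by simp
    ultimately have "p dvd 1" using s(2) by (metis coprime_common_divisor)
    then show False using odd_prime.p_gt_2[OF Q(2)[OF that]] by simp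
  qed
  obtain g where g: "\<forall>p\<in>Q. norm (g p :: complex) ^ 2 = real p"
    "\<And>k. dft (\<Prod>Q) (\<lambda>j. of_int (jac Q (int s * j))) k = (\<Prod>p\<in>Q. g p * of_int (Legendre k (int p)) + 1)"
    using dft_jac[OF Q nd] by blast
  interpret js: jacobi_spectrum Q g by (rule jacobi_spectrum.intro) (use Q g in blast)+
  have pj: "periodic (\<Prod>Q) (\<lambda>j. complex_of_int (jac Q j))"
    using periodic_jac[OF Q] by (simp add: periodic_def)
  have "modulated_spectrum Q g s (dft s (\<lambda>j. \<tau> (int (\<Prod>Q) * j))) h (\<lambda>j. \<tau> j * of_int (jac Q j))"
  proof unfold_locales
    show "periodic (s * \<Prod>Q) (\<lambda>j. \<tau> j * of_int (jac Q j))"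
      by (intro periodic_mult periodic_times \<tau> pj)
    show "dft (s * \<Prod>Q) (\<lambda>j. \<tau> j * of_int (jac Q j)) k = dft s (\<lambda>j. \<tau> (int (\<Prod>Q) * j)) k * js.jspec k" for k
      using dft_mult[OF s(1) js.n_pos s(2) \<tau> pj, of k] by (simp only: g(2) js.jspec_def)
    show "periodic s (dft s (\<lambda>j. \<tau> (int (\<Prod>Q) * j)))" by (rule periodic_dft[OF s(1)])
  qed (use s \<beta> ph in auto)
  then show ?thesis by blast
qed

lemma ee_quarters: "ee (1/4) = \<i>" "ee (-(1/4)) = -\<i>" "ee (1/2) = -1" "ee (-(1/2)) = -1" "ee (-(3/4)) = \<i>"
proof -
  show 1: "ee (1/4) = \<i>" by (simp add: ee_def complex_eq_iff)
  show 2: "ee (-(1/4)) = -\<i>" using cnj_ee[of "1/4"] 1 by simp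
  show 3: "ee (1/2) = -1" using ee_add[of "1/4" "1/4"] 1 by simp
  show 4: "ee (-(1/2)) = -1" using ee_add[of "-(1/4)" "-(1/4)"] 2 by simp
  show "ee (-(3/4)) = \<i>" using ee_add[of "-(1/4)" "-(1/2)"] 2 4 by simp
qed

lemma ee_half_int: "ee (of_int k / 2) = (if even k then 1 else -1)"
proof (cases "even k")
  case True
  then obtain l where "k = 2 * l" by blast
  then have "real_of_int k / 2 = of_int l" by simp
  then show ?thesis using True by (simp only: ee_of_int if_True)
next
  case False
  then obtain l where "k = 2 * l + 1" by (elim oddE)
  then have "real_of_int k / 2 = 1 / 2 + of_int l" by simp
  then show ?thesis using False by (simp only: ee_periodic ee_quarters if_False)
qed

lemma jacobi_modulated_spectrum:
  assumes n: "n > 1" "odd n" "squarefree n"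
  shows "\<exists>g \<beta>. modulated_spectrum (prime_factors n) g 1 \<beta> 0 (\<lambda>j. of_int (jac (prime_factors n) j))"
proof -
  have Q: "\<Prod>(prime_factors n) = n" by (rule prod_prime_factors_squarefree[OF n(3)])
  have "{0..<1::int} = {0}" by auto
  then have d: "dft 1 (\<lambda>j. 1) k = 1" for k by (simp add: dft_def)
  have "\<exists>g. modulated_spectrum (prime_factors n) g 1 (dft 1 (\<lambda>j. 1)) 0 (\<lambda>j. 1 * of_int (jac (prime_factors n) j))"
    by (rule modulated_spectrum_exists[where \<tau> = "\<lambda>_. 1"])
      (simp_all add: odd_prime_factor[OF n(2)] periodic_def d[simplified])
  then show ?thesis by auto
qed

text \<open>
  The pattern \<open>+ + - -\<close> times \<open>\<i>^j\<close>; it has period 2 instead of 4.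
\<close>

definition tau_N :: "int \<Rightarrow> complex" where
  "tau_N j = (if even j then 1 else \<i>)"

lemma N_modulated_spectrum:
  assumes n: "n > 1" "odd n" "squarefree n"
  shows "\<exists>g \<beta>. modulated_spectrum (prime_factors n) g 2 \<beta> (int n) (\<lambda>j. tau_N j * of_int (jac (prime_factors n) j))"
proof -
  have Q: "\<Prod>(prime_factors n) = n" by (rule prod_prime_factors_squarefree[OF n(3)])
  have r2: "{0..<int 2} = {0, 1}" by auto
  have tau: "tau_N (int n * j) = tau_N j" for j using n(2) by (simp add: tau_N_def)
  have d: "dft 2 tau_N k = (if even k then 1 + \<i> else 1 - \<i>)" for k
  proof -
    have "dft 2 tau_N k = 1 + \<i> * ee (of_int (- k) / 2)"
      unfolding dft_def r2 by (simp add: tau_N_def)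
    then show ?thesis unfolding ee_half_int by simp
  qed
  have "\<exists>g. modulated_spectrum (prime_factors n) g 2 (dft 2 (\<lambda>j. tau_N (int (\<Prod>(prime_factors n)) * j))) (int n) (\<lambda>j. tau_N j * of_int (jac (prime_factors n) j))"
  proof (rule modulated_spectrum_exists)
    show "coprime 2 (\<Prod>(prime_factors n))" unfolding Q using n(2) by simp
    show "periodic 2 tau_N" by (rule periodicI_add) (simp add: tau_N_def)
    show "norm (dft 2 (\<lambda>j. tau_N (int (\<Prod>(prime_factors n)) * j)) k) ^ 2 = real 2" for k
      unfolding Q tau d by (simp add: cmod_power2)
    show "dft 2 (\<lambda>j. tau_N (int (\<Prod>(prime_factors n)) * j)) k ^ 2 * cnj (dft 2 (\<lambda>j. tau_N (int (\<Prod>(prime_factors n)) * j)) l) ^ 2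
               = of_nat 2 ^ 2 * ee (of_int (int n * (k - l)) / of_nat (2 * \<Prod>(prime_factors n)))" for k l
    proof -
      have "real_of_int (int n * (k - l)) / real (2 * n) = of_int (k - l) / 2" using n by simp
      then show ?thesis unfolding Q tau d
        by (simp only: ee_half_int) (auto simp: power2_eq_square algebra_simps)
    qed
  qed (simp_all add: odd_prime_factor[OF n(2)])
  then show ?thesis by blast
qed

lemma P_modulated_spectrum:
  assumes n: "n > 1" "odd n" "squarefree n"
  shows "\<exists>g \<beta>. modulated_spectrum (prime_factors n) g 4 \<beta> 0 (\<lambda>j. of_int (sigma_P j) * of_int (jac (prime_factors n) j))"
proof -
  have Q: "\<Prod>(prime_factors n) = n" by (rule prod_prime_factors_squarefree[OF n(3)])
  have r4: "{0..<int 4} = {0, 1, 2, 3}" by auto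
  let ?tau = "\<lambda>j. complex_of_int (sigma_P j)"
  have per: "periodic 4 ?tau" by (rule periodicI_add) (simp add: sigma_P_def)
  have tau: "?tau (int n * j) = ?tau j" for j
  proof -
    have "int n * j mod 4 = 2 \<longleftrightarrow> j mod 4 = 2"
    proof -
      have nm: "int n mod 4 = 1 \<or> int n mod 4 = 3" using n(2) by presburger
      have jm: "j mod 4 = 0 \<or> j mod 4 = 1 \<or> j mod 4 = 2 \<or> j mod 4 = 3" by presburger
      have "int n * j mod 4 = (int n mod 4) * (j mod 4) mod 4" by (simp add: mod_mult_eq)
      then show ?thesis using nm jm by auto
    qed
    then show ?thesis by (simp add: sigma_P_def)
  qed
  have d: "dft 4 ?tau k = 2 \<or> dft 4 ?tau k = -2" for k
  proof -
    have "dft 4 ?tau k = dft 4 ?tau (k mod 4)"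
      using periodic_dft[of 4 ?tau] by (simp add: periodic_def)
    moreover have "k mod 4 = 0 \<or> k mod 4 = 1 \<or> k mod 4 = 2 \<or> k mod 4 = 3" by presburger
    moreover have "ee (-1) = 1" "ee (-(3/2)) = -1" "ee (-(9/4)) = -\<i>"
      using ee_periodic[of 0 "-1"] ee_periodic[of "1/2" "-2"] ee_periodic[of "-(1/4)" "-2"] by (simp_all add: ee_quarters)
    moreover have "ee (-3) = 1" using ee_of_int[of "-3"] by simp
    ultimately show ?thesis
      unfolding dft_def r4 by (auto simp: sigma_P_def ee_quarters)
  qed
  have "\<exists>g. modulated_spectrum (prime_factors n) g 4 (dft 4 (\<lambda>j. ?tau (int (\<Prod>(prime_factors n)) * j))) 0 (\<lambda>j. ?tau j * of_int (jac (prime_factors n) j))"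
  proof (rule modulated_spectrum_exists)
    have "coprime (2 ^ 2) n" using n(2) by (simp only: coprime_power_left_iff coprime_left_2_iff_odd) simp
    then show "coprime 4 (\<Prod>(prime_factors n))" unfolding Q by simp
    show "norm (dft 4 (\<lambda>j. ?tau (int (\<Prod>(prime_factors n)) * j)) k) ^ 2 = real 4" for k
      unfolding Q tau using d[of k] by auto
    show "dft 4 (\<lambda>j. ?tau (int (\<Prod>(prime_factors n)) * j)) k ^ 2 * cnj (dft 4 (\<lambda>j. ?tau (int (\<Prod>(prime_factors n)) * j)) l) ^ 2
               = of_nat 4 ^ 2 * ee (of_int (0 * (k - l)) / of_nat (4 * \<Prod>(prime_factors n)))" for k l
      unfolding Q tau using d[of k] d[of l] by auto
  qed (simp_all add: odd_prime_factor[OF n(2)] per)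
  then show ?thesis by blast
qed

lemma tau_N_modulation: "tau_N j = of_int (sigma_N j) * ee (of_int j * (1/4))"
proof -
  have "real_of_int j * (1/4) = of_int (j mod 4) / 4 + of_int (j div 4)"
  proof -
    have "real_of_int j = real_of_int (4 * (j div 4) + j mod 4)" by (simp only: mult_div_mod_eq)
    then have "real_of_int j = 4 * real_of_int (j div 4) + real_of_int (j mod 4)"
      by (simp only: of_int_add of_int_mult of_int_numeral)
    then show ?thesis by linarith
  qed
  then have "ee (of_int j * (1/4)) = ee (of_int (j mod 4) / 4)" by (simp only: ee_periodic)
  moreover have "j mod 4 = 0 \<or> j mod 4 = 1 \<or> j mod 4 = 2 \<or> j mod 4 = 3" by presburger
  moreover have "ee (3/4) = -\<i>" using ee_periodic[of "-(1/4)" 1] by (simp add: ee_quarters)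
  moreover have "even j \<longleftrightarrow> j mod 4 = 0 \<or> j mod 4 = 2" by presburger
  ultimately show ?thesis by (auto simp: tau_N_def sigma_N_def ee_quarters)
qed

section \<open>Positivity of the limiting denominator\<close>

lemma limit_denominator_eq:
  assumes "T > 0"
  shows "limit_denominator R T = tent_sum (T + 2 * R) T + 2 * tent_sum 0 T - 4 * T / 3 - 1"
  unfolding tent_sum_0[OF assms] tent_sum_window[OF assms] limit_denominator_def by simp

text \<open>
  The two integers next to the centre of the tent lie at distances \<open>x\<close> and \<open>1 - x\<close> from it. By
  convexity the worst case is \<open>x = 1/2\<close>, and there the claim is an inequality in \<open>T\<close> alone, which is clear for
  \<open>T < 3/4\<close>.
\<close>

lemma limit_denominator_pos_short:
  assumes T: "0 < T" "T \<le> 1"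
  shows "limit_denominator R T > 0"
proof -
  define y where "y = T + 2 * R"
  define k where "k = \<lfloor>y\<rfloor>"
  define x where "x = y - of_int k"
  have x: "0 \<le> x" "x < 1" unfolding x_def k_def by linarith+
  let ?f = "\<lambda>i::int. (max 0 (1 - \<bar>(of_int i - y) / T\<bar>)) ^ 2"
  define a b where "a = max 0 (1 - x / T)" and "b = max 0 (1 - (1 - x) / T)"
  define N where "N = \<lceil>T + \<bar>y\<bar> + 2\<rceil>"
  have N: "T + \<bar>y\<bar> + 2 \<le> real_of_int N" unfolding N_def by linarith
  have kN: "k \<in> {-N..N}" "k + 1 \<in> {-N..N}"
  proof -
    have "\<bar>real_of_int k\<bar> \<le> \<bar>y\<bar> + 1" unfolding k_def by linarith
    then have "\<bar>real_of_int k\<bar> + 1 \<le> real_of_int N" using N T by linarith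
    then show "k \<in> {-N..N}" "k + 1 \<in> {-N..N}" by auto
  qed
  have "a ^ 2 + b ^ 2 = (\<Sum>i\<in>{k, k + 1}. ?f i)"
  proof -
    have "\<bar>(of_int k - y) / T\<bar> = x / T" "\<bar>(of_int (k + 1) - y) / T\<bar> = (1 - x) / T"
      using x T by (simp_all add: x_def abs_divide)
    then show ?thesis unfolding a_def b_def by simp
  qed
  also have "\<dots> \<le> (\<Sum>i=-N..N. ?f i)" using kN by (intro sum_mono2) auto
  also have "\<dots> = tent_sum y T" using N T by (intro tent_sum_eq[symmetric]) auto
  finally have ab: "a ^ 2 + b ^ 2 \<le> tent_sum y T" .
  have t0: "tent_sum 0 T = 1"
  proof -
    have "(\<Sum>\<^sub>\<infinity>m\<in>{1::nat..}. (max 0 (1 - real m / T)) ^ 2) = (\<Sum>m\<in>{}. (max 0 (1 - real m / T)) ^ 2)"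
      using T by (intro infsum_finite_support) (auto simp: le_divide_eq)
    then show ?thesis using tent_sum_0[OF T(1)] by simp
  qed
  have "0 < a ^ 2 + b ^ 2 + 1 - 4 * T / 3"
  proof (cases "T < 3 / 4")
    case True
    moreover have "0 \<le> a ^ 2 + b ^ 2" by simp
    ultimately show ?thesis by linarith
  next
    case False
    \<comment> \<open>In terms of \<open>w\<close>, the two values of the tent function add up to at least \<open>1 - w\<close>.\<close>
    define w where "w = 1 / T - 1"
    have w: "0 \<le> w" "w \<le> 1 / 3" using T False by (simp_all add: w_def field_simps)
    have Tw: "T = 1 / (1 + w)" using T by (simp add: w_def)
    have "1 - w \<le> a + b"
    proof -
      have "1 - x / T \<le> a" "1 - (1 - x) / T \<le> b" by (simp_all add: a_def b_def)
      moreover have "x / T + (1 - x) / T = 1 / T" by (simp add: add_divide_distrib[symmetric])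
      ultimately show ?thesis by (simp add: w_def)
    qed
    then have "(1 - w) ^ 2 \<le> (a + b) ^ 2" using w by (intro power_mono) auto
    moreover have "(a + b) ^ 2 \<le> 2 * (a ^ 2 + b ^ 2)"
      using zero_le_power2[of "a - b"] by (simp add: power2_eq_square algebra_simps)
    ultimately have "(1 - w) ^ 2 \<le> 2 * (a ^ 2 + b ^ 2)" by (rule order_trans)
    then have ab2: "(1 - w) ^ 2 / 2 \<le> a ^ 2 + b ^ 2" by (simp only: divide_le_eq mult.commute) simp
    have "0 < (1 + w) * ((1 - w) ^ 2 / 2 + 1) - 4 / 3"
    proof -
      have "w * w \<le> w * 1" using w by (intro mult_left_mono) auto
      moreover have "0 \<le> w * w * w" using w by simp
      ultimately have "0 \<le> w - w * w + w * w * w" by linarith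
      then have "0 < 1 / 6 + (w - w * w + w * w * w) / 2" by (intro add_pos_nonneg divide_nonneg_pos) simp_all
      also have "\<dots> = (1 + w) * ((1 - w) ^ 2 / 2 + 1) - 4 / 3"
        by (simp add: power2_eq_square field_simps)
      finally show ?thesis .
    qed
    then have "4 / 3 < ((1 - w) ^ 2 / 2 + 1) * (1 + w)" by (simp add: mult.commute)
    then have "4 / 3 / (1 + w) < (1 - w) ^ 2 / 2 + 1" using w by (simp only: pos_divide_less_eq)
    moreover have "4 * T / 3 = 4 / 3 / (1 + w)" unfolding Tw by simp
    ultimately show ?thesis using ab2 by linarith
  qed
  then show ?thesis unfolding limit_denominator_eq[OF T(1)] t0 y_def[symmetric] using ab by linarith
qed

section \<open>Growth conditions\<close>

lemma at_top_in_nontrivial: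
  assumes "infinite S"
  shows "at_top_in S \<noteq> bot"
proof
  assume "at_top_in S = bot"
  then have "eventually (\<lambda>_. False) (at_top_in S)" by simp
  then have "eventually (\<lambda>n. n \<notin> S) at_top" by (simp add: eventually_inf_principal)
  then obtain N where "\<And>n. n \<ge> N \<Longrightarrow> n \<notin> S" by (auto simp: eventually_at_top_linorder)
  then have "S \<subseteq> {..<N}" by (meson lessThan_iff not_le subsetI)
  with assms show False using finite_subset by blast
qed

lemma eventually_in_S: "\<forall>\<^sub>F n in at_top_in S. n \<in> S"
  by (simp add: eventually_inf_principal)

lemma real_at_top_in: "filterlim (\<lambda>n. real n) at_top (at_top_in S)"
  by (rule filterlim_mono[OF filterlim_real_sequentially order_refl]) simp

lemma kappa_facts:
  assumes n: "n > 1"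
  shows "kappa n > 0" "\<And>p. p \<in> prime_factors n \<Longrightarrow> kappa n \<le> p" "squarefree n \<Longrightarrow> kappa n ^ omega n \<le> n"
proof -
  obtain p where "prime p" "p dvd n" using n prime_factor_nat[of n] by auto
  then have "p \<in> prime_factors n" using n by (simp add: in_prime_factors_iff)
  then have ne: "prime_factors n \<noteq> {}" by blast
  have "kappa n \<in> prime_factors n" unfolding kappa_def using ne by (intro Min_in) auto
  then show "kappa n > 0" by (auto simp: in_prime_factors_iff prime_gt_0_nat)
  show le: "kappa n \<le> p" if "p \<in> prime_factors n" for p unfolding kappa_def using that by (intro Min_le) auto
  assume sq: "squarefree n"
  have "kappa n ^ omega n = (\<Prod>p\<in>prime_factors n. kappa n)" by (simp add: omega_def)
  also have "\<dots> \<le> \<Prod>(prime_factors n)" using le by (intro prod_mono) auto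
  finally show "kappa n ^ omega n \<le> n" by (simp add: prod_prime_factors_squarefree[OF sq])
qed

context
  fixes S :: "nat set"
  assumes S: "\<And>n. n \<in> S \<Longrightarrow> n > 1 \<and> odd n \<and> squarefree n"
    and growth: "((\<lambda>n. max (4 ^ omega n * ln (real n) ^ 6) (5 ^ omega n) / real (kappa n)) \<longlongrightarrow> 0) (at_top_in S)"
begin

abbreviation growth_ratio :: "nat \<Rightarrow> real" where
  "growth_ratio n \<equiv> max (4 ^ omega n * ln (real n) ^ 6) (5 ^ omega n) / real (kappa n)"

lemma kappa_at_top: "\<forall>\<^sub>F n in at_top_in S. M \<le> real (kappa n)"
proof -
  define M' where "M' = max M 1"
  have M': "M' > 0" "M \<le> M'" by (simp_all add: M'_def)
  have "\<forall>\<^sub>F n in at_top_in S. growth_ratio n < 1 / M'"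
    using order_tendstoD(2)[OF growth, of "1 / M'"] M' by simp
  with eventually_in_S show ?thesis
  proof eventually_elim
    case (elim n)
    have k: "0 < real (kappa n)" using kappa_facts(1) S[OF elim(1)] by simp
    have "(1::real) \<le> 5 ^ omega n" by simp
    then have "1 \<le> max (4 ^ omega n * ln (real n) ^ 6) (5 ^ omega n)" by (rule order_trans[OF _ max.cobounded2])
    then have "1 / real (kappa n) \<le> growth_ratio n" using k by (intro divide_right_mono) auto
    with elim have "1 / real (kappa n) < 1 / M'" by linarith
    then have "M' < real (kappa n)" using k M' by (simp add: divide_less_eq)
    with M' show ?case by linarith
  qed
qed

lemma ln_eventually_ge: "\<forall>\<^sub>F n in at_top_in S. C \<le> ln (real n)"
  using filterlim_compose[OF ln_at_top real_at_top_in[of S]] by (simp add: filterlim_at_top)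

lemma log_factor_le:
  assumes s: "0 < s" "s \<le> 4" and n: "4 \<le> ln (real n)" "n > 1"
  shows "1 + ln (real (s * n)) \<le> 2 * ln (real n)" "1 \<le> 1 + ln (real (s * n))"
proof -
  have "ln (real s) \<le> real s - 1" using s by (intro ln_le_minus_one) simp
  then have "ln (real s) \<le> 3" using s by simp
  moreover have "ln (real (s * n)) = ln (real s) + ln (real n)" using s n by (simp add: ln_mult)
  ultimately show "1 + ln (real (s * n)) \<le> 2 * ln (real n)" using n by linarith
  have "0 < s * n" using s n by simp
  then have "1 \<le> real (s * n)" by linarith
  then show "1 \<le> 1 + ln (real (s * n))" by simp
qed

text \<open>
  With \<open>omega^2 \<le> 4^omega\<close>, the square of \<open>omega * ln n ^ 2 / sqrt kappa\<close> is at most the ratio that tends to 0 by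
  hypothesis.
\<close>

lemma paired_error_limit:
  assumes s: "0 < s" "s \<le> 4"
  shows "((\<lambda>n. (exp (17 * real (omega n) / sqrt (real (kappa n))) - 1) * (1 + ln (real (s * n))) ^ 2) \<longlongrightarrow> 0) (at_top_in S)"
proof -
  let ?y = "\<lambda>n. 17 * real (omega n) / sqrt (real (kappa n))"
  let ?z = "\<lambda>n. 17 * sqrt (growth_ratio n)"
  have z0: "(?z \<longlongrightarrow> 0) (at_top_in S)"
    using tendsto_mult[OF tendsto_const tendsto_real_sqrt[OF growth], of 17] by simp
  have yz: "\<forall>\<^sub>F n in at_top_in S. 0 \<le> ?y n \<and> ?y n * ln (real n) ^ 2 \<le> ?z n"
    using eventually_in_S ln_eventually_ge[of 1]
  proof eventually_elim
    case (elim n)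
    have k: "0 < real (kappa n)" using kappa_facts(1) S[OF elim(1)] by simp
    have "real (omega n) \<le> 2 ^ omega n" by (rule less_imp_le[OF of_nat_less_two_power])
    then have "real (omega n) ^ 2 \<le> (2 ^ omega n) ^ 2" by (intro power_mono) auto
    also have "(2 ^ omega n) ^ 2 = (4::real) ^ omega n" by (simp add: power2_eq_square power_mult_distrib[symmetric])
    finally have o: "real (omega n) ^ 2 \<le> 4 ^ omega n" .
    have "ln (real n) ^ 4 \<le> ln (real n) ^ 6" using elim by (intro power_increasing) auto
    then have "real (omega n) ^ 2 * ln (real n) ^ 4 \<le> 4 ^ omega n * ln (real n) ^ 6"
      using o elim by (intro mult_mono) auto
    then have "real (omega n) ^ 2 * ln (real n) ^ 4 / real (kappa n) \<le> growth_ratio n"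
      using k by (intro divide_right_mono) auto
    moreover have "real (omega n) ^ 2 * ln (real n) ^ 4 / real (kappa n) = (real (omega n) * ln (real n) ^ 2 / sqrt (real (kappa n))) ^ 2"
      using k by (simp add: power_divide power_mult_distrib power_mult[symmetric])
    ultimately have "real (omega n) * ln (real n) ^ 2 / sqrt (real (kappa n)) \<le> sqrt (growth_ratio n)"
      by (intro real_le_rsqrt) simp
    then have "17 * (real (omega n) * ln (real n) ^ 2 / sqrt (real (kappa n))) \<le> ?z n" by simp
    then show ?case using k by simp
  qed
  have "\<forall>\<^sub>F n in at_top_in S. ?z n \<le> 1" using order_tendstoD(2)[OF z0, of 1] by (auto elim: eventually_mono)
  with yz ln_eventually_ge[of 4] eventually_in_S
  have "\<forall>\<^sub>F n in at_top_in S. 0 \<le> (exp (?y n) - 1) * (1 + ln (real (s * n))) ^ 2 \<and> (exp (?y n) - 1) * (1 + ln (real (s * n))) ^ 2 \<le> 8 * ?z n"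
  proof eventually_elim
    case (elim n)
    let ?L = "1 + ln (real (s * n))"
    have L: "?L \<le> 2 * ln (real n)" "1 \<le> ?L" using log_factor_le[OF s] elim S by auto
    have "1 \<le> ln (real n) ^ 2" using elim by (intro one_le_power) auto
    then have "?y n * 1 \<le> ?y n * ln (real n) ^ 2" using elim by (intro mult_left_mono) auto
    then have y1: "0 \<le> ?y n" "?y n \<le> 1" using elim by linarith+
    have "?y n ^ 2 \<le> ?y n * 1" unfolding power2_eq_square using y1 by (intro mult_left_mono) auto
    then have e: "exp (?y n) - 1 \<le> 2 * ?y n" using exp_bound[OF y1] by linarith
    have e0: "0 \<le> exp (?y n) - 1" using y1 by simp
    have "?L ^ 2 \<le> (2 * ln (real n)) ^ 2" using L by (intro power_mono) auto
    then have "(exp (?y n) - 1) * ?L ^ 2 \<le> (2 * ?y n) * (2 * ln (real n)) ^ 2"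
      using e e0 y1 by (intro mult_mono) auto
    also have "\<dots> = 8 * (?y n * ln (real n) ^ 2)" by (simp add: power_mult_distrib)
    also have "\<dots> \<le> 8 * ?z n" using elim by linarith
    finally show ?case using e0 by simp
  qed
  then have ev: "\<forall>\<^sub>F n in at_top_in S. 0 \<le> (exp (?y n) - 1) * (1 + ln (real (s * n))) ^ 2"
    "\<forall>\<^sub>F n in at_top_in S. (exp (?y n) - 1) * (1 + ln (real (s * n))) ^ 2 \<le> 8 * ?z n"
    by (auto elim: eventually_mono)
  have "((\<lambda>n. 8 * ?z n) \<longlongrightarrow> 0) (at_top_in S)"
    using tendsto_mult[OF tendsto_const z0, of 8] by simp
  then show ?thesis by (rule tendsto_sandwich[OF ev tendsto_const])
qed

text \<open>
  Once \<open>kappa n\<close> exceeds \<open>38^32\<close>, the power \<open>38^omega\<close> is at most \<open>n^(1/32)\<close>, because \<open>kappa^omega \<le> n\<close>.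
\<close>

lemma unpaired_error_limit:
  assumes s: "0 < s" "s \<le> 4"
  shows "((\<lambda>n. 38 ^ omega n * (1 + ln (real (s * n))) ^ 4 * real n powr (-1/16)) \<longlongrightarrow> 0) (at_top_in S)"
proof -
  have lim: "((\<lambda>n. 16 * ln (real n) ^ 4 * real n powr (-1/32)) \<longlongrightarrow> 0) (at_top_in S)"
  proof -
    have "((\<lambda>x::real. 16 * ln x ^ 4 * x powr (-1/32)) \<longlongrightarrow> 0) at_top" by real_asymp
    then show ?thesis by (rule filterlim_compose[OF _ real_at_top_in])
  qed
  have "\<forall>\<^sub>F n in at_top_in S. 38 ^ omega n * (1 + ln (real (s * n))) ^ 4 * real n powr (-1/16) \<le> 16 * ln (real n) ^ 4 * real n powr (-1/32)"
    using eventually_in_S ln_eventually_ge[of 4] kappa_at_top[of "38 ^ 32"]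
  proof eventually_elim
    case (elim n)
    have n: "n > 1" "squarefree n" using S elim by auto
    let ?L = "1 + ln (real (s * n))"
    have L: "?L \<le> 2 * ln (real n)" "1 \<le> ?L" using log_factor_le[OF s] elim n by auto
    have "((38::real) ^ omega n) ^ 32 = (38 ^ 32) ^ omega n" by (simp only: power_mult[symmetric] mult.commute)
    also have "\<dots> \<le> real (kappa n) ^ omega n" using elim by (intro power_mono) auto
    also have "\<dots> \<le> real n" using kappa_facts(3)[OF n] by (metis of_nat_le_iff of_nat_power)
    finally have "(((38::real) ^ omega n) ^ 32) powr (1/32) \<le> real n powr (1/32)" by (intro powr_mono2) auto
    moreover have "(x ^ 32) powr (1/32) = x" if "x > 0" for x :: real
    proof -
      have "x ^ 32 = x powr 32" using that by (intro powr_numeral[symmetric]) simp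
      then show ?thesis using that by (simp only: powr_powr) simp
    qed
    ultimately have 38: "(38::real) ^ omega n \<le> real n powr (1/32)" by (simp only: zero_less_power zero_less_numeral)
    have "?L ^ 4 \<le> (2 * ln (real n)) ^ 4" using L by (intro power_mono) auto
    then have "38 ^ omega n * ?L ^ 4 \<le> real n powr (1/32) * (2 * ln (real n)) ^ 4"
      using 38 by (intro mult_mono) auto
    then have "38 ^ omega n * ?L ^ 4 * real n powr (-1/16) \<le> real n powr (1/32) * (2 * ln (real n)) ^ 4 * real n powr (-1/16)"
      by (intro mult_right_mono) auto
    also have "\<dots> = 16 * ln (real n) ^ 4 * (real n powr (1/32) * real n powr (-1/16))" by (simp add: power_mult_distrib)
    also have "real n powr (1/32) * real n powr (-1/16) = real n powr (-1/32)" by (simp add: powr_add[symmetric])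
    finally show ?case .
  qed
  moreover have "\<forall>\<^sub>F n in at_top_in S. 0 \<le> 38 ^ omega n * (1 + ln (real (s * n))) ^ 4 * real n powr (-1/16)"
    by (simp add: zero_le_even_power)
  ultimately show ?thesis using lim by (intro tendsto_sandwich[OF _ _ tendsto_const lim])
qed

section \<open>Limit of the quadruple sums\<close>

text \<open>
  The scale is \<open>m = s n\<close>. The parameter \<open>H\<close> is the effect of the phase: \<open>2 r + h\<close> takes the place of \<open>2 r\<close>.
\<close>

lemma energy_limit:
  fixes t :: "nat \<Rightarrow> nat" and r h :: "nat \<Rightarrow> int" and E :: "nat \<Rightarrow> real"
  assumes T: "T > 0" and s: "0 < s" "s \<le> 4"
    and spec: "\<And>n. n \<in> S \<Longrightarrow> \<exists>g \<beta>. modulated_spectrum (prime_factors n) g s \<beta> (h n) (c n)"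
    and E: "\<And>n. n \<in> S \<Longrightarrow> quad_sum (c n) (r n) (t n) = of_real (E n)"
    and r: "((\<lambda>n. of_int (r n) / (real s * real n)) \<longlongrightarrow> R) (at_top_in S)"
    and t: "((\<lambda>n. real (t n) / (real s * real n)) \<longlongrightarrow> T) (at_top_in S)"
    and h: "((\<lambda>n. of_int (h n) / (real s * real n)) \<longlongrightarrow> 2 * H) (at_top_in S)"
  shows "((\<lambda>n. E n / real (t n) ^ 2) \<longlongrightarrow> 1 + limit_denominator (R + H) T) (at_top_in S)"
proof -
  let ?F = "at_top_in S"
  define m where "m n = s * n" for n
  have rm: "real (m n) = real s * real n" for n by (simp add: m_def)
  define q where "q n = int (t n) - 1 + 2 * r n + h n" for n
  let ?P = "\<lambda>n q. \<Sum>u\<in>shifts (t n). of_bool (int (m n) dvd u + q) * (real (t n) - real_of_int \<bar>u\<bar>) ^ 2"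
  define M where "M n = ?P n (q n) + 2 * ?P n 0 - 2 / real (m n) * ((2 * real (t n) ^ 3 + real (t n)) / 3)" for n
  define err where "err n = 3 * ((T + 1) * (T + 1 + 4)) ^ 2 * ((exp (17 * real (omega n) / sqrt (real (kappa n))) - 1) * (1 + ln (real (s * n))) ^ 2)
    + ((T + 1 + 4) ^ 4 + 48 * (T + 1 + 4) ^ 3) * (38 ^ omega n * (1 + ln (real (s * n))) ^ 4 * real n powr (-1/16))" for n
  have err0: "(err \<longlongrightarrow> 0) ?F"
  proof -
    have "(err \<longlongrightarrow> 3 * ((T + 1) * (T + 1 + 4)) ^ 2 * 0 + ((T + 1 + 4) ^ 4 + 48 * (T + 1 + 4) ^ 3) * 0) ?F"
      unfolding err_def[abs_def]
      by (intro tendsto_add tendsto_mult_left paired_error_limit unpaired_error_limit s)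
    then show ?thesis by simp
  qed
  have mpos: "\<forall>\<^sub>F n in ?F. m n > 0"
    using eventually_in_S
  proof eventually_elim
    case (elim n)
    then show ?case using S[OF elim] s by (simp add: m_def)
  qed
  have minf: "filterlim (\<lambda>n. real (m n)) at_top ?F"
  proof (rule filterlim_at_top_mono[OF real_at_top_in])
    have "n \<le> m n" for n using s by (simp add: m_def)
    then show "\<forall>\<^sub>F n in ?F. real n \<le> real (m n)" by (intro always_eventually allI of_nat_mono)
  qed
  have tm: "((\<lambda>n. real (t n) / real (m n)) \<longlongrightarrow> T) ?F" using t by (simp only: rm)
  have minv: "((\<lambda>n. 1 / real (m n)) \<longlongrightarrow> 0) ?F"
    using tendsto_inverse_0_at_top[OF minf] by (simp add: inverse_eq_divide)
  have qm: "((\<lambda>n. of_int (q n) / real (m n)) \<longlongrightarrow> T + 2 * (R + H)) ?F"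
  proof -
    have "((\<lambda>n. real (t n) / real (m n) - 1 / real (m n) + 2 * (of_int (r n) / real (m n)) + of_int (h n) / real (m n))
      \<longlongrightarrow> T - 0 + 2 * R + 2 * H) ?F"
      using r h unfolding rm[symmetric] by (intro tendsto_intros tm minv)
    moreover have "of_int (q n) / real (m n) = real (t n) / real (m n) - 1 / real (m n) + 2 * (of_int (r n) / real (m n)) + of_int (h n) / real (m n)" for n
      by (simp add: q_def add_divide_distrib diff_divide_distrib)
    moreover have "T - 0 + 2 * R + 2 * H = T + 2 * (R + H)" by simp
    ultimately show ?thesis by (simp only:)
  qed
  have tpos: "\<forall>\<^sub>F n in ?F. t n > 0"
    using order_tendstoD(1)[OF tm T] by eventually_elim (auto simp: zero_less_divide_iff)
  have P1: "((\<lambda>n. ?P n (q n) / real (t n) ^ 2) \<longlongrightarrow> tent_sum (T + 2 * (R + H)) T) ?F"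
    by (rule progression_limit[OF T tm qm mpos])
  have P2: "((\<lambda>n. ?P n 0 / real (t n) ^ 2) \<longlongrightarrow> tent_sum 0 T) ?F"
    by (rule progression_limit[OF T tm _ mpos]) simp
  have C: "((\<lambda>n. 2 / real (m n) * ((2 * real (t n) ^ 3 + real (t n)) / 3) / real (t n) ^ 2) \<longlongrightarrow> 4 * T / 3) ?F"
  proof -
    have "((\<lambda>n. 4 / 3 * (real (t n) / real (m n)) + 2 / 3 * (1 / real (m n)) * (1 / real (m n)) / (real (t n) / real (m n)))
       \<longlongrightarrow> 4 / 3 * T + 2 / 3 * 0 * 0 / T) ?F"
      using T by (intro tendsto_intros tm minv) auto
    moreover have "\<forall>\<^sub>F n in ?F. 4 / 3 * (real (t n) / real (m n)) + 2 / 3 * (1 / real (m n)) * (1 / real (m n)) / (real (t n) / real (m n))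
      = 2 / real (m n) * ((2 * real (t n) ^ 3 + real (t n)) / 3) / real (t n) ^ 2"
      using tpos mpos by eventually_elim (simp add: field_simps power2_eq_square power3_eq_cube)
    ultimately show ?thesis by (simp add: tendsto_cong)
  qed
  have "((\<lambda>n. ?P n (q n) / real (t n) ^ 2 + 2 * (?P n 0 / real (t n) ^ 2) - 2 / real (m n) * ((2 * real (t n) ^ 3 + real (t n)) / 3) / real (t n) ^ 2)
    \<longlongrightarrow> tent_sum (T + 2 * (R + H)) T + 2 * tent_sum 0 T - 4 * T / 3) ?F"
    by (intro tendsto_add tendsto_diff tendsto_mult tendsto_const P1 P2 C)
  then have Mlim: "((\<lambda>n. M n / real (t n) ^ 2) \<longlongrightarrow> 1 + limit_denominator (R + H) T) ?F"
    by (simp add: M_def add_divide_distrib diff_divide_distrib limit_denominator_eq[OF T] algebra_simps)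
  have close: "\<forall>\<^sub>F n in ?F. \<bar>E n / real (t n) ^ 2 - M n / real (t n) ^ 2\<bar> \<le> err n / (real (t n) / real (m n)) ^ 2"
  proof -
    have "\<forall>\<^sub>F n in ?F. real (t n) / real (m n) < T + 1" using order_tendstoD(2)[OF tm] by simp
    with eventually_in_S tpos mpos show ?thesis
    proof eventually_elim
      case (elim n)
      have n: "n > 1" "odd n" "squarefree n" using S elim by auto
      have Q: "\<Prod>(prime_factors n) = n" by (rule prod_prime_factors_squarefree[OF n(3)])
      obtain g \<beta> where ms: "modulated_spectrum (prime_factors n) g s \<beta> (h n) (c n)" using spec elim by blast
      have k: "0 < real (kappa n)" "\<And>p. p \<in> prime_factors n \<Longrightarrow> real (kappa n) \<le> real p"
        using kappa_facts(1,2)[OF n(1)] by simp_all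
      have tle: "real (t n) \<le> (T + 1) * real (s * \<Prod>(prime_factors n))"
        unfolding Q using elim by (simp add: m_def divide_less_eq)
      have Mn: "modulated_spectrum.main_count (prime_factors n) s (h n) (r n) (t n) = M n"
      proof -
        have "(\<Sum>(j1, j2, j3, j4)\<in>quads (t n). of_bool (int (m n) dvd j1 + j2 + 2 * r n + h n)) = ?P n (q n)"
          unfolding count_by_sum[where P = "\<lambda>u. int (m n) dvd u + 2 * r n + h n"] q_def
          by (intro sum.cong refl) (simp add: algebra_simps)
        then show ?thesis
          unfolding modulated_spectrum.main_count_def[OF ms] Q M_def m_def[symmetric] card_quads
            count_by_difference[where P = "\<lambda>u. int (m n) dvd u"] count_by_difference'[where P = "\<lambda>u. int (m n) dvd u"]
          by simp
      qed
      have "norm (complex_of_real (E n) - of_real (M n)) \<le> real (m n) ^ 2 * err n"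
        using modulated_spectrum.quad_sum_approx[OF ms k(1) k(2) _ tle, of "r n"] elim
        unfolding Mn E[OF elim(1)] Q by (simp add: err_def m_def omega_def)
      then have "\<bar>E n - M n\<bar> \<le> real (m n) ^ 2 * err n"
        by (simp only: of_real_diff[symmetric] norm_of_real)
      then have "\<bar>E n - M n\<bar> / real (t n) ^ 2 \<le> real (m n) ^ 2 * err n / real (t n) ^ 2"
        by (intro divide_right_mono) auto
      then show ?case by (simp add: diff_divide_distrib[symmetric] abs_divide power_divide mult.commute)
    qed
  qed
  have "((\<lambda>n. err n / (real (t n) / real (m n)) ^ 2) \<longlongrightarrow> 0 / T ^ 2) ?F"
    using T by (intro tendsto_intros err0 tm) auto
  then have g0: "((\<lambda>n. err n / (real (t n) / real (m n)) ^ 2) \<longlongrightarrow> 0) ?F" by (simp only: div_0)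
  have "((\<lambda>n. E n / real (t n) ^ 2 - M n / real (t n) ^ 2) \<longlongrightarrow> 0) ?F"
    by (rule Lim_null_comparison[OF _ g0]) (use close in \<open>simp only: real_norm_def\<close>)
  from tendsto_add[OF this Mlim] show ?thesis by simp
qed

text \<open>
  The numbers \<open>1/F\<close> converge by \<open>energy_limit\<close>; to pass to \<open>F\<close>, their limit must be nonzero. For \<open>T > 1\<close> this
  is read off from the sequences themselves, by \<open>quad_energy_ge\<close>.
\<close>

lemma merit_factor_limit:
  fixes t :: "nat \<Rightarrow> nat" and r h :: "nat \<Rightarrow> int" and x :: "nat \<Rightarrow> int \<Rightarrow> int" and B :: "nat \<Rightarrow> int list"
  assumes inf: "infinite S" and T: "T > 0" and s: "0 < s" "s \<le> 4" and \<epsilon>: "\<epsilon> * \<epsilon> = 1"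
    and spec: "\<And>n. n \<in> S \<Longrightarrow> \<exists>g \<beta>. modulated_spectrum (prime_factors n) g s \<beta> (h n) (\<lambda>j. of_int (x n j) * ee (of_int j * \<theta>))"
    and x: "\<And>n j. n \<in> S \<Longrightarrow> x n j = 1 \<or> x n j = -1"
    and per: "\<And>n j. n \<in> S \<Longrightarrow> x n j * x n (j + int (s * n)) = \<epsilon>"
    and B: "\<And>n j. n \<in> S \<Longrightarrow> periodic_ext (B n) j = x n j"
    and r: "((\<lambda>n. of_int (r n) / (real s * real n)) \<longlongrightarrow> R) (at_top_in S)"
    and t: "((\<lambda>n. real (t n) / (real s * real n)) \<longlongrightarrow> T) (at_top_in S)"
    and h: "((\<lambda>n. of_int (h n) / (real s * real n)) \<longlongrightarrow> 2 * H) (at_top_in S)"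
  shows "((\<lambda>n. merit_factor (rotate_resize (B n) (r n) (t n))) \<longlongrightarrow> limit_merit (R + H) T) (at_top_in S)"
proof -
  let ?F = "at_top_in S"
  let ?E = "\<lambda>n. quad_energy (x n) (r n) (t n)"
  let ?L = "limit_denominator (R + H) T"
  have lim: "((\<lambda>n. ?E n / real (t n) ^ 2) \<longlongrightarrow> 1 + ?L) ?F"
    by (rule energy_limit[OF T s spec quad_sum_modulated[where \<theta> = \<theta>] r t h]) simp_all
  have nb: "?F \<noteq> bot" by (rule at_top_in_nontrivial[OF inf])
  have tpos: "\<forall>\<^sub>F n in ?F. t n > 0"
    using order_tendstoD(1)[OF t T] by eventually_elim (auto simp: zero_less_divide_iff)
  have "?L > 0"
  proof (cases "T \<le> 1")
    case True
    then show ?thesis using T by (intro limit_denominator_pos_short)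
  next
    case False
    have "1 + 2 * (1 - 1 / T) ^ 2 \<le> 1 + ?L"
    proof (rule tendsto_le[OF nb lim])
      show "((\<lambda>n. 1 + 2 * (1 - 1 / (real (t n) / (real s * real n))) ^ 2) \<longlongrightarrow> 1 + 2 * (1 - 1 / T) ^ 2) ?F"
        using T by (intro tendsto_intros t) auto
      have "\<forall>\<^sub>F n in ?F. 1 < real (t n) / (real s * real n)" using order_tendstoD(1)[OF t, of 1] False by simp
      with eventually_in_S tpos
      show "\<forall>\<^sub>F n in ?F. 1 + 2 * (1 - 1 / (real (t n) / (real s * real n))) ^ 2 \<le> ?E n / real (t n) ^ 2"
      proof eventually_elim
        case (elim n)
        have sn: "0 < s * n" using S[OF elim(1)] s by simp
        then have "real (s * n) < real (t n)" using elim(3) by (simp add: less_divide_eq)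
        then have "s * n < t n" by linarith
        then have "real (t n) ^ 2 + 2 * (real (t n) - real (s * n)) ^ 2 \<le> ?E n"
          using quad_energy_ge[where x = "x n", OF x[OF elim(1)] sn _ per[OF elim(1)] \<epsilon>] by blast
        then have "(real (t n) ^ 2 + 2 * (real (t n) - real (s * n)) ^ 2) / real (t n) ^ 2 \<le> ?E n / real (t n) ^ 2"
          by (intro divide_right_mono) auto
        moreover have "(real (t n) ^ 2 + 2 * (real (t n) - real (s * n)) ^ 2) / real (t n) ^ 2
          = 1 + 2 * (1 - 1 / (real (t n) / (real s * real n))) ^ 2"
        proof -
          have "1 - 1 / (real (t n) / (real s * real n)) = (real (t n) - real (s * n)) / real (t n)"
            using elim(2) by (simp add: diff_divide_distrib)
          then show ?thesis using elim(2) by (simp add: power_divide add_divide_distrib)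
        qed
        ultimately show ?case by simp
      qed
    qed
    moreover have "0 < (1 - 1 / T) ^ 2" using False by simp
    ultimately show ?thesis by linarith
  qed
  then have "((\<lambda>n. 1 / (?E n / real (t n) ^ 2 - 1)) \<longlongrightarrow> 1 / (1 + ?L - 1)) ?F"
    by (intro tendsto_intros lim) auto
  moreover have "\<forall>\<^sub>F n in ?F. 1 / (?E n / real (t n) ^ 2 - 1) = merit_factor (rotate_resize (B n) (r n) (t n))"
    using eventually_in_S tpos
  proof eventually_elim
    case (elim n)
    show ?case
      by (rule merit_factor_rotate_resize[where x = "x n", OF x[OF elim(1)] elim(2) B[OF elim(1)], symmetric])
  qed
  ultimately show ?thesis unfolding limit_merit_eq by (simp add: tendsto_cong)
qed

end

section \<open>The limits for the three families\<close>

lemma jac_shift: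
  assumes "odd n" "squarefree n"
  shows "jac (prime_factors n) (j + int (s * n)) = jac (prime_factors n) j"
proof -
  have "periodic (\<Prod>(prime_factors n)) (jac (prime_factors n))"
    by (rule periodic_jac[OF finite_set_mset odd_prime_factor[OF assms(1)]])
  then have per: "periodic n (jac (prime_factors n))"
    by (simp only: prod_prime_factors_squarefree[OF assms(2)])
  show ?thesis by (rule periodic_congD[OF per]) (simp add: cong_def)
qed

theorem theorem2p3:
  fixes S :: "nat set" and R T :: real and r :: "nat \<Rightarrow> int" and t :: "nat \<Rightarrow> nat"
  assumes "infinite S"
    and "\<And>n. n \<in> S \<Longrightarrow> n > 1 \<and> odd n \<and> squarefree n"
    and "((\<lambda>n. max (4 ^ omega n * ln (real n) ^ 6) (5 ^ omega n) / real (kappa n)) \<longlongrightarrow> 0) (at_top_in S)"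
    and "T > 0"
  shows
    "((((\<lambda>n. real_of_int (r n) / real n) \<longlongrightarrow> R) (at_top_in S) \<and>
       ((\<lambda>n. real (t n) / real n) \<longlongrightarrow> T) (at_top_in S)) \<longrightarrow>
      ((\<lambda>n. merit_factor (rotate_resize (Jacobi_seq n) (r n) (t n))) \<longlongrightarrow> limit_merit R T) (at_top_in S)) \<and>
     ((((\<lambda>n. real_of_int (r n) / (2 * real n)) \<longlongrightarrow> R) (at_top_in S) \<and>
       ((\<lambda>n. real (t n) / (2 * real n)) \<longlongrightarrow> T) (at_top_in S)) \<longrightarrow>
      ((\<lambda>n. merit_factor (rotate_resize (N_seq (Jacobi_seq n)) (r n) (t n)))
         \<longlongrightarrow> limit_merit (R + 1 / 4) T) (at_top_in S)) \<and>
     ((((\<lambda>n. real_of_int (r n) / (4 * real n)) \<longlongrightarrow> R) (at_top_in S) \<and>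
       ((\<lambda>n. real (t n) / (4 * real n)) \<longlongrightarrow> T) (at_top_in S)) \<longrightarrow>
      ((\<lambda>n. merit_factor (rotate_resize (P_seq (Jacobi_seq n)) (r n) (t n)))
         \<longlongrightarrow> limit_merit R T) (at_top_in S))"
proof -
  note S = assms(2)
  note lim = merit_factor_limit[OF assms(2,3,1,4)]
  have jac: "jac (prime_factors n) j = 1 \<or> jac (prime_factors n) j = -1" if "n \<in> S" for n j
    using S[OF that] by (intro jac_pm1 odd_prime_factor) auto
  have jac_sq: "jac (prime_factors n) j * jac (prime_factors n) j = 1" if "n \<in> S" for n j
    using jac[OF that, of j] by auto
  have "((\<lambda>n. merit_factor (rotate_resize (Jacobi_seq n) (r n) (t n))) \<longlongrightarrow> limit_merit R T) (at_top_in S)"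
    if "((\<lambda>n. real_of_int (r n) / real n) \<longlongrightarrow> R) (at_top_in S)" "((\<lambda>n. real (t n) / real n) \<longlongrightarrow> T) (at_top_in S)"
  proof -
    have "((\<lambda>n. merit_factor (rotate_resize (Jacobi_seq n) (r n) (t n))) \<longlongrightarrow> limit_merit (R + 0) T) (at_top_in S)"
    proof (rule lim[where s = 1 and \<epsilon> = 1 and \<theta> = 0 and h = "\<lambda>_. 0" and x = "\<lambda>n. jac (prime_factors n)"])
      fix n j assume n: "n \<in> S"
      show "\<exists>g \<beta>. modulated_spectrum (prime_factors n) g 1 \<beta> 0 (\<lambda>j. of_int (jac (prime_factors n) j) * ee (of_int j * 0))"
        using jacobi_modulated_spectrum[of n] S[OF n] by simp
      show "jac (prime_factors n) j * jac (prime_factors n) (j + int (1 * n)) = 1"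
        using jac_sq[OF n, of j] jac_shift[of n j 1] S[OF n] by simp
      show "periodic_ext (Jacobi_seq n) j = jac (prime_factors n) j"
        using Jacobi_seq_eq_jac[of n] S[OF n] by simp
    qed (use that jac in simp_all)
    then show ?thesis by simp
  qed
  moreover have "((\<lambda>n. merit_factor (rotate_resize (N_seq (Jacobi_seq n)) (r n) (t n))) \<longlongrightarrow> limit_merit (R + 1 / 4) T) (at_top_in S)"
    if "((\<lambda>n. real_of_int (r n) / (2 * real n)) \<longlongrightarrow> R) (at_top_in S)" "((\<lambda>n. real (t n) / (2 * real n)) \<longlongrightarrow> T) (at_top_in S)"
  proof (rule lim[where s = 2 and \<epsilon> = "-1" and \<theta> = "1/4" and h = int and x = "\<lambda>n j. sigma_N j * jac (prime_factors n) j"])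
    fix n j assume n: "n \<in> S"
    have "(\<lambda>j. of_int (sigma_N j * jac (prime_factors n) j) * ee (of_int j * (1/4))) = (\<lambda>j. tau_N j * of_int (jac (prime_factors n) j))"
      by (rule ext) (simp add: tau_N_modulation)
    then show "\<exists>g \<beta>. modulated_spectrum (prime_factors n) g 2 \<beta> (int n) (\<lambda>j. of_int (sigma_N j * jac (prime_factors n) j) * ee (of_int j * (1/4)))"
      using N_modulated_spectrum[of n] S[OF n] by simp
    have "sigma_N j * sigma_N (j + int (2 * n)) = -1"
    proof -
      obtain k where "n = 2 * k + 1" using S[OF n] by (auto elim: oddE)
      then have "j + int (2 * n) = j + 2 + int k * 4" by simp
      then have "(j + int (2 * n)) mod 4 = (j + 2) mod 4" by (simp only: mod_mult_self1)
      moreover have "j mod 4 = 0 \<or> j mod 4 = 1 \<longleftrightarrow> \<not> ((j + 2) mod 4 = 0 \<or> (j + 2) mod 4 = 1)" by presburger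
      ultimately show ?thesis by (auto simp: sigma_N_def)
    qed
    then show "sigma_N j * jac (prime_factors n) j * (sigma_N (j + int (2 * n)) * jac (prime_factors n) (j + int (2 * n))) = -1"
      using jac_sq[OF n, of j] jac_shift[of n j 2] S[OF n] by (simp add: mult_ac) (metis mult.left_commute mult.right_neutral)
    show "sigma_N j * jac (prime_factors n) j = 1 \<or> sigma_N j * jac (prime_factors n) j = -1"
      using jac[OF n, of j] by (auto simp: sigma_N_def)
    show "periodic_ext (N_seq (Jacobi_seq n)) j = sigma_N j * jac (prime_factors n) j"
      using N_seq_eq[of n] S[OF n] by simp
  next
    have "\<forall>\<^sub>F n in at_top_in S. 2 * (1 / 4) = real_of_int (int n) / (real 2 * real n)"
      using eventually_in_S by eventually_elim (use S in force)
    then show "((\<lambda>n. real_of_int (int n) / (real 2 * real n)) \<longlongrightarrow> 2 * (1 / 4)) (at_top_in S)"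
      by (rule Lim_transform_eventually[OF tendsto_const])
  qed (use that in simp_all)
  moreover have "((\<lambda>n. merit_factor (rotate_resize (P_seq (Jacobi_seq n)) (r n) (t n))) \<longlongrightarrow> limit_merit R T) (at_top_in S)"
    if "((\<lambda>n. real_of_int (r n) / (4 * real n)) \<longlongrightarrow> R) (at_top_in S)" "((\<lambda>n. real (t n) / (4 * real n)) \<longlongrightarrow> T) (at_top_in S)"
  proof -
    have "((\<lambda>n. merit_factor (rotate_resize (P_seq (Jacobi_seq n)) (r n) (t n))) \<longlongrightarrow> limit_merit (R + 0) T) (at_top_in S)"
    proof (rule lim[where s = 4 and \<epsilon> = 1 and \<theta> = 0 and h = "\<lambda>_. 0" and x = "\<lambda>n j. sigma_P j * jac (prime_factors n) j"])
      fix n j assume n: "n \<in> S"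
      show "\<exists>g \<beta>. modulated_spectrum (prime_factors n) g 4 \<beta> 0 (\<lambda>j. of_int (sigma_P j * jac (prime_factors n) j) * ee (of_int j * 0))"
        using P_modulated_spectrum[of n] S[OF n] by simp
      have "(j + int (4 * n)) mod 4 = j mod 4" by simp
      then have "sigma_P j * sigma_P (j + int (4 * n)) = 1" unfolding sigma_P_def by simp
      then show "sigma_P j * jac (prime_factors n) j * (sigma_P (j + int (4 * n)) * jac (prime_factors n) (j + int (4 * n))) = 1"
        using jac_sq[OF n, of j] jac_shift[of n j 4] S[OF n] by (simp add: mult_ac) (metis mult.left_commute mult.right_neutral)
      show "sigma_P j * jac (prime_factors n) j = 1 \<or> sigma_P j * jac (prime_factors n) j = -1"
        using jac[OF n, of j] by (auto simp: sigma_P_def)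
      show "periodic_ext (P_seq (Jacobi_seq n)) j = sigma_P j * jac (prime_factors n) j"
        using P_seq_eq[of n] S[OF n] by simp
    qed (use that in simp_all)
    then show ?thesis by simp
  qed
  ultimately show ?thesis by blast
qed

end
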